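(* Let $M$ be a parabolic manifold with boundary $\partial M\neq\emptyset$. If $u\in C^{0}(M)\cap W^{1,2}_{loc}(\mathrm{int}M)$ satisfies $$\Delta u\geq 0\ \text{ on }\mathrm{int}M,\qquad \sup_M u<+\infty,$$ then $$\sup_M u=\sup_{\partial M}u .$$
   Context: $M$ is an oriented Riemannian manifold with smooth boundary $\partial M$, $\nu$ its exterior unit normal, $\mathrm{int}M=M\setminus\partial M$. A function $u\in W^{1,2}_{loc}(M)$ (local Sobolev regularity up to the boundary) is a weak Neumann solution of $\Delta u\ge0$ on $M$, $\partial u/\partial\nu\le 0$ on $\partial M$ if $-\int_M\langle\nabla u,\nabla\varphi\rangle\ge 0$ for every $0\le\varphi\in C^\infty_c(M)$, where $\varphi$ need not vanish on $\partial M$. $M$ is called parabolic if every $u\in C^0(M)\cap W^{1,2}_{loc}(M)$ which is such a weak Neumann solution and satisfies $\sup_M u<+\infty$ is constant. In the claim, the inequality $\Delta u\ge 0$ on $\mathrm{int}M$ is meant weakly: $-\int_{M}\langle\nabla u,\nabla\varphi\rangle\ge 0$ for every $0\le\varphi\in C_c^\infty(\mathrm{int}M)$; no condition on the normal derivative of $u$ is imposed. *)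

theory Defs
  imports "HOL-Analysis.Analysis"
begin

section \<open>Smooth functions\<close>

fun Ck_on :: "nat \<Rightarrow> 'a::real_normed_vector set \<Rightarrow> ('a \<Rightarrow> 'b::real_normed_vector) \<Rightarrow> bool" where
  "Ck_on 0 T f \<longleftrightarrow> continuous_on T f"
| "Ck_on (Suc k) T f \<longleftrightarrow>
     (\<forall>x\<in>T. f differentiable (at x)) \<and>
     (\<forall>v. Ck_on k T (\<lambda>x. frechet_derivative f (at x) v))"

text \<open>\<^const>\<open>Ck_on\<close> is meant for open sets only.  On a relatively open subset of a half-space,
  smoothness means that the function extends locally to a smooth function on an open set of the
  whole space; derivatives at points of the bounding hyperplane are then those of any extension, i.e.
  the derivatives \<open>at x within S\<close>, which are unique there.\<close>

definition smooth_on :: "'a::real_normed_vector set \<Rightarrow> ('a \<Rightarrow> 'b::real_normed_vector) \<Rightarrow> bool" where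
  "smooth_on S f \<longleftrightarrow>
     (\<forall>x\<in>S. \<exists>T F. open T \<and> x \<in> T \<and> (\<forall>k. Ck_on k T F) \<and> (\<forall>y\<in>S \<inter> T. F y = f y))"

section \<open>Manifolds with boundary\<close>

text \<open>The underlying space is a whole type \<open>'m\<close>, whose classes provide the Hausdorff and second
  countability axioms; the dimension is \<open>CARD('n)\<close>.  The model half-space is cut out by one
  coordinate, fixed once and for all.\<close>

definition bdry_coord :: "'n::finite" where
  "bdry_coord = (SOME i. True)"

definition half_space :: "(real^'n) set" where
  "half_space = {x. 0 \<le> x $ bdry_coord}"

text \<open>A chart is a pair of an open domain and a map, which is only relevant on that domain.\<close>

type_synonym ('m, 'n) chart = "'m set \<times> ('m \<Rightarrow> (real, 'n) vec)"

definition chart_inv :: "('m, 'n::finite) chart \<Rightarrow> real^'n \<Rightarrow> 'm" where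
  "chart_inv c = inv_into (fst c) (snd c)"

definition is_chart :: "('m::topological_space, 'n::finite) chart \<Rightarrow> bool" where
  "is_chart c \<longleftrightarrow>
     open (fst c) \<and>
     openin (top_of_set half_space) (snd c ` fst c) \<and>
     homeomorphism (fst c) (snd c ` fst c) (snd c) (chart_inv c)"

definition smooth_atlas :: "('m::topological_space, 'n::finite) chart set \<Rightarrow> bool" where
  "smooth_atlas A \<longleftrightarrow>
     (\<forall>c\<in>A. is_chart c) \<and>
     (\<Union>c\<in>A. fst c) = UNIV \<and>
     (\<forall>c\<in>A. \<forall>c'\<in>A. smooth_on (snd c ` (fst c \<inter> fst c')) (snd c' \<circ> chart_inv c))"

definition bdry :: "('m, 'n::finite) chart set \<Rightarrow> 'm set" where
  "bdry A = {p. \<exists>c\<in>A. p \<in> fst c \<and> snd c p $ bdry_coord = 0}"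

definition int_mfd :: "('m, 'n::finite) chart set \<Rightarrow> 'm set" where
  "int_mfd A = UNIV - bdry A"

text \<open>The Jacobian matrix, at the point \<open>p\<close>, of the transition map from \<open>c\<close> to \<open>c'\<close>.\<close>

definition jacobian :: "('m, 'n::finite) chart \<Rightarrow> ('m, 'n) chart \<Rightarrow> 'm \<Rightarrow> real^'n^'n" where
  "jacobian c c' p =
     matrix (frechet_derivative (snd c' \<circ> chart_inv c)
       (at (snd c p) within snd c ` (fst c \<inter> fst c')))"

text \<open>An orientation: \<open>\<theta> c p\<close> is \<open>1\<close> or \<open>-1\<close> according to whether the coordinate frame of \<open>c\<close> at
  \<open>p\<close> is positively or negatively oriented.  (Asking for an atlas with positive transition
  determinants would be too strong for the fixed half-space in dimension one.)\<close>

definition orientation ::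
    "('m::topological_space, 'n::finite) chart set \<Rightarrow> (('m, 'n) chart \<Rightarrow> 'm \<Rightarrow> real) \<Rightarrow> bool" where
  "orientation A \<theta> \<longleftrightarrow>
     (\<forall>c\<in>A. continuous_on (fst c) (\<theta> c) \<and> (\<forall>p\<in>fst c. \<theta> c p \<in> {1, -1})) \<and>
     (\<forall>c\<in>A. \<forall>c'\<in>A. \<forall>p\<in>fst c \<inter> fst c'. \<theta> c' p = sgn (det (jacobian c c' p)) * \<theta> c p)"

text \<open>A Riemannian metric: \<open>G c p\<close> is the matrix \<open>(g\<^sub>i\<^sub>j)\<close> at \<open>p\<close> in the coordinates \<open>c\<close>.\<close>

definition riemannian_metric ::
    "('m::topological_space, 'n::finite) chart set \<Rightarrow> (('m, 'n) chart \<Rightarrow> 'm \<Rightarrow> real^'n^'n) \<Rightarrow> bool" where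
  "riemannian_metric A G \<longleftrightarrow>
     (\<forall>c\<in>A. smooth_on (snd c ` fst c) (G c \<circ> chart_inv c) \<and>
        (\<forall>p\<in>fst c. transpose (G c p) = G c p \<and> (\<forall>v. v \<noteq> 0 \<longrightarrow> 0 < v \<bullet> (G c p *v v)))) \<and>
     (\<forall>c\<in>A. \<forall>c'\<in>A. \<forall>p\<in>fst c \<inter> fst c'.
        G c p = transpose (jacobian c c' p) ** G c' p ** jacobian c c' p)"

definition oriented_riemannian_manifold ::
    "('m::{t2_space,second_countable_topology}, 'n::finite) chart set \<Rightarrow>
     (('m, 'n) chart \<Rightarrow> 'm \<Rightarrow> real) \<Rightarrow> (('m, 'n) chart \<Rightarrow> 'm \<Rightarrow> real^'n^'n) \<Rightarrow> bool" where
  "oriented_riemannian_manifold A \<theta> G \<longleftrightarrow>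
     smooth_atlas A \<and> orientation A \<theta> \<and> riemannian_metric A G"

text \<open>The unique Borel measure that is \<open>sqrt (det g\<^sub>i\<^sub>j) dx\<close> in every chart; existence is the change of
  variables formula, uniqueness holds because countably many charts cover the manifold.\<close>

definition riemannian_volume ::
    "('m::topological_space, 'n::finite) chart set \<Rightarrow> (('m, 'n) chart \<Rightarrow> 'm \<Rightarrow> real^'n^'n) \<Rightarrow>
     'm measure" where
  "riemannian_volume A G = (THE \<mu>. sets \<mu> = sets borel \<and>
     (\<forall>c\<in>A. \<forall>B\<in>sets borel. B \<subseteq> fst c \<longrightarrow>
        emeasure \<mu> B =
          (\<integral>\<^sup>+x. ennreal (sqrt (det (G c (chart_inv c x)))) * indicator (snd c ` B) x \<partial>lborel)))"

section \<open>Differentials, weak differentials and local Sobolev functions\<close>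

text \<open>Covector fields are given by their components in each chart.  The transformation law is imposed
  at every point, so that pairings with covector fields do not depend on the chart chosen.\<close>

definition covector_field ::
    "('m, 'n::finite) chart set \<Rightarrow> (('m, 'n) chart \<Rightarrow> 'm \<Rightarrow> real^'n) \<Rightarrow> bool" where
  "covector_field A \<omega> \<longleftrightarrow>
     (\<forall>c\<in>A. \<forall>c'\<in>A. \<forall>p\<in>fst c \<inter> fst c'. \<omega> c p = transpose (jacobian c c' p) *v \<omega> c' p)"

definition differential :: "('m \<Rightarrow> real) \<Rightarrow> ('m, 'n::finite) chart \<Rightarrow> 'm \<Rightarrow> real^'n" where
  "differential \<phi> c p =
     (\<chi> i. frechet_derivative (\<phi> \<circ> chart_inv c) (at (snd c p) within snd c ` fst c) (axis i 1))"

text \<open>The inner product of the gradients, \<open>g\<^sup>i\<^sup>j \<omega>\<^sub>i \<eta>\<^sub>j\<close>, computed in some chart around \<open>p\<close>.\<close>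

definition grad_inner ::
    "('m, 'n::finite) chart set \<Rightarrow> (('m, 'n) chart \<Rightarrow> 'm \<Rightarrow> real^'n^'n) \<Rightarrow>
     (('m, 'n) chart \<Rightarrow> 'm \<Rightarrow> real^'n) \<Rightarrow> (('m, 'n) chart \<Rightarrow> 'm \<Rightarrow> real^'n) \<Rightarrow> 'm \<Rightarrow> real" where
  "grad_inner A G \<omega> \<eta> p =
     (let c = (SOME c. c \<in> A \<and> p \<in> fst c) in \<omega> c p \<bullet> (matrix_inv (G c p) *v \<eta> c p))"

definition weak_gradient_on ::
    "(real^'n) set \<Rightarrow> (real^'n \<Rightarrow> real) \<Rightarrow> (real^'n \<Rightarrow> real^'n) \<Rightarrow> bool" where
  "weak_gradient_on V f w \<longleftrightarrow>
     (\<forall>\<psi>. (\<forall>k. Ck_on k UNIV \<psi>) \<and> compact (closure {x. \<psi> x \<noteq> 0}) \<and>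
          closure {x. \<psi> x \<noteq> 0} \<subseteq> V \<longrightarrow>
        (\<forall>i. (\<integral>x. f x * frechet_derivative \<psi> (at x) (axis i 1) \<partial>lborel) =
             - (\<integral>x. w x $ i * \<psi> x \<partial>lborel)))"

definition L2_loc :: "(real^'n) set \<Rightarrow> (real^'n \<Rightarrow> 'b::euclidean_space) \<Rightarrow> bool" where
  "L2_loc V f \<longleftrightarrow>
     set_borel_measurable lborel V f \<and>
     (\<forall>K. compact K \<and> K \<subseteq> V \<longrightarrow> set_integrable lborel K (\<lambda>x. (norm (f x))\<^sup>2))"

text \<open>\<open>u\<close> belongs to \<open>W\<^sup>1\<^sup>,\<^sup>2\<^sub>l\<^sub>o\<^sub>c(S)\<close>, with weak differential \<open>\<omega>\<close>.  Here \<open>S\<close> is the whole manifold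
  (then the bounds hold up to the boundary, since the compact sets in \<^const>\<open>L2_loc\<close> may meet the bounding
  hyperplane) or its interior.  The differential is always tested on the interior of the chart image,
  taken in the whole space, i.e. away from the boundary.\<close>

definition weak_differential ::
    "('m, 'n::finite) chart set \<Rightarrow> 'm set \<Rightarrow> ('m \<Rightarrow> real) \<Rightarrow> (('m, 'n) chart \<Rightarrow> 'm \<Rightarrow> real^'n) \<Rightarrow> bool"
  where
  "weak_differential A S u \<omega> \<longleftrightarrow>
     covector_field A \<omega> \<and>
     (\<forall>c\<in>A. L2_loc (snd c ` (fst c \<inter> S)) (u \<circ> chart_inv c) \<and>
            L2_loc (snd c ` (fst c \<inter> S)) (\<omega> c \<circ> chart_inv c) \<and>
            weak_gradient_on (interior (snd c ` (fst c \<inter> S))) (u \<circ> chart_inv c) (\<omega> c \<circ> chart_inv c))"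

definition W12_loc :: "('m, 'n::finite) chart set \<Rightarrow> 'm set \<Rightarrow> ('m \<Rightarrow> real) \<Rightarrow> bool" where
  "W12_loc A S u \<longleftrightarrow> (\<exists>\<omega>. weak_differential A S u \<omega>)"

section \<open>Weak subsolutions and parabolicity\<close>

text \<open>Smooth functions with compact support contained in \<open>S\<close>; for \<open>S = UNIV\<close> they need not vanish on
  the boundary.\<close>

definition test_function ::
    "('m::topological_space, 'n::finite) chart set \<Rightarrow> 'm set \<Rightarrow> ('m \<Rightarrow> real) \<Rightarrow> bool" where
  "test_function A S \<phi> \<longleftrightarrow>
     (\<forall>c\<in>A. smooth_on (snd c ` fst c) (\<phi> \<circ> chart_inv c)) \<and>
     compact (closure {p. \<phi> p \<noteq> 0}) \<and> closure {p. \<phi> p \<noteq> 0} \<subseteq> S"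

text \<open>The weak differential is unique almost everywhere, so the existential quantifier merely names it.\<close>

definition weakly_subharmonic ::
    "('m::topological_space, 'n::finite) chart set \<Rightarrow> (('m, 'n) chart \<Rightarrow> 'm \<Rightarrow> real^'n^'n) \<Rightarrow>
     'm set \<Rightarrow> ('m \<Rightarrow> real) \<Rightarrow> bool" where
  "weakly_subharmonic A G S u \<longleftrightarrow>
     (\<exists>\<omega>. weak_differential A S u \<omega> \<and>
       (\<forall>\<phi>. test_function A S \<phi> \<and> (\<forall>p. 0 \<le> \<phi> p) \<longrightarrow>
          - (\<integral>p. grad_inner A G \<omega> (differential \<phi>) p \<partial>riemannian_volume A G) \<ge> 0))"

definition weak_neumann_subsolution ::
    "('m::topological_space, 'n::finite) chart set \<Rightarrow> (('m, 'n) chart \<Rightarrow> 'm \<Rightarrow> real^'n^'n) \<Rightarrow>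
     ('m \<Rightarrow> real) \<Rightarrow> bool" where
  "weak_neumann_subsolution A G u \<longleftrightarrow> weakly_subharmonic A G UNIV u"

definition parabolic ::
    "('m::topological_space, 'n::finite) chart set \<Rightarrow> (('m, 'n) chart \<Rightarrow> 'm \<Rightarrow> real^'n^'n) \<Rightarrow> bool" where
  "parabolic A G \<longleftrightarrow>
     (\<forall>u. continuous_on UNIV u \<and> W12_loc A UNIV u \<and> weak_neumann_subsolution A G u \<and>
          bdd_above (range u) \<longrightarrow> (\<exists>k. \<forall>p. u p = k))"

end

theory Submission
  imports Defs
begin

text \<open>If \<open>sup\<^bsub>\<partial>M\<^esub> u < s < sup\<^bsub>M\<^esub> u\<close>, then \<open>v = max u s\<close> is constant near the boundary, so it is a bounded
  weak Neumann subsolution on all of \<open>M\<close> as soon as it is subharmonic in the interior.  By parabolicity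
  \<open>v\<close> is constant, hence equal to its boundary value \<open>s\<close>, which contradicts \<open>s < sup\<^bsub>M\<^esub> u\<close>.

  Subharmonicity of \<open>v\<close> is obtained in a chart by testing the inequality for \<open>u\<close> with \<open>\<phi> \<eta>\<^sub>k(u\<^sub>j)\<close>,
  where \<open>u\<^sub>j\<close> are mollifications of \<open>u\<close> and \<open>\<eta>\<^sub>k\<close> are smooth increasing functions tending to the
  indicator function of \<open>{s<..}\<close>.  As \<open>j \<rightarrow> \<infinity>\<close> the term with \<open>\<eta>\<^sub>k'\<close> tends to a nonnegative energy,
  because the gradients of \<open>u\<^sub>j\<close> converge in \<open>L\<^sup>2\<close>; it can be dropped, and then \<open>k \<rightarrow> \<infinity>\<close>.\<close>

section \<open>Functions of class \<open>C\<^sup>k\<close>\<close>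

text \<open>The hypotheses on u say nothing at the boundary: the inequality is tested only by
  functions supported in the interior, and the weak differential is square integrable only on
  compact subsets of the interior. Since s lies strictly above the boundary supremum, the closed set
  \<open>{p. s \<le> u p}\<close> misses the boundary, so it meets the support of any test function
  on M in a compact subset of the interior. This one compactness fact yields both the L2 bound up to
  the boundary and the finite cover by cutoffs. The weak differential of v is \<omega> set to 0 off
  the strict set \<open>{p. s < u p}\<close>; as this restriction depends only on the point, the
  transformation law survives at every point. Two features of the definitions cost work. The volume
  is a definite description, so no integral over M can be evaluated before existence and uniqueness
  are established. The Bochner integral of a non-integrable function is 0, so an inequality that is
  to be added to another has to travel with integrability.\<close>

lemma Ck_on_cong:
  assumes "Ck_on k T f" "open T" "\<And>x. x \<in> T \<Longrightarrow> f x = g x"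
  shows "Ck_on k T g"
  using assms
proof (induction k arbitrary: f g)
  case 0
  then show ?case by (auto cong: continuous_on_cong)
next
  case (Suc k)
  have d: "g differentiable (at x)" if "x \<in> T" for x
  proof -
    from Suc.prems that obtain D where "(f has_derivative D) (at x)"
      by (auto simp: differentiable_def)
    then have "(g has_derivative D) (at x)"
      by (rule has_derivative_transform_within_open[OF _ Suc.prems(2) that Suc.prems(3)])
    then show ?thesis by (auto simp: differentiable_def)
  qed
  have e: "frechet_derivative f (at x) = frechet_derivative g (at x)" if "x \<in> T" for x
    using Suc.prems that by (intro frechet_derivative_transform_within_open[where X=T]) auto
  have "Ck_on k T (\<lambda>x. frechet_derivative g (at x) v)" for v
  proof (rule Suc.IH)
    show "Ck_on k T (\<lambda>x. frechet_derivative f (at x) v)" using Suc.prems by simp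
  qed (use Suc.prems e in auto)
  with d show ?case by simp
qed

lemma Ck_on_subset: "Ck_on k T f \<Longrightarrow> S \<subseteq> T \<Longrightarrow> Ck_on k S f"
  by (induction k arbitrary: f) (auto intro: continuous_on_subset)

lemma Ck_on_Suc_D: "Ck_on (Suc k) T f \<Longrightarrow> Ck_on k T f"
proof (induction k arbitrary: f)
  case 0
  then show ?case
    by (auto intro!: continuous_at_imp_continuous_on differentiable_imp_continuous_within)
next
  case (Suc k)
  then have "Ck_on k T (\<lambda>x. frechet_derivative f (at x) v)" for v
    by (intro Suc.IH) (simp only: Ck_on.simps(2), simp)
  with Suc.prems show ?case by (simp only: Ck_on.simps(2)) simp
qed

text \<open>Serves to glue a function from its chart expression on one open set and the zero
  function off a compact support.\<close>

lemma Ck_on_local: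
  assumes "\<And>x. x \<in> T \<Longrightarrow> \<exists>U. open U \<and> x \<in> U \<and> Ck_on k U f"
  shows "Ck_on k T f"
  using assms
proof (induction k arbitrary: f)
  case 0
  have "isCont f x" if x: "x \<in> T" for x
    using 0[OF x] by (auto simp: continuous_on_eq_continuous_at)
  then show ?case by (simp add: continuous_at_imp_continuous_on)
next
  case (Suc k)
  have "f differentiable (at x)" if "x \<in> T" for x
  proof -
    from Suc.prems[OF that] obtain U where "x \<in> U" "Ck_on (Suc k) U f" by blast
    then show ?thesis by simp
  qed
  moreover have "Ck_on k T (\<lambda>x. frechet_derivative f (at x) v)" for v
  proof (rule Suc.IH)
    fix x assume "x \<in> T"
    from Suc.prems[OF this] obtain U where "open U" "x \<in> U" "Ck_on (Suc k) U f" by blast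
    then show "\<exists>U. open U \<and> x \<in> U \<and> Ck_on k U (\<lambda>x. frechet_derivative f (at x) v)"
      by (intro exI[of _ U]) simp
  qed
  ultimately show ?case by simp
qed

lemma Ck_on_SucI:
  assumes "open T" "\<And>x. x \<in> T \<Longrightarrow> (f has_derivative f' x) (at x)"
    "\<And>v. Ck_on k T (\<lambda>x. f' x v)"
  shows "Ck_on (Suc k) T f"
proof -
  have "f' x = frechet_derivative f (at x)" if "x \<in> T" for x
    using assms(2)[OF that] by (rule frechet_derivative_at)
  then have "Ck_on k T (\<lambda>x. frechet_derivative f (at x) v)" for v
    by (intro Ck_on_cong[OF assms(3) assms(1)]) auto
  then show ?thesis using assms(2) by (auto simp: differentiable_def)
qed

lemma Ck_on_has_derivative:
  "Ck_on (Suc k) T f \<Longrightarrow> x \<in> T \<Longrightarrow> (f has_derivative frechet_derivative f (at x)) (at x)"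
  by (simp add: frechet_derivative_works)

lemma Ck_on_const [simp]: "Ck_on k T (\<lambda>x. c)"
  by (induction k arbitrary: c) auto

lemma Ck_on_add:
  assumes "open T" "Ck_on k T f" "Ck_on k T g"
  shows "Ck_on k T (\<lambda>x. f x + g x)"
  using assms
proof (induction k arbitrary: f g)
  case (Suc k)
  show ?case
    by (rule Ck_on_SucI[OF Suc.prems(1)])
      (use Suc in \<open>auto intro!: has_derivative_add simp: frechet_derivative_works\<close>)
qed (auto intro: continuous_intros)

lemma Ck_on_sum:
  assumes "open T" "\<And>i. i \<in> I \<Longrightarrow> Ck_on k T (f i)"
  shows "Ck_on k T (\<lambda>x. \<Sum>i\<in>I. f i x)"
  using assms(2) by (induction I rule: infinite_finite_induct) (auto intro: Ck_on_add[OF assms(1)])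

lemma Ck_on_scaleR:
  fixes f :: "'a::real_normed_vector \<Rightarrow> real"
  assumes "open T" "Ck_on k T f" "Ck_on k T g"
  shows "Ck_on k T (\<lambda>x. f x *\<^sub>R g x)"
  using assms
proof (induction k arbitrary: f g)
  case (Suc k)
  show ?case
  proof (rule Ck_on_SucI[OF Suc.prems(1)])
    fix x assume "x \<in> T"
    with Suc.prems have "f differentiable (at x)" "g differentiable (at x)" by auto
    then show "((\<lambda>x. f x *\<^sub>R g x) has_derivative
       (\<lambda>h. f x *\<^sub>R frechet_derivative g (at x) h + frechet_derivative f (at x) h *\<^sub>R g x)) (at x)"
      by (intro has_derivative_scaleR) (auto simp: frechet_derivative_works)
  next
    fix v
    from Suc.prems have "Ck_on k T (\<lambda>x. frechet_derivative f (at x) v)"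
      "Ck_on k T (\<lambda>x. frechet_derivative g (at x) v)" by auto
    with Ck_on_Suc_D[OF Suc.prems(2)] Ck_on_Suc_D[OF Suc.prems(3)]
    show "Ck_on k T (\<lambda>x. f x *\<^sub>R frechet_derivative g (at x) v + frechet_derivative f (at x) v *\<^sub>R g x)"
      by (intro Ck_on_add[OF Suc.prems(1)] Suc.IH[OF Suc.prems(1)]) assumption+
  qed
qed (auto intro: continuous_intros)

lemma Ck_on_mult:
  fixes f :: "'a::real_normed_vector \<Rightarrow> real"
  shows "open T \<Longrightarrow> Ck_on k T f \<Longrightarrow> Ck_on k T g \<Longrightarrow> Ck_on k T (\<lambda>x. f x * g x)"
  using Ck_on_scaleR[of T k f g] by simp

lemma Ck_on_minus:
  fixes f :: "'a::real_normed_vector \<Rightarrow> real"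
  shows "open T \<Longrightarrow> Ck_on k T f \<Longrightarrow> Ck_on k T (\<lambda>x. - f x)"
  using Ck_on_mult[of T k "\<lambda>x. -1" f] by simp

lemma Ck_on_diff:
  fixes f :: "'a::real_normed_vector \<Rightarrow> real"
  shows "open T \<Longrightarrow> Ck_on k T f \<Longrightarrow> Ck_on k T g \<Longrightarrow> Ck_on k T (\<lambda>x. f x - g x)"
  using Ck_on_add[of T k f "\<lambda>x. - g x"] Ck_on_minus[of T k g] by simp

lemma Ck_on_linear:
  assumes "open T" "bounded_linear f"
  shows "Ck_on k T f"
proof (cases k)
  case 0 then show ?thesis using assms by (simp add: linear_continuous_on)
next
  case (Suc j)
  then show ?thesis
    using Ck_on_SucI[where f=f and f'="\<lambda>_. f"] assms
    by (auto simp del: Ck_on.simps intro: bounded_linear_imp_has_derivative)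
qed

lemma Ck_on_linear_compose:
  assumes "open T" "bounded_linear L" "Ck_on k T f"
  shows "Ck_on k T (\<lambda>x. L (f x))"
  using assms(3)
proof (induction k arbitrary: f)
  case 0 then show ?case
    using continuous_on_compose2[OF linear_continuous_on[OF assms(2)], where t=UNIV and f=f and s=T] by simp
next
  case (Suc k)
  show ?case
    by (rule Ck_on_SucI[OF assms(1)])
      (use Suc in \<open>auto intro!: bounded_linear.has_derivative[OF assms(2)] simp: frechet_derivative_works\<close>)
qed

text \<open>The chain rule applies the derivative of g to a vector that varies with x, whereas
  \<open>Ck_on\<close> only controls derivatives in fixed directions. Expanding that vector over
  \<open>Basis\<close> leaves sums of products of scalar coefficients with directional derivatives
  of g along f, which the induction hypothesis covers.\<close>

lemma Ck_on_compose:
  fixes f :: "'a::real_normed_vector \<Rightarrow> 'b::euclidean_space"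
    and g :: "'b \<Rightarrow> 'c::real_normed_vector"
  assumes "open T" "open S" "Ck_on k T f" "Ck_on k S g" "f ` T \<subseteq> S"
  shows "Ck_on k T (\<lambda>x. g (f x))"
  using assms(3-)
proof (induction k arbitrary: g)
  case 0
  then show ?case by (auto intro: continuous_on_compose2)
next
  case (Suc k)
  let ?D = "\<lambda>h x v. frechet_derivative h (at x) v"
  show ?case
  proof (rule Ck_on_SucI[OF assms(1)])
    fix x assume x: "x \<in> T"
    have g: "(g has_derivative ?D g (f x)) (at (f x))"
      using Suc.prems(3) x by (intro Ck_on_has_derivative[OF Suc.prems(2)]) auto
    have f: "(f has_derivative ?D f x) (at x)"
      by (rule Ck_on_has_derivative[OF Suc.prems(1) x])
    have lin: "linear (?D g (f x))" using g by (rule has_derivative_linear)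
    have "((\<lambda>x. g (f x)) has_derivative (\<lambda>v. ?D g (f x) (?D f x v))) (at x)"
      using has_derivative_compose[OF f g] .
    moreover have "?D g (f x) (?D f x v) = (\<Sum>b\<in>Basis. (?D f x v \<bullet> b) *\<^sub>R ?D g (f x) b)" for v
      by (subst euclidean_representation[of "?D f x v", symmetric])
        (simp add: linear_sum[OF lin] linear_cmul[OF lin] del: euclidean_representation)
    ultimately show "((\<lambda>x. g (f x)) has_derivative
        (\<lambda>v. \<Sum>b\<in>Basis. (?D f x v \<bullet> b) *\<^sub>R ?D g (f x) b)) (at x)"
      by simp
  next
    fix v
    have "Ck_on k T (\<lambda>x. ?D g (f x) b)" for b
    proof (intro Suc.IH[of "\<lambda>y. ?D g y b"])
      show "Ck_on k T f" by (rule Ck_on_Suc_D[OF Suc.prems(1)])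
    qed (use Suc.prems in auto)
    moreover have "Ck_on k T (\<lambda>x. ?D f x v \<bullet> b)" for b
      using Suc.prems by (intro Ck_on_linear_compose[OF assms(1) bounded_linear_inner_left]) auto
    ultimately show "Ck_on k T (\<lambda>x. \<Sum>b\<in>Basis. (?D f x v \<bullet> b) *\<^sub>R ?D g (f x) b)"
      by (intro Ck_on_sum[OF assms(1)] Ck_on_scaleR[OF assms(1)])
  qed
qed

definition smooth :: "('a::real_normed_vector \<Rightarrow> 'b::real_normed_vector) \<Rightarrow> bool" where
  "smooth f \<longleftrightarrow> (\<forall>k. Ck_on k UNIV f)"

lemma smooth_continuous: "smooth f \<Longrightarrow> continuous_on S f"
  using Ck_on.simps(1)[of UNIV f] continuous_on_subset[of UNIV f S] unfolding smooth_def by blast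

lemma smooth_has_derivative: "smooth f \<Longrightarrow> (f has_derivative frechet_derivative f (at x)) (at x)"
  by (rule Ck_on_has_derivative[of 0 UNIV]) (simp_all add: smooth_def del: Ck_on.simps)

lemma smooth_frechet: "smooth f \<Longrightarrow> smooth (\<lambda>x. frechet_derivative f (at x) v)"
  unfolding smooth_def using Ck_on.simps(2)[of _ UNIV f] by blast

lemma smooth_const [simp]: "smooth (\<lambda>x. c)" by (simp add: smooth_def)

lemma smooth_add: "smooth f \<Longrightarrow> smooth g \<Longrightarrow> smooth (\<lambda>x. f x + g x)"
  by (simp add: smooth_def Ck_on_add)

lemma smooth_mult: "smooth f \<Longrightarrow> smooth g \<Longrightarrow> smooth (\<lambda>x. f x * g x)"
  for f :: "'a::real_normed_vector \<Rightarrow> real"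
  by (simp add: smooth_def Ck_on_mult)

lemma smooth_diff: "smooth f \<Longrightarrow> smooth g \<Longrightarrow> smooth (\<lambda>x. f x - g x)"
  for f :: "'a::real_normed_vector \<Rightarrow> real"
  by (simp add: smooth_def Ck_on_diff)

lemma smooth_linear: "bounded_linear f \<Longrightarrow> smooth f"
  by (simp add: smooth_def Ck_on_linear)

lemma smooth_compose: "smooth f \<Longrightarrow> smooth g \<Longrightarrow> smooth (\<lambda>x. g (f x))"
  for f :: "'a::real_normed_vector \<Rightarrow> 'b::euclidean_space"
  unfolding smooth_def using Ck_on_compose[of UNIV UNIV _ f g] by simp

section \<open>A family of functions flat at the origin\<close>

definition flat :: "nat \<Rightarrow> real \<Rightarrow> real" where
  "flat n t = (if t > 0 then exp (- 1 / t) / t ^ n else 0)"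

lemma flat_nonneg: "0 \<le> flat n t" by (simp add: flat_def)

lemma flat_tendsto_0: "(flat n \<longlongrightarrow> 0) (at 0)"
proof -
  have "((\<lambda>t::real. inverse t ^ n / exp (inverse t)) \<longlongrightarrow> 0) (at_right 0)"
    by (rule filterlim_compose[OF tendsto_power_div_exp_0 filterlim_inverse_at_top_right])
  moreover have "\<forall>\<^sub>F t in at_right 0. inverse t ^ n / exp (inverse t) = flat n t"
    by (auto simp: flat_def eventually_at_filter exp_minus field_simps)
  ultimately have "(flat n \<longlongrightarrow> 0) (at_right 0)"
    by (rule Lim_transform_eventually)
  moreover have "(flat n \<longlongrightarrow> 0) (at_left 0)"
    by (rule tendsto_eventually) (auto simp: flat_def eventually_at_filter)
  ultimately show ?thesis by (simp add: filterlim_at_split)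
qed

text \<open>The power in the denominator is there to close the family under differentiation, so that
  smoothness of all members follows from one induction on the order of differentiability with n
  arbitrary.\<close>

lemma flat_has_real_derivative:
  "(flat n has_real_derivative (flat (n + 2) t - n * flat (n + 1) t)) (at t)"
proof -
  consider "t > 0" | "t < 0" | "t = 0" by linarith
  then show ?thesis
  proof cases
    case 1
    have "((\<lambda>t. exp (- 1 / t) / t ^ n) has_real_derivative
       (exp (-1/t) * (1 / t^2) * t^n - exp (-1/t) * (n * t^(n-1))) / (t^n * t^n)) (at t)"
      using 1 by (auto intro!: derivative_eq_intros simp: power2_eq_square)
    moreover have "(exp (-1/t) * (1 / t^2) * t^n - exp (-1/t) * (n * t^(n-1))) / (t^n * t^n)
        = flat (n + 2) t - n * flat (n + 1) t"
      using 1 by (cases n) (auto simp: flat_def field_simps power2_eq_square)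
    ultimately have "((\<lambda>t. exp (- 1 / t) / t ^ n) has_real_derivative
        flat (n + 2) t - n * flat (n + 1) t) (at t)" by simp
    then show ?thesis
      by (rule has_field_derivative_transform_within_open[where S="{0<..}"]) (use 1 in \<open>auto simp: flat_def\<close>)
  next
    case 2
    have "((\<lambda>t::real. 0::real) has_real_derivative 0) (at t)" by simp
    then have "(flat n has_real_derivative 0) (at t)"
      by (rule has_field_derivative_transform_within_open[where S="{..<0}"]) (use 2 in \<open>auto simp: flat_def\<close>)
    then show ?thesis using 2 by (simp add: flat_def)
  next
    case 3
    \<comment> \<open>At the origin the difference quotient of \<open>flat n\<close> is
      \<open>flat (n + 1)\<close> itself, so \<open>flat_tendsto_0\<close> is exactly the limit
      required.\<close>
    have "\<forall>\<^sub>F h in at 0. flat (n + 1) h = (flat n (0 + h) - flat n 0) / h"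
      by (auto simp: flat_def eventually_at_filter)
    then have "((\<lambda>h. (flat n (0 + h) - flat n 0) / h) \<longlongrightarrow> 0) (at 0)"
      by (rule Lim_transform_eventually[OF flat_tendsto_0])
    then show ?thesis using 3 by (simp add: DERIV_def flat_def)
  qed
qed

lemma smooth_flat: "smooth (flat n)"
proof -
  have "Ck_on k UNIV (flat n)" for k
  proof (induction k arbitrary: n)
    case 0
    have "isCont (flat n) t" for t
      by (rule DERIV_isCont[OF flat_has_real_derivative])
    then show ?case by (simp add: continuous_at_imp_continuous_on)
  next
    case (Suc k)
    have d: "(flat n has_derivative (\<lambda>v. (flat (n + 2) t - n * flat (n + 1) t) * v)) (at t)" for t
      using flat_has_real_derivative[of n t] by (simp add: has_field_derivative_def)
    show ?case
      by (rule Ck_on_SucI[OF _ d]) (auto intro!: Ck_on_mult Ck_on_diff Suc.IH)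
  qed
  then show ?thesis by (simp add: smooth_def)
qed

section \<open>Bump functions and mollifiers\<close>

lemma smooth_sum: "(\<And>i. i \<in> I \<Longrightarrow> smooth (f i)) \<Longrightarrow> smooth (\<lambda>x. \<Sum>i\<in>I. f i x)"
  by (simp add: smooth_def Ck_on_sum)

lemma smooth_inner_self: "smooth (\<lambda>x::'a::euclidean_space. (x - a) \<bullet> (x - a))"
proof -
  have "smooth (\<lambda>x::'a. \<Sum>b\<in>Basis. (x \<bullet> b - a \<bullet> b) * (x \<bullet> b - a \<bullet> b))"
    by (intro smooth_sum smooth_mult smooth_diff smooth_const smooth_linear bounded_linear_inner_left)
  moreover have "(\<lambda>x::'a. \<Sum>b\<in>Basis. (x \<bullet> b - a \<bullet> b) * (x \<bullet> b - a \<bullet> b)) = (\<lambda>x. (x - a) \<bullet> (x - a))"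
    by (rule ext, subst euclidean_inner) (simp add: inner_diff_left)
  ultimately show ?thesis by simp
qed

lemma frechet_derivative_eq: "(f has_derivative f') (at x) \<Longrightarrow> frechet_derivative f (at x) = f'"
  by (rule frechet_derivative_at[symmetric])

text \<open>The factor \<open>exp 1\<close> normalises \<open>flat 0\<close> to the value 1 at 1.
  The inner expression is at most 0 for t \<le> 0 and equal to 1 for t \<ge> 1; a second application
  of the normalised \<open>flat 0\<close> turns these into the exact values 0 and 1, so no quotient
  or integral of smooth functions is involved.\<close>

definition smooth_step :: "real \<Rightarrow> real" where
  "smooth_step t = exp 1 * flat 0 (1 - exp 1 * flat 0 (1 - t))"

lemma smooth_smooth_step: "smooth smooth_step"
proof -
  have 1: "smooth (\<lambda>t::real. 1 - c * flat 0 t)" for c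
    by (intro smooth_diff smooth_mult smooth_const smooth_flat)
  have 2: "smooth (\<lambda>t::real. 1 - t)"
    by (intro smooth_diff smooth_const smooth_linear bounded_linear_ident)
  have "smooth (\<lambda>t::real. 1 - exp 1 * flat 0 (1 - t))"
    using smooth_compose[OF 2 1] .
  from smooth_compose[OF this smooth_flat] show ?thesis
    unfolding smooth_step_def[abs_def] by (intro smooth_mult smooth_const)
qed

lemma flat_0_mono: "s \<le> t \<Longrightarrow> flat 0 s \<le> flat 0 t"
  by (auto simp: flat_def field_simps)

lemma smooth_step_ge_1: "1 \<le> t \<Longrightarrow> smooth_step t = 1"
  by (simp add: smooth_step_def flat_def flip: exp_add)

lemma smooth_step_le_0:
  assumes "t \<le> 0" shows "smooth_step t = 0"
proof -
  have "flat 0 1 \<le> flat 0 (1 - t)" by (rule flat_0_mono) (use assms in simp)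
  then have "1 \<le> exp 1 * flat 0 (1 - t)"
    by (simp add: flat_def exp_minus field_simps)
  then show ?thesis by (simp add: smooth_step_def flat_def)
qed

lemma smooth_step_bounds: "0 \<le> smooth_step t" "smooth_step t \<le> 1"
proof -
  show "0 \<le> smooth_step t" by (simp add: smooth_step_def flat_nonneg)
  have "flat 0 (1 - exp 1 * flat 0 (1 - t)) \<le> flat 0 1"
    by (rule flat_0_mono) (simp add: flat_nonneg)
  then show "smooth_step t \<le> 1"
    by (simp add: smooth_step_def flat_def exp_minus field_simps split: if_splits)
qed

lemma smooth_bump_exists:
  fixes a :: "'a::euclidean_space"
  assumes "0 < r"
  obtains \<zeta> :: "'a \<Rightarrow> real" where "smooth \<zeta>" "\<And>x. 0 \<le> \<zeta> x" "\<And>x. \<zeta> x \<le> 1"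
    "\<And>x. x \<in> cball a r \<Longrightarrow> \<zeta> x = 1" "\<And>x. x \<notin> ball a (2 * r) \<Longrightarrow> \<zeta> x = 0"
proof
  \<comment> \<open>The argument is at least 1 up to distance r from a and at most 0 from distance r
    times the square root of 2 onwards, hence outside \<open>ball a (2 * r)\<close>.\<close>
  let ?\<zeta> = "\<lambda>x. smooth_step (2 - inverse (r\<^sup>2) * ((x - a) \<bullet> (x - a)))"
  show "smooth ?\<zeta>"
    by (intro smooth_compose[OF _ smooth_smooth_step] smooth_diff smooth_mult smooth_const smooth_inner_self)
  show "?\<zeta> x = 1" if "x \<in> cball a r" for x
  proof (rule smooth_step_ge_1)
    have "(x - a) \<bullet> (x - a) \<le> r\<^sup>2"
      using that by (simp add: dist_norm norm_minus_commute power_mono flip: power2_norm_eq_inner)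
    then show "1 \<le> 2 - inverse (r\<^sup>2) * ((x - a) \<bullet> (x - a))"
      using assms by (simp add: field_simps)
  qed
  show "?\<zeta> x = 0" if "x \<notin> ball a (2 * r)" for x
  proof (rule smooth_step_le_0)
    have "(2 * r)\<^sup>2 \<le> (norm (x - a))\<^sup>2"
      using that assms by (intro power_mono) (auto simp: dist_norm norm_minus_commute)
    moreover have "2 * r\<^sup>2 \<le> (2 * r)\<^sup>2" by (simp add: power_mult_distrib)
    ultimately have "2 * r\<^sup>2 \<le> (x - a) \<bullet> (x - a)"
      by (simp only: power2_norm_eq_inner)
    then show "2 - inverse (r\<^sup>2) * ((x - a) \<bullet> (x - a)) \<le> 0"
      using assms by (simp add: field_simps)
  qed
qed (auto simp: smooth_step_bounds)

definition mollifier :: "real \<Rightarrow> ('a::euclidean_space \<Rightarrow> real) \<Rightarrow> bool" where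
  "mollifier \<delta> \<rho> \<longleftrightarrow> smooth \<rho> \<and> (\<forall>x. 0 \<le> \<rho> x) \<and> (\<forall>x. \<delta> < norm x \<longrightarrow> \<rho> x = 0) \<and>
     integrable lborel \<rho> \<and> (\<integral>x. \<rho> x \<partial>lborel) = 1"

lemma integrable_continuous_compact_support:
  fixes f :: "'a::euclidean_space \<Rightarrow> 'b::euclidean_space"
  assumes "continuous_on UNIV f" "compact K" "\<And>x. x \<notin> K \<Longrightarrow> f x = 0"
  shows "integrable lborel f"
proof -
  have "integrable lborel (\<lambda>x. indicator K x *\<^sub>R f x)"
    using assms(1,2) continuous_on_subset by (intro borel_integrable_compact) auto
  moreover have "(\<lambda>x. indicator K x *\<^sub>R f x) = f"
    using assms(3) by (auto simp: indicator_def)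
  ultimately show ?thesis by simp
qed

lemma mollifier_exists:
  assumes "0 < \<delta>"
  obtains \<rho> :: "'a::euclidean_space \<Rightarrow> real" where "mollifier \<delta> \<rho>"
proof -
  obtain \<zeta> :: "'a \<Rightarrow> real" where \<zeta>: "smooth \<zeta>" "\<And>x. 0 \<le> \<zeta> x" "\<And>x. \<zeta> x \<le> 1"
    "\<And>x. x \<in> cball 0 (\<delta>/2) \<Longrightarrow> \<zeta> x = 1" "\<And>x. x \<notin> ball 0 (2 * (\<delta>/2)) \<Longrightarrow> \<zeta> x = 0"
    using smooth_bump_exists[of "\<delta>/2" "0::'a"] assms by (metis half_gt_zero)
  have int: "integrable lborel \<zeta>"
    by (rule integrable_continuous_compact_support[OF smooth_continuous[OF \<zeta>(1)], of "cball 0 \<delta>"])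
      (use \<zeta>(5) in auto)
  have "measure lborel (cball (0::'a) (\<delta>/2)) = (\<integral>x. indicator (cball (0::'a) (\<delta>/2)) x \<partial>lborel)"
    by simp
  also have "\<dots> \<le> (\<integral>x. \<zeta> x \<partial>lborel)"
  proof (rule integral_mono[OF _ int])
    show "integrable lborel (indicator (cball (0::'a) (\<delta>/2)) :: 'a \<Rightarrow> real)"
      using emeasure_lborel_cball_finite[of "0::'a" "\<delta>/2"] by (intro integrable_real_indicator) auto
  qed (use \<zeta>(2,4) in \<open>auto simp: indicator_def\<close>)
  finally have pos: "0 < (\<integral>x. \<zeta> x \<partial>lborel)" (is "0 < ?c")
    using assms content_cball_pos[of "\<delta>/2" "0::'a"] by linarith
  have "mollifier \<delta> (\<lambda>x. inverse ?c * \<zeta> x)"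
    unfolding mollifier_def using int \<zeta> pos by (auto intro!: smooth_mult)
  then show ?thesis by (rule that)
qed

text \<open>Exactly the class of functions over which \<open>weak_gradient_on\<close>
  quantifies.\<close>

definition test_fun :: "'a::euclidean_space set \<Rightarrow> ('a \<Rightarrow> real) \<Rightarrow> bool" where
  "test_fun V \<psi> \<longleftrightarrow> smooth \<psi> \<and> compact (closure {x. \<psi> x \<noteq> 0}) \<and> closure {x. \<psi> x \<noteq> 0} \<subseteq> V"

lemma test_funI:
  assumes "smooth \<psi>" "compact K" "K \<subseteq> V" "\<And>x. x \<notin> K \<Longrightarrow> \<psi> x = 0"
  shows "test_fun V \<psi>"
proof -
  have "closure {x. \<psi> x \<noteq> 0} \<subseteq> K"
    using assms(2,4) by (intro closure_minimal compact_imp_closed) auto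
  then have "compact (K \<inter> closure {x. \<psi> x \<noteq> 0})" "K \<inter> closure {x. \<psi> x \<noteq> 0} = closure {x. \<psi> x \<noteq> 0}"
    using assms(2) by (auto intro: compact_Int_closed)
  with \<open>_ \<subseteq> K\<close> show ?thesis
    using assms(1,3) unfolding test_fun_def by auto
qed

lemma frechet_derivative_locally_zero:
  assumes "open U" "x \<in> U" "\<And>y. y \<in> U \<Longrightarrow> f y = 0"
  shows "frechet_derivative f (at x) v = 0"
proof -
  have "(f has_derivative (\<lambda>_. 0)) (at x)"
    by (rule has_derivative_transform_within_open[OF has_derivative_const[of 0] assms(1,2)])
      (use assms(3) in auto)
  then show ?thesis by (simp add: frechet_derivative_eq)
qed

lemma frechet_derivative_outside_support:
  assumes "closed K" "\<And>x. x \<notin> K \<Longrightarrow> f x = 0" "x \<notin> K"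
  shows "frechet_derivative f (at x) v = 0"
  by (rule frechet_derivative_locally_zero[of "- K"]) (use assms in auto)

section \<open>A smooth convex approximation of the positive part\<close>

definition ramp :: "real \<Rightarrow> real" where "ramp t = t * flat 0 t"
definition ramp' :: "real \<Rightarrow> real" where "ramp' t = flat 0 t + flat 1 t"

lemma ramp_has_real_derivative: "(ramp has_real_derivative ramp' t) (at t)"
proof -
  have "t * flat 2 t = flat 1 t" by (simp add: flat_def power2_eq_square)
  then show ?thesis
    using DERIV_mult[OF DERIV_ident flat_has_real_derivative[of 0 t]]
    by (simp add: ramp_def[abs_def] ramp'_def algebra_simps eval_nat_numeral)
qed

text \<open>The \<open>flat 2\<close> contributions cancel, and what remains is a single nonnegative
  function. So \<open>ramp\<close> is convex, and this sign is what later permits discarding the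
  energy term.\<close>

lemma ramp'_has_real_derivative: "(ramp' has_real_derivative flat 3 t) (at t)"
  using DERIV_add[OF flat_has_real_derivative[of 0 t] flat_has_real_derivative[of 1 t]]
  by (simp add: ramp'_def[abs_def] eval_nat_numeral)

lemma smooth_ramp: "smooth ramp" "smooth ramp'"
  unfolding ramp_def[abs_def] ramp'_def[abs_def]
  by (intro smooth_mult smooth_add smooth_flat smooth_linear bounded_linear_ident)+

text \<open>In the variable y = 1/t the upper bound reads (1 + y) exp(-y) \<le> 1.\<close>

lemma ramp'_bounds: "0 \<le> ramp' t" "ramp' t \<le> 1"
proof -
  show "0 \<le> ramp' t" by (simp add: ramp'_def flat_nonneg)
  have "1 + 1 / t \<le> exp (1 / t)" by (rule exp_ge_add_one_self)
  then have "exp (- (1 / t)) * (1 + 1 / t) \<le> exp (- (1 / t)) * exp (1 / t)"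
    by (rule mult_left_mono) simp
  then have "exp (- (1 / t)) * (1 + 1 / t) \<le> 1" by (simp flip: exp_add)
  then show "ramp' t \<le> 1" by (simp add: ramp'_def flat_def distrib_left)
qed

lemma ramp'_eq_0: "t \<le> 0 \<Longrightarrow> ramp' t = 0" "t \<le> 0 \<Longrightarrow> ramp t = 0"
  by (auto simp: ramp'_def ramp_def flat_def)

lemma flat_0_bounds: "0 \<le> flat 0 t" "flat 0 t \<le> 1"
  by (auto simp: flat_def)

lemma flat_0_tendsto: "0 < t \<Longrightarrow> (\<lambda>k. flat 0 (real (Suc k) * t)) \<longlonglongrightarrow> 1"
proof -
  assume t: "0 < t"
  have "(\<lambda>k. exp (- (inverse t * inverse (real (Suc k))))) \<longlonglongrightarrow> exp (- (inverse t * 0))"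
    by (intro tendsto_intros LIMSEQ_inverse_real_of_nat)
  moreover have "exp (- (inverse t * inverse (real (Suc k)))) = flat 0 (real (Suc k) * t)" for k
    using t by (simp add: flat_def field_simps del: of_nat_Suc)
  ultimately show ?thesis by simp
qed

text \<open>The limit 0 at t = 0 is the reason why the truncated gradient lives on the strict set
  \<open>s < u\<close> and not on \<open>s \<le> u\<close>.\<close>

lemma ramp'_tendsto: "(\<lambda>k. ramp' (real (Suc k) * t)) \<longlonglongrightarrow> (if 0 < t then 1 else 0)"
proof (cases "0 < t")
  case True
  have "(\<lambda>k. flat 0 (real (Suc k) * t) * (1 + inverse t * inverse (real (Suc k)))) \<longlonglongrightarrow> 1 * (1 + inverse t * 0)"
    by (intro tendsto_intros LIMSEQ_inverse_real_of_nat flat_0_tendsto True)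
  moreover have "flat 0 (real (Suc k) * t) * (1 + inverse t * inverse (real (Suc k))) = ramp' (real (Suc k) * t)" for k
    using True by (simp add: ramp'_def flat_def field_simps del: of_nat_Suc)
  ultimately show ?thesis using True by simp
next
  case False
  then show ?thesis by (simp add: ramp'_eq_0 mult_nonneg_nonpos del: of_nat_Suc)
qed

lemma ramp_tendsto: "(\<lambda>k. ramp (real (Suc k) * t) / real (Suc k)) \<longlonglongrightarrow> max t 0"
proof (cases "0 < t")
  case True
  have "(\<lambda>k. t * flat 0 (real (Suc k) * t)) \<longlonglongrightarrow> t * 1"
    by (intro tendsto_intros flat_0_tendsto True)
  moreover have "t * flat 0 (real (Suc k) * t) = ramp (real (Suc k) * t) / real (Suc k)" for k
    by (simp add: ramp_def del: of_nat_Suc)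
  ultimately show ?thesis using True by simp
next
  case False
  then show ?thesis by (simp add: ramp'_eq_0 mult_nonneg_nonpos del: of_nat_Suc)
qed

lemma ramp_bound: "\<bar>ramp (real (Suc k) * t) / real (Suc k)\<bar> \<le> \<bar>t\<bar>"
proof -
  have "ramp (real (Suc k) * t) / real (Suc k) = t * flat 0 (real (Suc k) * t)"
    by (simp add: ramp_def del: of_nat_Suc)
  then show ?thesis
    using flat_0_bounds[of "real (Suc k) * t"] by (simp add: abs_mult mult_left_le)
qed

section \<open>Mollification\<close>

definition conv :: "('a::euclidean_space \<Rightarrow> real) \<Rightarrow> ('a \<Rightarrow> real) \<Rightarrow> 'a \<Rightarrow> real" where
  "conv \<rho> g x = (\<integral>y. \<rho> (x - y) * g y \<partial>lborel)"

lemma distr_lborel_reflect: "distr lborel borel (\<lambda>y. x - y) = (lborel :: 'a::euclidean_space measure)"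
proof -
  show ?thesis
    by (subst (2) lborel_affine[of "-1" x]) (simp_all add: density_1)
qed

lemma nn_integral_reflect:
  "f \<in> borel_measurable borel \<Longrightarrow> (\<integral>\<^sup>+y. f (x - y) \<partial>lborel) = (\<integral>\<^sup>+y. f y \<partial>lborel)"
  for x :: "'a::euclidean_space"
  by (subst (2) distr_lborel_reflect[of x, symmetric]) (simp add: nn_integral_distr)

lemma integral_reflect:
  "f \<in> borel_measurable borel \<Longrightarrow> (\<integral>y. f (x - y) \<partial>lborel) = (\<integral>y. f y \<partial>lborel)"
  for x :: "'a::euclidean_space" and f :: "'a \<Rightarrow> real"
  by (subst (2) distr_lborel_reflect[of x, symmetric]) (simp add: integral_distr)

lemma integrable_reflect:
  "integrable lborel f \<Longrightarrow> integrable lborel (\<lambda>y. f (x - y))"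
  for x :: "'a::euclidean_space" and f :: "'a \<Rightarrow> real"
  by (rule integrable_distr[where T="\<lambda>y. x - y" and M'=borel]) (simp_all add: distr_lborel_reflect)

text \<open>Compact support of the kernel turns the Lebesgue integral into a gauge integral over a
  fixed box, the form to which \<open>leibniz_rule\<close> applies.\<close>

lemma conv_eq_box:
  assumes "continuous_on UNIV \<rho>" "\<And>x. \<delta> < norm x \<Longrightarrow> \<rho> x = 0" "continuous_on UNIV g"
    and "cball x \<delta> \<subseteq> cbox a b"
  shows "conv \<rho> g x = integral (cbox a b) (\<lambda>y. \<rho> (x - y) * g y)"
proof -
  have "continuous_on (cbox a b) (\<lambda>y. \<rho> (x - y) * g y)"
    by (intro continuous_intros continuous_on_compose2[OF assms(1)] continuous_on_subset[OF assms(3)]) auto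
  then have "set_integrable lborel (cbox a b) (\<lambda>y. \<rho> (x - y) * g y)"
    unfolding set_integrable_def by (intro borel_integrable_compact) auto
  then have "(LINT y:cbox a b|lborel. \<rho> (x - y) * g y) = integral (cbox a b) (\<lambda>y. \<rho> (x - y) * g y)"
    by (rule set_borel_integral_eq_integral)
  moreover have "indicator (cbox a b) y *\<^sub>R (\<rho> (x - y) * g y) = \<rho> (x - y) * g y" for y
    using assms(2)[of "x - y"] assms(4) by (cases "norm (x - y) \<le> \<delta>") (auto simp: dist_norm subset_iff)
  ultimately show ?thesis by (simp only: conv_def set_lebesgue_integral_def)
qed

lemma conv_has_derivative:
  fixes \<rho> g :: "'a::euclidean_space \<Rightarrow> real"
  assumes \<rho>: "smooth \<rho>" and supp: "\<And>x. \<delta> < norm x \<Longrightarrow> \<rho> x = 0" and g: "continuous_on UNIV g"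
  shows "(conv \<rho> g has_derivative (\<lambda>v. conv (\<lambda>x. frechet_derivative \<rho> (at x) v) g x)) (at x)"
proof -
  define D where "D = (\<lambda>y. Blinfun (frechet_derivative \<rho> (at y)))"
  have D: "blinfun_apply (D y) = frechet_derivative \<rho> (at y)" for y
    unfolding D_def
    by (rule bounded_linear_Blinfun_apply[OF has_derivative_bounded_linear[OF smooth_has_derivative[OF \<rho>]]])
  \<comment> \<open>The extra 1 lets a single box serve all base points in \<open>ball x 1\<close>,
    so the domain of integration does not move while differentiating.\<close>
  obtain c where c: "cball x (1 + \<bar>\<delta>\<bar>) \<subseteq> cbox (- c) c"
    using bounded_subset_cbox_symmetric[OF bounded_cball] by metis
  have sub: "cball y \<delta> \<subseteq> cbox (- c) c" if "y \<in> ball x 1" for y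
  proof -
    have "cball y \<delta> \<subseteq> cball x (1 + \<bar>\<delta>\<bar>)"
      using that by (auto simp: cball_subset_cball_iff dist_commute)
    with c show ?thesis by blast
  qed
  have supp': "frechet_derivative \<rho> (at y) v = 0" if "\<delta> < norm y" for y v
    by (rule frechet_derivative_outside_support[of "cball 0 \<delta>"]) (use supp that in auto)
  have cD: "continuous_on UNIV (\<lambda>y. frechet_derivative \<rho> (at y) v)" for v
    by (rule smooth_continuous[OF smooth_frechet[OF \<rho>]])
  have "((\<lambda>y. integral (cbox (- c) c) (\<lambda>t. \<rho> (y - t) * g t)) has_derivative
      integral (cbox (- c) c) (\<lambda>t. g t *\<^sub>R D (x - t))) (at x within ball x 1)"
  proof (rule leibniz_rule)
    fix y t
    have "((\<lambda>y. \<rho> (y - t)) has_derivative (\<lambda>v. frechet_derivative \<rho> (at (y - t)) (v - 0))) (at y within ball x 1)"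
      by (rule has_derivative_compose[OF _ smooth_has_derivative[OF \<rho>]]) (intro derivative_intros)
    then show "((\<lambda>y. \<rho> (y - t) * g t) has_derivative blinfun_apply (g t *\<^sub>R D (y - t))) (at y within ball x 1)"
      by (auto intro!: derivative_eq_intros simp: D blinfun.scaleR_left mult.commute)
  next
    show "(\<lambda>t. \<rho> (y - t) * g t) integrable_on cbox (- c) c" for y
      by (intro integrable_continuous continuous_intros continuous_on_compose2[OF smooth_continuous[OF \<rho>, of UNIV]]
          continuous_on_subset[OF g]) auto
    show "continuous_on (ball x 1 \<times> cbox (- c) c) (\<lambda>(y, t). g t *\<^sub>R D (y - t))"
      unfolding split_beta
    proof (rule continuous_on_blinfun_componentwise)
      fix i :: 'a
      show "continuous_on (ball x 1 \<times> cbox (- c) c) (\<lambda>z. blinfun_apply (g (snd z) *\<^sub>R D (fst z - snd z)) i)"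
        by (simp add: D blinfun.scaleR_left)
          (intro continuous_intros continuous_on_compose2[OF cD] continuous_on_compose2[OF g]; simp)
    qed
  qed auto
  then have "((\<lambda>y. integral (cbox (- c) c) (\<lambda>t. \<rho> (y - t) * g t)) has_derivative
      integral (cbox (- c) c) (\<lambda>t. g t *\<^sub>R D (x - t))) (at x)"
    by (simp add: at_within_open[of x "ball x 1"])
  then have "(conv \<rho> g has_derivative integral (cbox (- c) c) (\<lambda>t. g t *\<^sub>R D (x - t))) (at x)"
    by (rule has_derivative_transform_within_open[where s="ball x 1"])
      (use conv_eq_box[OF smooth_continuous[OF \<rho>] supp g sub] in auto)
  moreover have "blinfun_apply (integral (cbox (- c) c) (\<lambda>t. g t *\<^sub>R D (x - t)))
      = (\<lambda>v. conv (\<lambda>x. frechet_derivative \<rho> (at x) v) g x)"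
  proof
    fix v show "blinfun_apply (integral (cbox (- c) c) (\<lambda>t. g t *\<^sub>R D (x - t))) v
      = conv (\<lambda>x. frechet_derivative \<rho> (at x) v) g x"
  proof -
    have "continuous_on (cbox (- c) c) (\<lambda>t. g t *\<^sub>R D (x - t))"
    proof (rule continuous_on_blinfun_componentwise)
      fix i :: 'a
      show "continuous_on (cbox (- c) c) (\<lambda>t. blinfun_apply (g t *\<^sub>R D (x - t)) i)"
        by (simp add: D blinfun.scaleR_left)
          (intro continuous_intros continuous_on_compose2[OF cD] continuous_on_compose2[OF g]; simp)
    qed
    then have "integral (cbox (- c) c) ((\<lambda>L. blinfun_apply L v) \<circ> (\<lambda>t. g t *\<^sub>R D (x - t)))
      = blinfun_apply (integral (cbox (- c) c) (\<lambda>t. g t *\<^sub>R D (x - t))) v"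
      by (intro integral_linear integrable_continuous bounded_linear_intros)
    then have "blinfun_apply (integral (cbox (- c) c) (\<lambda>t. g t *\<^sub>R D (x - t))) v
       = integral (cbox (- c) c) (\<lambda>t. frechet_derivative \<rho> (at (x - t)) v * g t)"
      by (simp add: o_def D blinfun.scaleR_left mult.commute)
    also have "\<dots> = conv (\<lambda>x. frechet_derivative \<rho> (at x) v) g x"
      by (rule conv_eq_box[OF cD supp' g sub, symmetric]) auto
    finally show ?thesis .
  qed
  qed
  ultimately show ?thesis by (simp only:)
qed

text \<open>All derivatives fall on the kernel. The kernel is a general smooth function of bounded
  support because the derivative of a mollifier is neither nonnegative nor of integral 1, while its
  support radius is preserved throughout the induction.\<close>

lemma smooth_conv:
  fixes \<rho> g :: "'a::euclidean_space \<Rightarrow> real"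
  assumes "smooth \<rho>" "\<And>x. \<delta> < norm x \<Longrightarrow> \<rho> x = 0" "continuous_on UNIV g"
  shows "smooth (conv \<rho> g)"
proof -
  have "Ck_on k UNIV (conv \<rho> g)" for k
    using assms(1,2)
  proof (induction k arbitrary: \<rho>)
    case 0
    have "isCont (conv \<rho> g) x" for x
      by (rule has_derivative_continuous[OF conv_has_derivative[OF 0 assms(3)]])
    then show ?case by (simp add: continuous_at_imp_continuous_on)
  next
    case (Suc k)
    show ?case
    proof (rule Ck_on_SucI[OF open_UNIV conv_has_derivative[OF Suc.prems assms(3)]])
      fix v
      show "Ck_on k UNIV (conv (\<lambda>x. frechet_derivative \<rho> (at x) v) g)"
      proof (rule Suc.IH)
        show "frechet_derivative \<rho> (at x) v = 0" if "\<delta> < norm x" for x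
          by (rule frechet_derivative_outside_support[of "cball 0 \<delta>"]) (use Suc.prems that in auto)
      qed (rule smooth_frechet[OF Suc.prems(1)])
    qed
  qed
  then show ?thesis by (simp add: smooth_def)
qed

lemma mollifier_translate:
  assumes "mollifier \<delta> \<rho>"
  shows "integrable lborel (\<lambda>y. \<rho> (x - y))" "(\<integral>y. \<rho> (x - y) \<partial>lborel) = 1"
  using assms integrable_reflect[of \<rho> x] integral_reflect[of \<rho> x]
  by (auto simp: mollifier_def)

lemma integrable_mollifier_mult:
  fixes h :: "'a::euclidean_space \<Rightarrow> real"
  assumes "mollifier \<delta> \<rho>" "integrable lborel h"
  shows "integrable lborel (\<lambda>y. \<rho> (x - y) * h y)"
proof -
  have cont: "continuous_on UNIV \<rho>" using assms(1) by (simp add: mollifier_def smooth_continuous)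
  have "bounded (\<rho> ` cball 0 \<delta>)"
    by (intro compact_imp_bounded compact_continuous_image continuous_on_subset[OF cont]) auto
  then obtain B where "\<forall>y\<in>\<rho> ` cball 0 \<delta>. norm y \<le> B" unfolding bounded_iff by blast
  then have B: "\<bar>\<rho> x\<bar> \<le> B" if "x \<in> cball 0 \<delta>" for x
    using that by (metis imageI real_norm_def)
  have B': "\<bar>\<rho> x\<bar> \<le> \<bar>B\<bar>" for x
  proof (cases "norm x \<le> \<delta>")
    case True then show ?thesis using B[of x] by simp
  next
    case False then show ?thesis using assms(1) by (simp add: mollifier_def)
  qed
  have meas: "\<rho> \<in> borel_measurable borel" by (rule borel_measurable_continuous_onI[OF cont])
  have "integrable lborel (\<lambda>y. \<bar>B\<bar> * h y)" using assms(2) by simp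
  then show ?thesis
  proof (rule Bochner_Integration.integrable_bound)
    show "(\<lambda>y. \<rho> (x - y) * h y) \<in> borel_measurable lborel"
      using meas assms(2) by measurable
    show "AE y in lborel. norm (\<rho> (x - y) * h y) \<le> norm (\<bar>B\<bar> * h y)"
      using B' by (auto simp: abs_mult intro!: mult_right_mono)
  qed
qed

lemma conv_minus_bound:
  fixes g :: "'a::euclidean_space \<Rightarrow> real"
  assumes "mollifier \<delta> \<rho>" "continuous_on UNIV g"
    and "\<And>y. dist x y \<le> \<delta> \<Longrightarrow> \<bar>g y - g x\<bar> \<le> \<epsilon>"
  shows "\<bar>conv \<rho> g x - g x\<bar> \<le> \<epsilon>"
proof -
  have \<rho>: "continuous_on UNIV \<rho>" "\<And>x. 0 \<le> \<rho> x" "\<And>x. \<delta> < norm x \<Longrightarrow> \<rho> x = 0"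
    using assms(1) by (auto simp: mollifier_def smooth_continuous)
  have int: "integrable lborel (\<lambda>y. \<rho> (x - y) * g y)"
    by (rule integrable_continuous_compact_support[of _ "cball x \<delta>"])
      (use \<rho> in \<open>auto intro!: continuous_intros continuous_on_compose2[OF \<rho>(1)] assms(2) simp: dist_norm\<close>)
  note tr = mollifier_translate[OF assms(1), of x]
  have "conv \<rho> g x - g x = (\<integral>y. \<rho> (x - y) * g y - \<rho> (x - y) * g x \<partial>lborel)"
    using int tr by (simp add: conv_def)
  also have "\<bar>\<dots>\<bar> \<le> (\<integral>y. \<rho> (x - y) * \<epsilon> \<partial>lborel)"
  proof (rule integral_abs_bound_integral)
    show "\<bar>\<rho> (x - y) * g y - \<rho> (x - y) * g x\<bar> \<le> \<rho> (x - y) * \<epsilon>" for y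
    proof (cases "dist x y \<le> \<delta>")
      case True
      have "\<bar>\<rho> (x - y) * g y - \<rho> (x - y) * g x\<bar> = \<rho> (x - y) * \<bar>g y - g x\<bar>"
        using \<rho>(2)[of "x - y"] by (simp add: abs_mult flip: right_diff_distrib)
      then show ?thesis using assms(3)[OF True] \<rho>(2)[of "x - y"] by (simp add: mult_left_mono)
    qed (use \<rho>(3)[of "x - y"] in \<open>simp add: dist_norm\<close>)
  qed (use int tr in auto)
  also have "\<dots> = \<epsilon>" using tr by simp
  finally show ?thesis .
qed

lemma uniform_limit_conv:
  fixes g :: "'a::euclidean_space \<Rightarrow> real"
  assumes "\<And>j. mollifier (\<delta> j) (\<rho> j)" "\<delta> \<longlonglongrightarrow> 0" "continuous_on UNIV g" "compact K"
  shows "uniform_limit K (\<lambda>j. conv (\<rho> j) g) g sequentially"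
proof (rule uniform_limitI)
  fix e :: real assume "0 < e"
  obtain R where R: "K \<subseteq> ball 0 R" using compact_imp_bounded[OF assms(4)] bounded_subset_ballD by blast
  \<comment> \<open>The margin 1 keeps every point within distance \<delta> j < 1 of K in the region
    of uniform continuity.\<close>
  have "uniformly_continuous_on (cball 0 (R + 1)) g"
    by (intro compact_uniformly_continuous continuous_on_subset[OF assms(3)]) auto
  then obtain d where d: "0 < d" "\<And>x y. x \<in> cball 0 (R+1) \<Longrightarrow> y \<in> cball 0 (R+1) \<Longrightarrow> dist y x < d \<Longrightarrow> dist (g y) (g x) < e/2"
    using \<open>0 < e\<close> unfolding uniformly_continuous_on_def by (metis half_gt_zero)
  have "\<forall>\<^sub>F j in sequentially. \<delta> j < min d 1"
    by (rule order_tendstoD(2)[OF assms(2)]) (use d(1) in simp)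
  then show "\<forall>\<^sub>F j in sequentially. \<forall>x\<in>K. dist (conv (\<rho> j) g x) (g x) < e"
  proof eventually_elim
    case (elim j)
    show ?case
    proof
      fix x assume "x \<in> K"
      have "\<bar>conv (\<rho> j) g x - g x\<bar> \<le> e/2"
      proof (rule conv_minus_bound[OF assms(1,3)])
        fix y assume y: "dist x y \<le> \<delta> j"
        have "norm x < R" using R \<open>x \<in> K\<close> by auto
        moreover have "norm y \<le> norm x + dist x y" by norm
        ultimately have "dist (g y) (g x) < e/2"
          using y elim by (intro d(2)) (auto simp: dist_commute)
        then show "\<bar>g y - g x\<bar> \<le> e/2" by (simp add: dist_real_def)
      qed
      then show "dist (conv (\<rho> j) g x) (g x) < e" using \<open>0 < e\<close> by (simp add: dist_real_def)
    qed
  qed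
qed

text \<open>The squared L2 norm, valued in \<open>ennreal\<close> so that it makes sense without
  integrability; convergence to 0 then even implies that the squares are eventually
  integrable.\<close>

definition l2sq :: "('a::euclidean_space \<Rightarrow> real) \<Rightarrow> ennreal" where
  "l2sq f = (\<integral>\<^sup>+x. ennreal ((f x)\<^sup>2) \<partial>lborel)"

lemma l2sq_integrable:
  "f \<in> borel_measurable borel \<Longrightarrow> integrable lborel (\<lambda>x. (f x)\<^sup>2) \<Longrightarrow>
    l2sq f = ennreal (\<integral>x. (f x)\<^sup>2 \<partial>lborel)"
  unfolding l2sq_def by (rule nn_integral_eq_integral) auto

lemma l2sq_integrable_iff:
  "f \<in> borel_measurable borel \<Longrightarrow> integrable lborel (\<lambda>x. (f x)\<^sup>2) \<longleftrightarrow> l2sq f < \<infinity>"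
  unfolding l2sq_def integrable_iff_bounded by simp

text \<open>Stands in for the triangle inequality. Working with squares costs a factor 3, which
  accounts for the tolerances \<open>e / 6\<close> (two terms) and \<open>b' / 9\<close> (three
  terms) in the approximation arguments.\<close>

lemma l2sq_add3:
  assumes [measurable]: "f \<in> borel_measurable borel" "g \<in> borel_measurable borel" "h \<in> borel_measurable borel"
  shows "l2sq (\<lambda>x. f x + g x + h x) \<le> 3 * (l2sq f + l2sq g + l2sq h)"
proof -
  have *: "(a + b + c)\<^sup>2 \<le> 3 * (a\<^sup>2 + b\<^sup>2 + c\<^sup>2)" for a b c :: real
  proof -
    have "0 \<le> (a - b)\<^sup>2 + (a - c)\<^sup>2 + (b - c)\<^sup>2" by simp
    then show ?thesis by (simp add: power2_eq_square algebra_simps)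
  qed
  have "l2sq (\<lambda>x. f x + g x + h x)
      \<le> (\<integral>\<^sup>+x. 3 * (ennreal ((f x)\<^sup>2) + ennreal ((g x)\<^sup>2) + ennreal ((h x)\<^sup>2)) \<partial>lborel)"
    unfolding l2sq_def
  proof (rule nn_integral_mono)
    fix x
    have "ennreal ((f x + g x + h x)\<^sup>2) \<le> ennreal (3 * ((f x)\<^sup>2 + (g x)\<^sup>2 + (h x)\<^sup>2))"
      by (rule ennreal_leI[OF *])
    also have "\<dots> = 3 * (ennreal ((f x)\<^sup>2) + ennreal ((g x)\<^sup>2) + ennreal ((h x)\<^sup>2))"
      by (simp add: ennreal_mult)
    finally show "ennreal ((f x + g x + h x)\<^sup>2) \<le> 3 * (ennreal ((f x)\<^sup>2) + ennreal ((g x)\<^sup>2) + ennreal ((h x)\<^sup>2))" .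
  qed
  also have "\<dots> = 3 * (l2sq f + l2sq g + l2sq h)"
    by (simp add: l2sq_def nn_integral_cmult nn_integral_add)
  finally show ?thesis .
qed

text \<open>Jensen's inequality for the probability density \<rho>(x - y) in y, obtained from the
  nonnegativity of the variance of h about its mean \<open>conv \<rho> h x\<close>.\<close>

lemma conv_sq_le:
  assumes m: "mollifier \<delta> \<rho>" and h: "integrable lborel h" "integrable lborel (\<lambda>y. (h y)\<^sup>2)"
  shows "(conv \<rho> h x)\<^sup>2 \<le> (\<integral>y. \<rho> (x - y) * (h y)\<^sup>2 \<partial>lborel)"
proof -
  let ?c = "conv \<rho> h x"
  note tr = mollifier_translate[OF m, of x]
  note i1 = integrable_mollifier_mult[OF m h(1), of x]
  note i2 = integrable_mollifier_mult[OF m h(2), of x]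
  have "0 \<le> (\<integral>y. \<rho> (x - y) * (h y - ?c)\<^sup>2 \<partial>lborel)"
    using m by (intro integral_nonneg_AE) (auto simp: mollifier_def)
  also have "(\<lambda>y. \<rho> (x - y) * (h y - ?c)\<^sup>2)
      = (\<lambda>y. \<rho> (x - y) * (h y)\<^sup>2 - 2 * ?c * (\<rho> (x - y) * h y) + ?c\<^sup>2 * \<rho> (x - y))"
    by (rule ext) (simp add: power2_eq_square algebra_simps)
  also have "(\<integral>y. \<rho> (x - y) * (h y)\<^sup>2 - 2 * ?c * (\<rho> (x - y) * h y) + ?c\<^sup>2 * \<rho> (x - y) \<partial>lborel)
     = (\<integral>y. \<rho> (x - y) * (h y)\<^sup>2 \<partial>lborel) - 2 * ?c * ?c + ?c\<^sup>2"
    using tr i1 i2 by (simp add: conv_def)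
  finally show ?thesis by (simp add: power2_eq_square)
qed

lemma conv_measurable:
  assumes [measurable]: "\<rho> \<in> borel_measurable borel" "h \<in> borel_measurable borel"
  shows "conv \<rho> h \<in> borel_measurable borel"
  unfolding conv_def[abs_def] by measurable

text \<open>Young's inequality in L2: Jensen pointwise, then Tonelli, then the unit mass of the
  kernel. The bound does not depend on the radius \<delta>, which is what the density argument
  needs.\<close>

lemma l2sq_conv_le:
  assumes m: "mollifier \<delta> \<rho>" and h: "integrable lborel h" "integrable lborel (\<lambda>y. (h y)\<^sup>2)"
  shows "l2sq (conv \<rho> h) \<le> l2sq h"
proof -
  have meas [measurable]: "\<rho> \<in> borel_measurable borel" "h \<in> borel_measurable borel"
    using m h(1) by (auto simp: mollifier_def intro: borel_measurable_continuous_onI smooth_continuous)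
  have nn: "0 \<le> \<rho> x" for x using m by (simp add: mollifier_def)
  have "l2sq (conv \<rho> h) \<le> (\<integral>\<^sup>+x. \<integral>\<^sup>+y. ennreal (\<rho> (x - y) * (h y)\<^sup>2) \<partial>lborel \<partial>lborel)"
    unfolding l2sq_def
  proof (rule nn_integral_mono)
    fix x
    have "ennreal ((conv \<rho> h x)\<^sup>2) \<le> ennreal (\<integral>y. \<rho> (x - y) * (h y)\<^sup>2 \<partial>lborel)"
      by (rule ennreal_leI[OF conv_sq_le[OF m h]])
    also have "\<dots> = (\<integral>\<^sup>+y. ennreal (\<rho> (x - y) * (h y)\<^sup>2) \<partial>lborel)"
      by (rule nn_integral_eq_integral[symmetric, OF integrable_mollifier_mult[OF m h(2)]]) (simp add: nn)
    finally show "ennreal ((conv \<rho> h x)\<^sup>2) \<le> (\<integral>\<^sup>+y. ennreal (\<rho> (x - y) * (h y)\<^sup>2) \<partial>lborel)" .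
  qed
  also have "\<dots> = (\<integral>\<^sup>+y. \<integral>\<^sup>+x. ennreal (\<rho> (x - y) * (h y)\<^sup>2) \<partial>lborel \<partial>lborel)"
    by (rule lborel_pair.Fubini') measurable
  also have "\<dots> = (\<integral>\<^sup>+y. ennreal ((h y)\<^sup>2) \<partial>lborel)"
  proof (rule nn_integral_cong)
    fix y
    have "(\<integral>\<^sup>+x. ennreal (\<rho> (x - y) * (h y)\<^sup>2) \<partial>lborel)
        = (\<integral>\<^sup>+x. ennreal (\<rho> (x - y)) * ennreal ((h y)\<^sup>2) \<partial>lborel)"
      by (simp add: ennreal_mult nn)
    also have "\<dots> = (\<integral>\<^sup>+x. ennreal (\<rho> (x - y)) \<partial>lborel) * ennreal ((h y)\<^sup>2)"
      by (rule nn_integral_multc) measurable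
    \<comment> \<open>Translation by y is written as a composition of two reflections, first about 0
      and then x to -y - x.\<close>
    also have "(\<integral>\<^sup>+x. ennreal (\<rho> (x - y)) \<partial>lborel) = (\<integral>\<^sup>+x. ennreal (\<rho> x) \<partial>lborel)"
    proof -
      have "(\<integral>\<^sup>+x. ennreal (\<rho> (x - y)) \<partial>lborel) = (\<integral>\<^sup>+x. ennreal (\<rho> ((0 - x) - y)) \<partial>lborel)"
        by (rule nn_integral_reflect[symmetric]) measurable
      also have "\<dots> = (\<integral>\<^sup>+x. ennreal (\<rho> (- y - x)) \<partial>lborel)"
      proof (rule nn_integral_cong)
        fix x :: 'a
        have "0 - x - y = - y - x" by (simp add: algebra_simps)
        then show "ennreal (\<rho> (0 - x - y)) = ennreal (\<rho> (- y - x))" by (simp only:)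
      qed
      also have "\<dots> = (\<integral>\<^sup>+x. ennreal (\<rho> x) \<partial>lborel)"
        by (rule nn_integral_reflect) measurable
      finally show ?thesis .
    qed
    also have "\<dots> = ennreal (\<integral>x. \<rho> x \<partial>lborel)"
      using m nn by (intro nn_integral_eq_integral) (auto simp: mollifier_def)
    finally show "(\<integral>\<^sup>+x. ennreal (\<rho> (x - y) * (h y)\<^sup>2) \<partial>lborel) = ennreal ((h y)\<^sup>2)"
      using m by (simp add: mollifier_def)
  qed
  finally show ?thesis by (simp add: l2sq_def)
qed

text \<open>Truncating h both in space and in value gives a bounded function of bounded support
  close to h. Lebesgue measurability makes it an almost everywhere limit of continuous functions;
  clipping these to the same range and cutting them off gives a common integrable majorant, so the
  convergence holds in L2.\<close>

lemma l2_dense_continuous: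
  fixes h :: "'a::euclidean_space \<Rightarrow> real"
  assumes h: "h \<in> borel_measurable borel" "integrable lborel (\<lambda>x. (h x)\<^sup>2)" and "0 < e"
  obtains g R where "continuous_on UNIV g" "\<And>x. R < norm x \<Longrightarrow> g x = 0" "l2sq (\<lambda>x. h x - g x) < ennreal e"
proof -
  note [measurable] = h(1)
  define T where "T = (\<lambda>N x. if norm x \<le> real N then max (- real N) (min (real N) (h x)) else 0)"
  have T_meas [measurable]: "T N \<in> borel_measurable borel" for N unfolding T_def by measurable
  have "(\<lambda>N. \<integral>\<^sup>+x. ennreal ((h x - T N x)\<^sup>2) \<partial>lborel) \<longlonglongrightarrow> (\<integral>\<^sup>+x. 0 \<partial>(lborel :: 'a measure))"
  proof (rule nn_integral_dominated_convergence[where w="\<lambda>x. ennreal ((h x)\<^sup>2)"])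
    show "(\<integral>\<^sup>+x. ennreal ((h x)\<^sup>2) \<partial>lborel) < \<infinity>"
      using h(2) l2sq_integrable_iff[OF h(1)] by (simp add: l2sq_def)
    show "AE x in lborel. ennreal ((h x - T N x)\<^sup>2) \<le> ennreal ((h x)\<^sup>2)" for N
    proof (rule AE_I2, rule ennreal_leI)
      fix x :: 'a
      have "\<bar>h x - T N x\<bar> \<le> \<bar>h x\<bar>" by (auto simp: T_def)
      then show "(h x - T N x)\<^sup>2 \<le> (h x)\<^sup>2" by (simp add: abs_le_square_iff)
    qed
    show "AE x in lborel. (\<lambda>N. ennreal ((h x - T N x)\<^sup>2)) \<longlonglongrightarrow> 0"
    proof (rule AE_I2)
      fix x :: 'a
      obtain N0 :: nat where N0: "norm x + \<bar>h x\<bar> \<le> real N0" using real_arch_simple by blast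
      have "\<forall>\<^sub>F N in sequentially. ennreal ((h x - T N x)\<^sup>2) = 0"
        using eventually_ge_at_top[of N0]
      proof eventually_elim
        case (elim N)
        then have "real N0 \<le> real N" by simp
        with N0 have "norm x \<le> real N" "\<bar>h x\<bar> \<le> real N"
          by (smt (verit) norm_ge_zero)+
        then have "T N x = h x" by (auto simp: T_def)
        then show ?case by simp
      qed
      then show "(\<lambda>N. ennreal ((h x - T N x)\<^sup>2)) \<longlonglongrightarrow> 0" by (rule tendsto_eventually)
    qed
  qed measurable
  then have "(\<lambda>N. l2sq (\<lambda>x. h x - T N x)) \<longlonglongrightarrow> 0" by (simp add: l2sq_def)
  moreover have "(0::ennreal) < ennreal (e / 6)" using \<open>0 < e\<close> by simp
  ultimately have "\<forall>\<^sub>F N in sequentially. l2sq (\<lambda>x. h x - T N x) < ennreal (e / 6)"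
    by (rule order_tendstoD(2))
  then obtain N where N: "l2sq (\<lambda>x. h x - T N x) < ennreal (e / 6)"
    by (auto simp: eventually_sequentially)

  have "T N measurable_on UNIV"
    by (rule lebesgue_measurable_imp_measurable_on[OF _ ]) (auto intro: measurable_completion)
  then obtain Z F where Z: "negligible Z" and F: "\<And>n. continuous_on UNIV (F n)"
    and lim: "\<And>x. x \<notin> Z \<Longrightarrow> (\<lambda>n. F n x) \<longlonglongrightarrow> T N x"
    unfolding measurable_on_def by auto
  \<comment> \<open>A continuous cutoff equal to 1 where \<open>T N\<close> can be nonzero and
    vanishing from norm N + 1 on. Multiplying by it therefore does not change the limit
    \<open>T N\<close>.\<close>
  define \<kappa> where "\<kappa> = (\<lambda>x::'a. max 0 (min 1 (real N + 1 - norm x)))"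
  define G where "G = (\<lambda>n x. \<kappa> x * max (- real N) (min (real N) (F n x)))"
  have G_cont: "continuous_on UNIV (G n)" for n
    unfolding G_def \<kappa>_def by (intro continuous_intros F)
  have [measurable]: "G n \<in> borel_measurable borel" for n
    by (rule borel_measurable_continuous_onI[OF G_cont])
  have Zae: "AE x in lborel. x \<notin> Z"
    using Z by (metis AE_completion_iff AE_not_in negligible_iff_null_sets)
  have "(\<lambda>n. \<integral>\<^sup>+x. ennreal ((T N x - G n x)\<^sup>2) \<partial>lborel) \<longlonglongrightarrow> (\<integral>\<^sup>+x. 0 \<partial>(lborel :: 'a measure))"
  proof (rule nn_integral_dominated_convergence
      [where w="\<lambda>x. ennreal ((2 * real N)\<^sup>2) * indicator (cball 0 (real N + 1)) x"])
    show "(\<integral>\<^sup>+x. ennreal ((2 * real N)\<^sup>2) * indicator (cball (0::'a) (real N + 1)) x \<partial>lborel) < \<infinity>"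
      using emeasure_lborel_cball_finite[of "0::'a" "real N + 1"]
      by (simp add: nn_integral_cmult_indicator ennreal_mult_less_top)
    show "AE x in lborel. ennreal ((T N x - G n x)\<^sup>2) \<le> ennreal ((2 * real N)\<^sup>2) * indicator (cball 0 (real N + 1)) x" for n
    proof (rule AE_I2)
      fix x :: 'a
      show "ennreal ((T N x - G n x)\<^sup>2) \<le> ennreal ((2 * real N)\<^sup>2) * indicator (cball 0 (real N + 1)) x"
      proof (cases "norm x \<le> real N + 1")
        case True
        have t: "\<bar>T N x\<bar> \<le> real N" by (auto simp: T_def)
        have "0 \<le> \<kappa> x" "\<kappa> x \<le> 1" by (auto simp: \<kappa>_def)
        then have "\<bar>G n x\<bar> \<le> 1 * real N"
          unfolding G_def abs_mult by (intro mult_mono) auto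
        with t have "\<bar>T N x - G n x\<bar> \<le> \<bar>2 * real N\<bar>" by linarith
        then have "(T N x - G n x)\<^sup>2 \<le> (2 * real N)\<^sup>2" by (simp only: abs_le_square_iff)
        then show ?thesis using True by (simp add: ennreal_leI)
      next
        case False
        then show ?thesis by (simp add: T_def G_def \<kappa>_def)
      qed
    qed
    show "AE x in lborel. (\<lambda>n. ennreal ((T N x - G n x)\<^sup>2)) \<longlonglongrightarrow> 0"
      using Zae
    proof eventually_elim
      case (elim x)
      have "(\<lambda>n. G n x) \<longlonglongrightarrow> \<kappa> x * max (- real N) (min (real N) (T N x))"
        unfolding G_def by (intro tendsto_intros lim elim)
      moreover have "\<kappa> x * max (- real N) (min (real N) (T N x)) = T N x"
        by (auto simp: T_def \<kappa>_def)
      ultimately have "(\<lambda>n. (T N x - G n x)\<^sup>2) \<longlonglongrightarrow> (T N x - T N x)\<^sup>2"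
        by (intro tendsto_intros) simp
      then show ?case by (metis cancel_comm_monoid_add_class.diff_cancel ennreal_0 tendsto_ennrealI zero_power2)
    qed
  qed (measurable, simp)
  then have "(\<lambda>n. l2sq (\<lambda>x. T N x - G n x)) \<longlonglongrightarrow> 0" by (simp add: l2sq_def)
  moreover have "(0::ennreal) < ennreal (e / 6)" using \<open>0 < e\<close> by simp
  ultimately have "\<forall>\<^sub>F n in sequentially. l2sq (\<lambda>x. T N x - G n x) < ennreal (e / 6)"
    by (rule order_tendstoD(2))
  then obtain n where n: "l2sq (\<lambda>x. T N x - G n x) < ennreal (e / 6)"
    by (auto simp: eventually_sequentially)
  have "l2sq (\<lambda>x. (h x - T N x) + (T N x - G n x) + 0)
      \<le> 3 * (l2sq (\<lambda>x. h x - T N x) + l2sq (\<lambda>x. T N x - G n x) + l2sq (\<lambda>x::'a. 0))"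
    by (rule l2sq_add3) measurable
  also have "\<dots> = 3 * (l2sq (\<lambda>x. h x - T N x) + l2sq (\<lambda>x. T N x - G n x))" by (simp add: l2sq_def)
  also have "\<dots> < 3 * (ennreal (e / 6) + ennreal (e / 6))"
    using add_strict_mono[OF N n] by (intro ennreal_mult_strict_left_mono) auto
  also have "\<dots> = ennreal e"
    using \<open>0 < e\<close> by (simp flip: ennreal_plus ennreal_mult ennreal_numeral)
  finally have "l2sq (\<lambda>x. h x - G n x) < ennreal e" by simp
  moreover have "G n x = 0" if "real N + 1 < norm x" for x
    using that by (simp add: G_def \<kappa>_def)
  ultimately show ?thesis using that[OF G_cont] by blast
qed

lemma conv_eq_0:
  assumes "mollifier \<delta> \<rho>" "\<And>x. R < norm x \<Longrightarrow> g x = 0" "R + \<delta> < norm x"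
  shows "conv \<rho> g x = 0"
proof -
  have "\<rho> (x - y) * g y = 0" for y
  proof (cases "R < norm y")
    case False
    have "norm x \<le> norm (x - y) + norm y" by (metis add_diff_cancel diff_add_cancel norm_triangle_ineq)
    then have "\<delta> < norm (x - y)" using assms(3) False by linarith
    then show ?thesis using assms(1) by (simp add: mollifier_def)
  qed (use assms(2) in simp)
  then have "(\<lambda>y. \<rho> (x - y) * g y) = (\<lambda>_. 0)" by (rule ext)
  then show ?thesis by (simp only: conv_def Bochner_Integration.integral_zero)
qed

lemma l2sq_conv_continuous:
  fixes g :: "'a::euclidean_space \<Rightarrow> real"
  assumes m: "\<And>j. mollifier (\<delta> j) (\<rho> j)" and \<delta>: "\<delta> \<longlonglongrightarrow> 0"
    and g: "continuous_on UNIV g" "\<And>x. R < norm x \<Longrightarrow> g x = 0"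
  shows "(\<lambda>j. l2sq (\<lambda>x. conv (\<rho> j) g x - g x)) \<longlonglongrightarrow> 0"
proof -
  let ?B = "cball (0::'a) (R + 1)"
  have u: "uniform_limit ?B (\<lambda>j. conv (\<rho> j) g) g sequentially"
    by (rule uniform_limit_conv[OF m \<delta> g(1)]) simp
  have fin: "emeasure lborel ?B < \<infinity>" by (rule emeasure_lborel_cball_finite)
  have bound: "\<forall>\<^sub>F j in sequentially. l2sq (\<lambda>x. conv (\<rho> j) g x - g x) \<le> ennreal (e\<^sup>2) * emeasure lborel ?B"
    if "0 < e" for e :: real
  proof -
    have "\<forall>\<^sub>F j in sequentially. \<delta> j < 1" by (rule order_tendstoD(2)[OF \<delta>]) simp
    with uniform_limitD[OF u that] show ?thesis
    proof eventually_elim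
      case (elim j)
      have "l2sq (\<lambda>x. conv (\<rho> j) g x - g x) \<le> (\<integral>\<^sup>+x. ennreal (e\<^sup>2) * indicator ?B x \<partial>lborel)"
        unfolding l2sq_def
      proof (rule nn_integral_mono)
        fix x :: 'a
        show "ennreal ((conv (\<rho> j) g x - g x)\<^sup>2) \<le> ennreal (e\<^sup>2) * indicator ?B x"
        proof (cases "x \<in> ?B")
          case True
          then have "\<bar>conv (\<rho> j) g x - g x\<bar> \<le> \<bar>e\<bar>" using elim(1) by (force simp: dist_real_def)
          then have "(conv (\<rho> j) g x - g x)\<^sup>2 \<le> e\<^sup>2" by (simp only: abs_le_square_iff)
          then show ?thesis using True by (simp add: ennreal_leI)
        next
          case False
          then have "R + 1 < norm x" by simp
          then have "conv (\<rho> j) g x = 0" "g x = 0"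
            using elim(2) by (auto intro!: conv_eq_0[OF m g(2)] g(2))
          then show ?thesis by simp
        qed
      qed
      also have "\<dots> = ennreal (e\<^sup>2) * emeasure lborel ?B" by (simp add: nn_integral_cmult_indicator)
      finally show ?case .
    qed
  qed
  show ?thesis
  proof (rule order_tendstoI)
    fix a :: ennreal assume "0 < a"
    \<comment> \<open>Capping at 1 makes the threshold a finite number even if a is infinite, so
      that it can be handled as a real.\<close>
    define b where "b = min a 1"
    have b: "0 < b" "b < \<infinity>" "b \<le> a" using \<open>0 < a\<close>
      by (auto simp: b_def min_less_iff_disj)
    define M where "M = measure lborel ?B"
    have M: "emeasure lborel ?B = ennreal M" "0 \<le> M"
      using fin by (auto simp: M_def emeasure_eq_ennreal_measure)
    obtain b' where b': "b = ennreal b'" "0 < b'"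
      using b by (cases b) auto
    \<comment> \<open>Chosen such that \<open>e\<^sup>2 * M < b'\<close>. The summand 1 guards
      against M = 0, which occurs when the radius R + 1 is not positive.\<close>
    define e where "e = sqrt (b' / (2 * (M + 1)))"
    have e: "0 < e" "e\<^sup>2 = b' / (2 * (M + 1))" using b' M by (auto simp: e_def)
    have "e\<^sup>2 * M < b'"
    proof -
      have "e\<^sup>2 * M \<le> e\<^sup>2 * (M + 1)" by (intro mult_left_mono zero_le_power2) simp
      also have "\<dots> = b' / 2" using M(2) e(2) by (simp add: field_simps)
      finally show ?thesis using b'(2) by simp
    qed
    then have "ennreal (e\<^sup>2) * emeasure lborel ?B < b"
      using M b' by (simp add: ennreal_lessI flip: ennreal_mult)
    then show "\<forall>\<^sub>F j in sequentially. l2sq (\<lambda>x. conv (\<rho> j) g x - g x) < a"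
      using bound[OF e(1)] b(3) by (auto elim!: eventually_mono)
  qed simp
qed

text \<open>Density argument: h is replaced by a continuous g of bounded support. The error h - g is
  not enlarged by convolution, uniformly in j, and for g itself the convergence is uniform on a
  fixed ball.\<close>

lemma l2sq_conv_tendsto:
  fixes h :: "'a::euclidean_space \<Rightarrow> real"
  assumes m: "\<And>j. mollifier (\<delta> j) (\<rho> j)" and \<delta>: "\<delta> \<longlonglongrightarrow> 0"
    and h: "integrable lborel h" "integrable lborel (\<lambda>x. (h x)\<^sup>2)"
  shows "(\<lambda>j. l2sq (\<lambda>x. conv (\<rho> j) h x - h x)) \<longlonglongrightarrow> 0"
proof (rule order_tendstoI)
  fix a :: ennreal assume "0 < a"
  have hm [measurable]: "h \<in> borel_measurable borel" using h(1) by simp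
  have \<rho>m [measurable]: "\<rho> j \<in> borel_measurable borel" for j
    using m[of j] by (auto simp: mollifier_def intro: borel_measurable_continuous_onI smooth_continuous)
  define b where "b = min a 1"
  have b: "0 < b" "b < \<infinity>" "b \<le> a" using \<open>0 < a\<close> by (auto simp: b_def min_less_iff_disj)
  then obtain b' where b': "b = ennreal b'" "0 < b'" by (cases b) auto
  obtain g R where g: "continuous_on UNIV g" "\<And>x. R < norm x \<Longrightarrow> g x = 0"
    and hg: "l2sq (\<lambda>x. h x - g x) < ennreal (b' / 9)"
    by (rule l2_dense_continuous[OF hm h(2), of "b' / 9"]) (use b' in auto)
  have gm [measurable]: "g \<in> borel_measurable borel" by (rule borel_measurable_continuous_onI[OF g(1)])
  have "0 < ennreal (b' / 9)" using b' by simp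
  with l2sq_conv_continuous[OF m \<delta> g]
  have "\<forall>\<^sub>F j in sequentially. l2sq (\<lambda>x. conv (\<rho> j) g x - g x) < ennreal (b' / 9)"
    by (rule order_tendstoD(2))
  then show "\<forall>\<^sub>F j in sequentially. l2sq (\<lambda>x. conv (\<rho> j) h x - h x) < a"
  proof eventually_elim
    case (elim j)
    have gi: "integrable lborel g" "integrable lborel (\<lambda>x. (g x)\<^sup>2)"
      by (rule integrable_continuous_compact_support[of _ "cball 0 R"];
          use g in \<open>auto intro!: continuous_intros\<close>)+
    have "integrable lborel (\<lambda>x. (h x - g x)\<^sup>2)"
      using hg by (subst l2sq_integrable_iff) (auto intro: less_trans)
    moreover have "integrable lborel (\<lambda>x. h x - g x)" using h gi by simp
    ultimately have "l2sq (conv (\<rho> j) (\<lambda>x. h x - g x)) \<le> l2sq (\<lambda>x. h x - g x)"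
      by (intro l2sq_conv_le[OF m])
    moreover have "conv (\<rho> j) (\<lambda>x. h x - g x) = (\<lambda>x. conv (\<rho> j) h x - conv (\<rho> j) g x)"
      using integrable_mollifier_mult[OF m h(1)] integrable_mollifier_mult[OF m gi(1)]
      by (simp add: fun_eq_iff conv_def right_diff_distrib)
    ultimately have 1: "l2sq (\<lambda>x. conv (\<rho> j) h x - conv (\<rho> j) g x) \<le> l2sq (\<lambda>x. h x - g x)" by simp
    have 2: "l2sq (\<lambda>x. g x - h x) = l2sq (\<lambda>x. h x - g x)"
      by (simp add: l2sq_def power2_commute)
    have [measurable]: "conv (\<rho> j) h \<in> borel_measurable borel" "conv (\<rho> j) g \<in> borel_measurable borel"
      by (rule conv_measurable; measurable)+
    have "l2sq (\<lambda>x. conv (\<rho> j) h x - h x)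
      = l2sq (\<lambda>x. (conv (\<rho> j) h x - conv (\<rho> j) g x) + (conv (\<rho> j) g x - g x) + (g x - h x))"
      by simp
    also have "\<dots> \<le> 3 * (l2sq (\<lambda>x. conv (\<rho> j) h x - conv (\<rho> j) g x) + l2sq (\<lambda>x. conv (\<rho> j) g x - g x)
        + l2sq (\<lambda>x. g x - h x))"
      by (rule l2sq_add3) measurable
    also have "\<dots> \<le> 3 * (l2sq (\<lambda>x. h x - g x) + l2sq (\<lambda>x. conv (\<rho> j) g x - g x) + l2sq (\<lambda>x. h x - g x))"
      unfolding 2 using 1 by (intro mult_left_mono add_mono) auto
    also have "\<dots> < 3 * (ennreal (b' / 9) + ennreal (b' / 9) + ennreal (b' / 9))"
      using add_strict_mono[OF add_strict_mono[OF hg elim] hg] by (intro ennreal_mult_strict_left_mono) auto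
    also have "\<dots> = b" using b' by (simp flip: ennreal_plus ennreal_mult ennreal_numeral)
    finally show ?case using b(3) by simp
  qed
qed simp

text \<open>Pairs a strongly convergent sequence with a fixed square-integrable function by
  \<open>2 \<bar>F D\<bar> \<le> t F\<^sup>2 + D\<^sup>2 / t\<close>, which replaces the Cauchy--Schwarz inequality.\<close>

lemma integral_mult_tendsto_0:
  fixes F :: "'a::euclidean_space \<Rightarrow> real"
  assumes F: "F \<in> borel_measurable borel" "integrable lborel (\<lambda>x. (F x)\<^sup>2)"
    and D: "\<And>j. D j \<in> borel_measurable borel" "(\<lambda>j. l2sq (D j)) \<longlonglongrightarrow> 0"
    and H: "\<And>j. H j \<in> borel_measurable borel" "\<And>j x. \<bar>H j x\<bar> \<le> B"
  shows "(\<lambda>j. \<integral>x. H j x * F x * D j x \<partial>lborel) \<longlonglongrightarrow> 0"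
    and "\<forall>\<^sub>F j in sequentially. integrable lborel (\<lambda>x. H j x * F x * D j x)"
proof -
  note [measurable] = F(1) D(1) H(1)
  have D2: "\<forall>\<^sub>F j in sequentially. integrable lborel (\<lambda>x. (D j x)\<^sup>2) \<and> (\<integral>x. (D j x)\<^sup>2 \<partial>lborel) < e"
    if "0 < e" for e
  proof -
    have "0 < ennreal e" using that by simp
    with D(2) have "\<forall>\<^sub>F j in sequentially. l2sq (D j) < ennreal e" by (rule order_tendstoD(2))
    then show ?thesis
    proof eventually_elim
      case (elim j)
      then have i: "integrable lborel (\<lambda>x. (D j x)\<^sup>2)"
        by (subst l2sq_integrable_iff[OF D(1)]) (auto intro: less_trans)
      have "ennreal (\<integral>x. (D j x)\<^sup>2 \<partial>lborel) < ennreal e"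
        using elim l2sq_integrable[OF D(1) i] by simp
      then show ?case using i by (simp add: ennreal_less_iff)
    qed
  qed
  have B: "0 \<le> B" using H(2)[of 0 0] by (meson abs_ge_zero order_trans)
  have pt: "\<bar>H j x * F x * D j x\<bar> \<le> (B / 2) * (t * (F x)\<^sup>2 + (D j x)\<^sup>2 / t)" if "0 < t" for j x t
  proof -
    have "0 \<le> (t * \<bar>F x\<bar> - \<bar>D j x\<bar>)\<^sup>2 / t" using that by simp
    also have "\<dots> = t * (F x)\<^sup>2 + (D j x)\<^sup>2 / t - 2 * (\<bar>F x\<bar> * \<bar>D j x\<bar>)"
      using that by (simp add: power2_eq_square field_simps)
    finally have *: "\<bar>F x\<bar> * \<bar>D j x\<bar> \<le> (t * (F x)\<^sup>2 + (D j x)\<^sup>2 / t) / 2" by simp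
    have "\<bar>H j x * F x * D j x\<bar> = \<bar>H j x\<bar> * (\<bar>F x\<bar> * \<bar>D j x\<bar>)" by (simp add: abs_mult)
    also have "\<dots> \<le> B * ((t * (F x)\<^sup>2 + (D j x)\<^sup>2 / t) / 2)"
      using * H(2) B by (intro mult_mono) auto
    finally show ?thesis by simp
  qed
  have int: "integrable lborel (\<lambda>x. H j x * F x * D j x)" if "integrable lborel (\<lambda>x. (D j x)\<^sup>2)" for j
  proof (rule Bochner_Integration.integrable_bound)
    show "integrable lborel (\<lambda>x. (B / 2) * (1 * (F x)\<^sup>2 + (D j x)\<^sup>2 / 1))"
      using F(2) that by simp
    have "\<bar>H j x * F x * D j x\<bar> \<le> \<bar>(B / 2) * (1 * (F x)\<^sup>2 + (D j x)\<^sup>2 / 1)\<bar>" for x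
      using pt[of 1 j x] by linarith
    then show "AE x in lborel. norm (H j x * F x * D j x) \<le> norm ((B / 2) * (1 * (F x)\<^sup>2 + (D j x)\<^sup>2 / 1))"
      by (simp only: real_norm_def AE_I2)
  qed measurable
  show "\<forall>\<^sub>F j in sequentially. integrable lborel (\<lambda>x. H j x * F x * D j x)"
    using D2[OF zero_less_one] by eventually_elim (use int in auto)
  show "(\<lambda>j. \<integral>x. H j x * F x * D j x \<partial>lborel) \<longlonglongrightarrow> 0"
  proof (rule tendstoI)
    fix e :: real assume "0 < e"
    define M where "M = (\<integral>x. (F x)\<^sup>2 \<partial>lborel)"
    have M: "0 \<le> M" by (simp add: M_def)
    \<comment> \<open>With this weight the first term satisfies
      \<open>t * (M + 1) = e / (B + 1)\<close>, and asking the squared norm of \<open>D j\<close> to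
      be below \<open>e * t / (B + 1)\<close> bounds the second term by the same quantity. Adding 1
      to B and M avoids vanishing denominators.\<close>
    define t where "t = e / ((B + 1) * (M + 1))"
    have t: "0 < t" using \<open>0 < e\<close> B M by (auto simp: t_def)
    have "0 < e * t / (B + 1)" using t B \<open>0 < e\<close> by (intro divide_pos_pos mult_pos_pos) auto
    from D2[OF this] show "\<forall>\<^sub>F j in sequentially. dist (\<integral>x. H j x * F x * D j x \<partial>lborel) 0 < e"
    proof eventually_elim
      case (elim j)
      have "\<bar>\<integral>x. H j x * F x * D j x \<partial>lborel\<bar> \<le> (\<integral>x. (B / 2) * (t * (F x)\<^sup>2 + (D j x)\<^sup>2 / t) \<partial>lborel)"
        by (rule integral_abs_bound_integral) (use int elim F pt t in auto)
      also have "\<dots> = (B / 2) * (t * M + (\<integral>x. (D j x)\<^sup>2 \<partial>lborel) / t)"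
        using F elim by (simp add: M_def)
      also have "\<dots> \<le> ((B + 1) / 2) * (t * (M + 1) + (\<integral>x. (D j x)\<^sup>2 \<partial>lborel) / t)"
        using B M t by (intro mult_mono add_mono) auto
      also have "\<dots> < ((B + 1) / 2) * (e / (B + 1) + e / (B + 1))"
      proof -
        have "M + 1 \<noteq> 0" using M by linarith
        then have "t * (M + 1) = e / (B + 1)" by (simp add: t_def)
        moreover have "(\<integral>x. (D j x)\<^sup>2 \<partial>lborel) / t < e / (B + 1)"
          using elim t B by (simp add: field_simps)
        ultimately show ?thesis using B by (intro mult_strict_left_mono) auto
      qed
      also have "\<dots> = (B + 1) * (e / (B + 1))" by simp
      also have "\<dots> = e" using B by simp
      finally show ?case by simp
    qed
  qed
qed

section \<open>Weak gradients and truncation\<close>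

text \<open>Convolving f with the constant 1 gives the constant function with value the integral of
  f. Its derivative is 0 on the one hand and the integral of the derivative of f on the other.
  Applied to products this becomes integration by parts.\<close>

lemma integral_frechet_derivative_eq_0:
  fixes f :: "'a::euclidean_space \<Rightarrow> real"
  assumes f: "smooth f" and supp: "\<And>x. R < norm x \<Longrightarrow> f x = 0"
  shows "(\<integral>x. frechet_derivative f (at x) v \<partial>lborel) = 0"
proof -
  have fm [measurable]: "f \<in> borel_measurable borel" "(\<lambda>x. frechet_derivative f (at x) v) \<in> borel_measurable borel"
    by (intro borel_measurable_continuous_onI smooth_continuous smooth_frechet f)+
  have "conv f (\<lambda>_. 1) = (\<lambda>x. \<integral>y. f y \<partial>lborel)"
    by (rule ext) (simp add: conv_def integral_reflect)
  moreover have "(conv f (\<lambda>_. 1) has_derivative (\<lambda>v. conv (\<lambda>x. frechet_derivative f (at x) v) (\<lambda>_. 1) 0)) (at 0)"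
    by (rule conv_has_derivative[OF f supp]) auto
  ultimately have "((\<lambda>x::'a. \<integral>y. f y \<partial>lborel) has_derivative
     (\<lambda>v. conv (\<lambda>x. frechet_derivative f (at x) v) (\<lambda>_. 1) 0)) (at 0)" by simp
  from has_derivative_unique[OF this has_derivative_const]
  have "conv (\<lambda>x. frechet_derivative f (at x) v) (\<lambda>_. 1) 0 = 0" by (simp add: fun_eq_iff)
  then show ?thesis using integral_reflect[OF fm(2), of 0] by (simp add: conv_def)
qed

lemma continuous_on_extend_0:
  fixes f :: "'a::t2_space \<Rightarrow> 'b::{topological_space,zero}"
  assumes "continuous_on V f" "open V" "compact K" "K \<subseteq> V" "\<And>x. x \<notin> K \<Longrightarrow> f x = 0"
  shows "continuous_on UNIV f"
proof -
  have o: "open (- K)" using assms(3) by (simp add: compact_imp_closed open_Compl)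
  have "continuous_on (- K) f"
    by (rule continuous_on_eq[OF continuous_on_const[of _ 0]]) (use assms(5) in auto)
  with assms(1,2) o have "continuous_on (V \<union> - K) f" by (intro continuous_on_open_Un)
  moreover have "V \<union> - K = UNIV" using assms(4) by auto
  ultimately show ?thesis by simp
qed

definition grad :: "(real^'n \<Rightarrow> real) \<Rightarrow> real^'n \<Rightarrow> real^'n" where
  "grad f x = (\<chi> i. frechet_derivative f (at x) (axis i 1))"

text \<open>Nothing is known about w outside V, not even measurability, so w only enters global
  integrals multiplied by the indicator of a compact subset of V.\<close>

lemma L2_loc_component:
  fixes w :: "real^'n \<Rightarrow> real^'n"
  assumes "L2_loc V w" "compact K" "K \<subseteq> V"
  shows "(\<lambda>x. indicator K x * w x $ i) \<in> borel_measurable borel"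
    and "integrable lborel (\<lambda>x. (indicator K x * w x $ i)\<^sup>2)"
proof -
  have wm: "(\<lambda>x. indicator V x *\<^sub>R w x) \<in> borel_measurable borel"
    using assms(1) by (simp add: L2_loc_def set_borel_measurable_def)
  have [measurable]: "K \<in> sets borel" using assms(2) by (simp add: borel_compact)
  have "(\<lambda>x. indicator K x * w x $ i) = (\<lambda>x. indicator K x * ((indicator V x *\<^sub>R w x) \<bullet> axis i 1))"
    using assms(3) by (auto simp: fun_eq_iff inner_axis indicator_def)
  also have "\<dots> \<in> borel_measurable borel" using wm by measurable
  finally show m [measurable]: "(\<lambda>x. indicator K x * w x $ i) \<in> borel_measurable borel" .
  have wi: "integrable lborel (\<lambda>x. indicator K x * (norm (w x))\<^sup>2)"
    using assms by (simp add: L2_loc_def set_integrable_def)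
  show "integrable lborel (\<lambda>x. (indicator K x * w x $ i)\<^sup>2)"
  proof (rule Bochner_Integration.integrable_bound[OF wi])
    show "AE x in lborel. norm ((indicator K x * w x $ i)\<^sup>2) \<le> norm (indicator K x * (norm (w x))\<^sup>2)"
      using component_le_norm_cart[of _ i] by (auto simp: indicator_def abs_le_square_iff[symmetric])
  qed measurable
qed

lemma test_funD:
  assumes "test_fun V \<psi>"
  obtains K where "smooth \<psi>" "compact K" "K \<subseteq> V" "\<And>x. x \<notin> K \<Longrightarrow> \<psi> x = 0" "\<And>x. x \<notin> K \<Longrightarrow> grad \<psi> x = 0"
proof -
  define K where "K = closure {x. \<psi> x \<noteq> 0}"
  have a: "smooth \<psi>" "compact K" "K \<subseteq> V" using assms by (simp_all add: test_fun_def K_def)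
  have 0: "\<psi> x = 0" if "x \<notin> K" for x
  proof -
    have "x \<notin> {x. \<psi> x \<noteq> 0}" using that unfolding K_def by (rule contra_subsetD[OF closure_subset])
    then show ?thesis by simp
  qed
  have "frechet_derivative \<psi> (at x) v = 0" if "x \<notin> K" for x v
    by (rule frechet_derivative_outside_support[OF compact_imp_closed[OF a(2)] 0 that])
  then have "grad \<psi> x = 0" if "x \<notin> K" for x
    using that by (simp add: grad_def vec_eq_iff)
  from that[OF a 0 this] show ?thesis .
qed

text \<open>For x in K the function y to \<rho>(x - y) is itself admissible in the definition of the
  weak gradient. Hence differentiating the mollification of u gives the mollification of w at x, and
  L2 convergence of the gradients on K is the convergence of mollifications.\<close>

lemma weak_gradient_approx:
  fixes V K :: "(real^'n) set"
  assumes V: "open V" "continuous_on V u" "L2_loc V w" "weak_gradient_on V u w"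
    and K: "compact K" "K \<subseteq> V"
  obtains U g where "\<And>j::nat. smooth (U j)" "continuous_on UNIV g" "\<And>x. x \<in> K \<Longrightarrow> g x = u x"
    "\<And>x. x \<in> K \<Longrightarrow> (\<lambda>j. U j x) \<longlonglongrightarrow> g x" "\<And>j x. x \<in> K \<Longrightarrow> \<bar>U j x - g x\<bar> \<le> 1"
    "\<And>i. (\<lambda>j. l2sq (\<lambda>x. indicator K x * (grad (U j) x $ i - w x $ i))) \<longlonglongrightarrow> 0"
proof -
  obtain e where e: "0 < e" "(\<Union>x\<in>K. ball x e) \<subseteq> V"
    using compact_subset_open_imp_ball_epsilon_subset[OF K(1) V(1) K(2)] by blast
  \<comment> \<open>A compact neighbourhood of K still inside V; it contains the supports of all
    mollifiers of radius at most e/2 centred in K.\<close>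
  define K' where "K' = {x + y | x y. x \<in> K \<and> y \<in> cball 0 (e/2)}"
  have K': "compact K'" unfolding K'_def by (intro compact_sums K(1) compact_cball)
  have cb: "cball x (e/2) \<subseteq> K'" if "x \<in> K" for x
  proof
    fix y assume "y \<in> cball x (e/2)"
    then have "y - x \<in> cball 0 (e/2)" by (simp add: dist_norm norm_minus_commute)
    moreover have "y = x + (y - x)" by simp
    ultimately show "y \<in> K'" using that unfolding K'_def by blast
  qed
  have KK': "K \<subseteq> K'" using cb e(1) by (meson centre_in_cball half_gt_zero less_imp_le subset_iff)
  have K'V: "K' \<subseteq> V"
  proof
    fix z assume "z \<in> K'"
    then obtain x y where "z = x + y" "x \<in> K" "norm y \<le> e/2" unfolding K'_def by auto
    then have "z \<in> ball x e" using e(1) by (simp add: dist_norm)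
    with \<open>x \<in> K\<close> e(2) show "z \<in> V" by blast
  qed
  \<comment> \<open>The convolution lemmas ask for a function continuous on the whole space, whence
    the Tietze extension. On K the mollifications only see values on K', where g and u
    agree.\<close>
  obtain g where g: "continuous_on UNIV g" "\<And>x. x \<in> K' \<Longrightarrow> g x = u x"
    by (rule Tietze_unbounded[OF continuous_on_subset[OF V(2) K'V], of UNIV])
      (use compact_imp_closed[OF K'] in auto)
  define \<delta> where "\<delta> = (\<lambda>j. (e/2) * inverse (real (Suc j)))"
  have \<delta>: "0 < \<delta> j" "\<delta> j \<le> e/2" for j
    using e(1) by (auto simp: \<delta>_def field_simps simp del: of_nat_Suc)
  have "\<delta> \<longlonglongrightarrow> (e/2) * 0" unfolding \<delta>_def by (intro tendsto_intros LIMSEQ_inverse_real_of_nat)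
  then have \<delta>0: "\<delta> \<longlonglongrightarrow> 0" by simp
  have "\<forall>j. \<exists>\<rho>. mollifier (\<delta> j) (\<rho> :: real^'n \<Rightarrow> real)" using \<delta>(1) mollifier_exists by metis
  then obtain \<rho> where m: "\<And>j. mollifier (\<delta> j) (\<rho> j :: real^'n \<Rightarrow> real)" by metis
  have \<rho>: "smooth (\<rho> j)" "\<And>x. 0 \<le> \<rho> j x" "\<And>x. \<delta> j < norm x \<Longrightarrow> \<rho> j x = 0" for j
    using m[of j] by (auto simp: mollifier_def)
  define U where "U = (\<lambda>j. conv (\<rho> j) g)"
  have U: "smooth (U j)" for j unfolding U_def by (rule smooth_conv[OF \<rho>(1,3) g(1)])
  define h where "h = (\<lambda>i x. indicator K' x * w x $ i)"
  have hm [measurable]: "h i \<in> borel_measurable borel" and hi2: "integrable lborel (\<lambda>x. (h i x)\<^sup>2)" for i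
    unfolding h_def by (rule L2_loc_component[OF V(3) K' K'V])+
  have Ki: "integrable lborel (indicator K' :: real^'n \<Rightarrow> real)"
    using emeasure_compact_finite[OF K'] K' by (intro integrable_real_indicator) (auto simp: borel_compact)
  have hi: "integrable lborel (h i)" for i
  proof (rule Bochner_Integration.integrable_bound)
    show "integrable lborel (\<lambda>x. indicator K' x + (h i x)\<^sup>2)" using Ki hi2 by simp
    have "\<bar>h i x\<bar> \<le> indicator K' x + (h i x)\<^sup>2" for x
    proof -
      have "0 \<le> (\<bar>h i x\<bar> - 1)\<^sup>2" by simp
      then have "2 * \<bar>h i x\<bar> \<le> 1 + (h i x)\<^sup>2" by (simp add: power2_eq_square algebra_simps)
      then show ?thesis by (cases "x \<in> K'") (auto simp: h_def)
    qed
    then show "AE x in lborel. norm (h i x) \<le> norm (indicator K' x + (h i x)\<^sup>2)"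
      by (auto intro!: AE_I2 order_trans[OF _ abs_ge_self])
  qed simp
  have DU: "grad (U j) x $ i = conv (\<rho> j) (h i) x" if x: "x \<in> K" for i j x
  proof -
    define \<psi> where "\<psi> = (\<lambda>y. \<rho> j (x - y))"
    have supp: "cball x (\<delta> j) \<subseteq> K'" using cb[OF x] \<delta>(2)[of j] by (auto simp: subset_iff)
    have \<psi>0: "\<psi> y = 0" if "y \<notin> cball x (\<delta> j)" for y
      using that \<rho>(3)[of j "x - y"] by (simp add: \<psi>_def dist_norm)
    have "bounded_linear (\<lambda>y::real^'n. - y)" by (rule bounded_linear_minus[OF bounded_linear_ident])
    then have "smooth (\<lambda>y::real^'n. x + (- y))" by (intro smooth_add smooth_const smooth_linear)
    from smooth_compose[OF this \<rho>(1)[of j]] have \<psi>s: "smooth \<psi>" by (simp add: \<psi>_def)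
    have D\<psi>: "frechet_derivative \<psi> (at y) v = - frechet_derivative (\<rho> j) (at (x - y)) v" for y v
    proof -
      have "(\<psi> has_derivative (\<lambda>v. frechet_derivative (\<rho> j) (at (x - y)) (- v))) (at y)"
        unfolding \<psi>_def
        by (rule has_derivative_compose[OF _ smooth_has_derivative[OF \<rho>(1)]]) (auto intro!: derivative_eq_intros)
      then have "frechet_derivative \<psi> (at y) v = frechet_derivative (\<rho> j) (at (x - y)) (- v)"
        by (simp add: frechet_derivative_eq)
      also have "\<dots> = - frechet_derivative (\<rho> j) (at (x - y)) v"
        by (rule linear_neg[OF has_derivative_linear[OF smooth_has_derivative[OF \<rho>(1)]]])
      finally show ?thesis .
    qed
    have "test_fun V \<psi>"
      by (rule test_funI[OF \<psi>s compact_cball[of x "\<delta> j"]]) (use supp K'V \<psi>0 in auto)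
    then have wg: "(\<integral>y. u y * frechet_derivative \<psi> (at y) (axis i 1) \<partial>lborel) = - (\<integral>y. w y $ i * \<psi> y \<partial>lborel)"
      using V(4) unfolding weak_gradient_on_def test_fun_def smooth_def by blast
    have "frechet_derivative (U j) (at x) = (\<lambda>v. conv (\<lambda>x. frechet_derivative (\<rho> j) (at x) v) g x)"
      unfolding U_def by (rule frechet_derivative_eq[OF conv_has_derivative[OF \<rho>(1,3) g(1)]])
    then have "grad (U j) x $ i = (\<integral>y. frechet_derivative (\<rho> j) (at (x - y)) (axis i 1) * g y \<partial>lborel)"
      by (simp add: grad_def conv_def)
    also have "\<dots> = (\<integral>y. - (u y * frechet_derivative \<psi> (at y) (axis i 1)) \<partial>lborel)"
    proof (rule Bochner_Integration.integral_cong[OF refl])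
      fix y
      show "frechet_derivative (\<rho> j) (at (x - y)) (axis i 1) * g y = - (u y * frechet_derivative \<psi> (at y) (axis i 1))"
      proof (cases "y \<in> cball x (\<delta> j)")
        case True
        then have "g y = u y" using supp g(2) by blast
        then show ?thesis by (simp add: D\<psi>)
      next
        case False
        have "frechet_derivative \<psi> (at y) (axis i 1) = 0"
          by (rule frechet_derivative_outside_support[OF closed_cball \<psi>0 False])
        then show ?thesis by (simp add: D\<psi>)
      qed
    qed
    also have "\<dots> = (\<integral>y. w y $ i * \<psi> y \<partial>lborel)" using wg by simp
    also have "\<dots> = conv (\<rho> j) (h i) x"
      unfolding conv_def
    proof (rule Bochner_Integration.integral_cong[OF refl])
      fix y show "w y $ i * \<psi> y = \<rho> j (x - y) * h i y"
      proof (cases "y \<in> K'")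
        case False
        then have "\<psi> y = 0" using supp by (intro \<psi>0) blast
        then show ?thesis by (simp add: \<psi>_def)
      qed (simp add: h_def \<psi>_def)
    qed
    finally show ?thesis .
  qed
  have lim2: "(\<lambda>j. l2sq (\<lambda>x. indicator K x * (grad (U j) x $ i - w x $ i))) \<longlonglongrightarrow> 0" for i
  proof (rule tendsto_sandwich[OF _ _ tendsto_const l2sq_conv_tendsto[OF m \<delta>0 hi hi2]])
    show "\<forall>\<^sub>F j in sequentially. l2sq (\<lambda>x. indicator K x * (grad (U j) x $ i - w x $ i))
        \<le> l2sq (\<lambda>x. conv (\<rho> j) (h i) x - h i x)"
      unfolding l2sq_def
    proof (intro always_eventually allI nn_integral_mono ennreal_leI)
      fix j x
      show "(indicator K x * (grad (U j) x $ i - w x $ i))\<^sup>2 \<le> (conv (\<rho> j) (h i) x - h i x)\<^sup>2"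
        using KK' DU[of x j i] by (cases "x \<in> K") (auto simp: h_def)
    qed
  qed simp
  have ul: "uniform_limit K U g sequentially"
    unfolding U_def by (rule uniform_limit_conv[OF m \<delta>0 g(1) K(1)])
  then have "\<forall>\<^sub>F j in sequentially. \<forall>x\<in>K. dist (U j x) (g x) < 1" by (rule uniform_limitD) simp
  \<comment> \<open>The returned sequence starts at N, so that the bound 1 holds for every index and
    supplies a majorant for dominated convergence.\<close>
  then obtain N where N: "\<And>j x. N \<le> j \<Longrightarrow> x \<in> K \<Longrightarrow> \<bar>U j x - g x\<bar> < 1"
    by (auto simp: eventually_sequentially dist_real_def)
  show ?thesis
  proof (rule that[of "\<lambda>j. U (j + N)" g])
    show "(\<lambda>j. U (j + N) x) \<longlonglongrightarrow> g x" if "x \<in> K" for x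
      by (rule LIMSEQ_ignore_initial_segment[OF tendsto_uniform_limitI[OF ul that]])
    show "(\<lambda>j. l2sq (\<lambda>x. indicator K x * (grad (U (j + N)) x $ i - w x $ i))) \<longlonglongrightarrow> 0" for i
      by (rule LIMSEQ_ignore_initial_segment[OF lim2])
    show "\<bar>U (j + N) x - g x\<bar> \<le> 1" if "x \<in> K" for j x using N[of "j + N" x] that by simp
  qed (use U g KK' in auto)
qed

lemma integrable_mult_l2:
  assumes "f \<in> borel_measurable borel" "g \<in> borel_measurable borel"
    "integrable lborel (\<lambda>x. (f x)\<^sup>2)" "integrable lborel (\<lambda>x. (g x)\<^sup>2)"
  shows "integrable lborel (\<lambda>x. f x * g x :: real)"
proof (rule Bochner_Integration.integrable_bound)
  show "integrable lborel (\<lambda>x. (f x)\<^sup>2 + (g x)\<^sup>2)" using assms by simp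
  show "(\<lambda>x. f x * g x) \<in> borel_measurable lborel" using assms by measurable
  have "\<bar>f x * g x\<bar> \<le> (f x)\<^sup>2 + (g x)\<^sup>2" for x
  proof -
    have "0 \<le> (\<bar>f x\<bar> - \<bar>g x\<bar>)\<^sup>2" by simp
    then have "2 * \<bar>f x * g x\<bar> \<le> (f x)\<^sup>2 + (g x)\<^sup>2" by (simp add: power2_eq_square algebra_simps abs_mult)
    then show ?thesis by linarith
  qed
  then show "AE x in lborel. norm (f x * g x) \<le> norm ((f x)\<^sup>2 + (g x)\<^sup>2)"
    by (auto intro!: AE_I2 order_trans[OF _ abs_ge_self])
qed

lemma integrable_sq_mult_bounded:
  assumes "c \<in> borel_measurable borel" "f \<in> borel_measurable borel"
    "\<And>x. \<bar>c x\<bar> \<le> B" "integrable lborel (\<lambda>x. (f x)\<^sup>2)"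
  shows "integrable lborel (\<lambda>x. (c x * f x :: real)\<^sup>2)"
proof (rule Bochner_Integration.integrable_bound)
  show "integrable lborel (\<lambda>x. B\<^sup>2 * (f x)\<^sup>2)" using assms by simp
  show "(\<lambda>x. (c x * f x)\<^sup>2) \<in> borel_measurable lborel" using assms by measurable
  have "(c x * f x)\<^sup>2 \<le> B\<^sup>2 * (f x)\<^sup>2" for x
    unfolding power_mult_distrib using assms(3)[of x]
    by (intro mult_right_mono) (auto simp flip: abs_le_square_iff)
  then show "AE x in lborel. norm ((c x * f x)\<^sup>2) \<le> norm (B\<^sup>2 * (f x)\<^sup>2)"
    by (auto intro!: AE_I2)
qed

lemma continuous_compact_support_bounded:
  fixes c :: "'a::euclidean_space \<Rightarrow> real"
  assumes "continuous_on UNIV c" "compact K" "\<And>x. x \<notin> K \<Longrightarrow> c x = 0"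
  obtains B where "\<And>x. \<bar>c x\<bar> \<le> B"
proof -
  have "bounded (c ` K)"
    by (intro compact_imp_bounded compact_continuous_image continuous_on_subset[OF assms(1)] assms(2)) auto
  then obtain B where B: "\<forall>y\<in>c ` K. norm y \<le> B" unfolding bounded_iff by blast
  have "\<bar>c x\<bar> \<le> \<bar>B\<bar>" for x
  proof (cases "x \<in> K")
    case True
    then have "\<bar>c x\<bar> \<le> B" using B by (metis imageI real_norm_def)
    then show ?thesis by linarith
  qed (use assms(3) in auto)
  then show ?thesis by (rule that)
qed

text \<open>Splitting \<open>grad (U j)\<close> into w and the error D j: the part with w converges
  by dominated convergence, as H is bounded and F w integrable, and the error is paired with a fixed
  L2 function. F is a test function in the truncation of the gradient, and a test function times
  coefficients times w in the energy term. Eventual integrability is part of the conclusion because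
  integrals of sums have to be split for given j.\<close>

lemma energy_limit:
  fixes w :: "real^'n \<Rightarrow> real^'n" and F :: "real^'n \<Rightarrow> real"
  assumes w: "L2_loc V w" and K: "compact K" "K \<subseteq> V"
    and U: "\<And>j::nat. smooth (U j)" "continuous_on UNIV g"
      "\<And>x. x \<in> K \<Longrightarrow> (\<lambda>j. U j x) \<longlonglongrightarrow> g x"
      "(\<lambda>j. l2sq (\<lambda>x. indicator K x * (grad (U j) x $ i - w x $ i))) \<longlonglongrightarrow> 0"
    and F: "F \<in> borel_measurable borel" "integrable lborel (\<lambda>x. (F x)\<^sup>2)" "\<And>x. x \<notin> K \<Longrightarrow> F x = 0"
    and H: "continuous_on UNIV H" "\<And>t. \<bar>H t\<bar> \<le> B"
  shows "(\<lambda>j. \<integral>x. H (U j x) * F x * grad (U j) x $ i \<partial>lborel) \<longlonglongrightarrow> (\<integral>x. H (g x) * F x * w x $ i \<partial>lborel)"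
    and "integrable lborel (\<lambda>x. H (g x) * F x * w x $ i)"
    and "\<forall>\<^sub>F j in sequentially. integrable lborel (\<lambda>x. H (U j x) * F x * grad (U j) x $ i)"
proof -
  define h where "h = (\<lambda>x. indicator K x * w x $ i)"
  define D where "D = (\<lambda>j x. indicator K x * (grad (U j) x $ i - w x $ i))"
  note hm = L2_loc_component[OF w K, of i, folded h_def]
  have Km [measurable]: "K \<in> sets borel" using K by (simp add: borel_compact)
  have [measurable]: "h \<in> borel_measurable borel" "F \<in> borel_measurable borel" by (rule hm F)+
  have Hm [measurable]: "H \<in> borel_measurable borel" "g \<in> borel_measurable borel" "U j \<in> borel_measurable borel" for j
    by (intro borel_measurable_continuous_onI H U smooth_continuous)+
  have gm [measurable]: "(\<lambda>x. grad (U j) x $ i) \<in> borel_measurable borel" for j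
    unfolding grad_def by (simp add: borel_measurable_continuous_onI smooth_continuous smooth_frechet U)
  have "D j = (\<lambda>x. indicator K x * grad (U j) x $ i - h x)" for j
    by (simp add: D_def h_def fun_eq_iff algebra_simps)
  then have Dm [measurable]: "D j \<in> borel_measurable borel" for j by simp
  have Fh: "integrable lborel (\<lambda>x. F x * h x)" by (rule integrable_mult_l2) (use F hm in \<open>auto simp: h_def\<close>)
  have dom: "integrable lborel (\<lambda>x. B * \<bar>F x * h x\<bar>)" using Fh by simp
  have bnd: "norm (H t * F x * h x) \<le> B * \<bar>F x * h x\<bar>" for t x
    using mult_right_mono[OF H(2), of "\<bar>F x * h x\<bar>" t] by (simp add: abs_mult mult.assoc)
  have lim2: "(\<lambda>j. \<integral>x. H (U j x) * F x * h x \<partial>lborel) \<longlonglongrightarrow> (\<integral>x. H (g x) * F x * h x \<partial>lborel)"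
  proof (rule integral_dominated_convergence[OF _ _ dom])
    show "AE x in lborel. (\<lambda>j. H (U j x) * F x * h x) \<longlonglongrightarrow> H (g x) * F x * h x"
    proof (rule AE_I2)
      fix x show "(\<lambda>j. H (U j x) * F x * h x) \<longlonglongrightarrow> H (g x) * F x * h x"
      proof (cases "x \<in> K")
        case True
        have "isCont H (g x)" using H(1) by (simp add: continuous_on_eq_continuous_at)
        from isCont_tendsto_compose[OF this U(3)[OF True]] show ?thesis by (intro tendsto_intros)
      qed (use F(3) in simp)
    qed
  qed (use bnd in auto)
  have int2: "integrable lborel (\<lambda>x. H (U j x) * F x * h x)" for j
    by (rule Bochner_Integration.integrable_bound[OF dom]) (use bnd in \<open>auto intro: order_trans[OF _ abs_ge_self]\<close>)
  have D0: "(\<lambda>j. l2sq (D j)) \<longlonglongrightarrow> 0" using U(4) by (simp add: D_def)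
  note t = integral_mult_tendsto_0[OF F(1,2) Dm D0, of "\<lambda>j x. H (U j x)" B, OF _ H(2)]
  have "(\<lambda>j. (\<integral>x. H (U j x) * F x * D j x \<partial>lborel) + (\<integral>x. H (U j x) * F x * h x \<partial>lborel))
     \<longlonglongrightarrow> 0 + (\<integral>x. H (g x) * F x * h x \<partial>lborel)"
    by (intro tendsto_add lim2 t(1)) measurable
  moreover have eq: "H (U j x) * F x * D j x + H (U j x) * F x * h x = H (U j x) * F x * grad (U j) x $ i" for j x
    using F(3)[of x] by (cases "x \<in> K") (auto simp: D_def h_def algebra_simps)
  have ev: "\<forall>\<^sub>F j in sequentially. integrable lborel (\<lambda>x. H (U j x) * F x * D j x)"
    by (rule t(2)) measurable
  have "\<forall>\<^sub>F j in sequentially. (\<integral>x. H (U j x) * F x * D j x \<partial>lborel) + (\<integral>x. H (U j x) * F x * h x \<partial>lborel)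
      = (\<integral>x. H (U j x) * F x * grad (U j) x $ i \<partial>lborel)"
    using ev
  proof eventually_elim
    case (elim j)
    show ?case
      by (subst Bochner_Integration.integral_add[OF elim int2, symmetric]) (simp add: eq)
  qed
  ultimately have "(\<lambda>j. \<integral>x. H (U j x) * F x * grad (U j) x $ i \<partial>lborel) \<longlonglongrightarrow> 0 + (\<integral>x. H (g x) * F x * h x \<partial>lborel)"
    by (rule Lim_transform_eventually)
  moreover have hw: "H (g x) * F x * h x = H (g x) * F x * w x $ i" for x
    using F(3)[of x] by (cases "x \<in> K") (auto simp: h_def)
  ultimately show "(\<lambda>j. \<integral>x. H (U j x) * F x * grad (U j) x $ i \<partial>lborel) \<longlonglongrightarrow> (\<integral>x. H (g x) * F x * w x $ i \<partial>lborel)"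
    by (simp only: add_0)
  have "integrable lborel (\<lambda>x. H (g x) * F x * h x)"
    by (rule Bochner_Integration.integrable_bound[OF dom]) (use bnd in \<open>auto intro: order_trans[OF _ abs_ge_self]\<close>)
  then show "integrable lborel (\<lambda>x. H (g x) * F x * w x $ i)" by (simp only: hw)
  show "\<forall>\<^sub>F j in sequentially. integrable lborel (\<lambda>x. H (U j x) * F x * grad (U j) x $ i)"
    using ev
  proof eventually_elim
    case (elim j)
    from Bochner_Integration.integrable_add[OF elim int2[of j]] show ?case by (simp only: eq)
  qed
qed

text \<open>In the variable y = 1/t this is y/3 \<le> exp(y/3), cubed. The constant itself is
  immaterial; it provides the bounded factor that \<open>energy_limit\<close> demands.\<close>

lemma flat_3_bound: "\<bar>flat 3 t\<bar> \<le> 27"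
proof (cases "0 < t")
  case True
  define y where "y = 1 / t"
  have y: "0 < y" using True by (simp add: y_def)
  have "y / 3 \<le> exp (y / 3)" using exp_ge_add_one_self[of "y / 3"] by linarith
  then have "(y / 3) ^ 3 \<le> exp (y / 3) ^ 3" using y by (intro power_mono) auto
  also have "\<dots> = exp y" by (simp flip: exp_of_nat_mult)
  finally have "y ^ 3 * exp (- y) \<le> 27" by (simp add: exp_minus field_simps power_divide)
  moreover have "flat 3 t = y ^ 3 * exp (- y)" using True by (simp add: flat_def y_def power_divide)
  ultimately show ?thesis using flat_nonneg[of 3 t] by simp
qed (simp add: flat_def)

text \<open>The chain rule is classical for a smooth function of \<open>U j\<close>. Sending j to
  infinity with k fixed gives it for a smooth function of u, and sending k to infinity replaces the
  smooth function by the positive part of u - s.\<close>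

lemma max_weak_gradient:
  fixes V :: "(real^'n) set"
  assumes V: "open V" "continuous_on V u" "L2_loc V w" "weak_gradient_on V u w"
  shows "weak_gradient_on V (\<lambda>x. max (u x) s) (\<lambda>x. if s < u x then w x else 0)"
  unfolding weak_gradient_on_def
proof (intro allI impI)
  fix \<psi> :: "real^'n \<Rightarrow> real" and i
  assume "(\<forall>k. Ck_on k UNIV \<psi>) \<and> compact (closure {x. \<psi> x \<noteq> 0}) \<and> closure {x. \<psi> x \<noteq> 0} \<subseteq> V"
  then have t: "test_fun V \<psi>" by (simp add: test_fun_def smooth_def)
  obtain K where \<psi>: "smooth \<psi>" and K: "compact K" "K \<subseteq> V" and \<psi>0: "\<And>x. x \<notin> K \<Longrightarrow> \<psi> x = 0"
    and gv: "\<And>x. x \<notin> K \<Longrightarrow> grad \<psi> x = 0"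
    by (rule test_funD[OF t]) blast
  have g0: "grad \<psi> x $ i = 0" if "x \<notin> K" for x using gv[OF that] by simp
  obtain R where R: "K \<subseteq> ball 0 R" using compact_imp_bounded[OF K(1)] bounded_subset_ballD by blast
  obtain U g where U: "\<And>j::nat. smooth (U j)" "continuous_on UNIV g" "\<And>x. x \<in> K \<Longrightarrow> g x = u x"
    "\<And>x. x \<in> K \<Longrightarrow> (\<lambda>j. U j x) \<longlonglongrightarrow> g x" "\<And>j x. x \<in> K \<Longrightarrow> \<bar>U j x - g x\<bar> \<le> 1"
    "\<And>i. (\<lambda>j. l2sq (\<lambda>x. indicator K x * (grad (U j) x $ i - w x $ i))) \<longlonglongrightarrow> 0"
    using weak_gradient_approx[OF V K] by blast
  \<comment> \<open>Rescaling by k + 1 in both variables steepens the transition at s while keeping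
    the derivative between 0 and 1.\<close>
  define m where "m = (\<lambda>k t. ramp (real (Suc k) * (t - s)) / real (Suc k))"
  define H where "H = (\<lambda>k t. ramp' (real (Suc k) * (t - s)))"
  have m_der: "(m k has_real_derivative H k t) (at t)" for k t
  proof -
    have "((\<lambda>t. ramp (real (Suc k) * (t - s))) has_real_derivative ramp' (real (Suc k) * (t - s)) * (real (Suc k) * 1)) (at t)"
      by (rule DERIV_chain2[OF ramp_has_real_derivative]) (auto intro!: derivative_eq_intros simp del: of_nat_Suc)
    from DERIV_cdivide[OF this, of "real (Suc k)"] show ?thesis
      by (simp add: m_def H_def del: of_nat_Suc)
  qed
  have sl: "smooth (\<lambda>t. real (Suc k) * (t - s))" for k
    by (intro smooth_mult smooth_diff smooth_const smooth_linear bounded_linear_ident)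
  have mH: "smooth (m k)" "smooth (H k)" for k
    using smooth_mult[OF smooth_const[of "inverse (real (Suc k))"] smooth_compose[OF sl[of k] smooth_ramp(1)]]
      smooth_compose[OF sl[of k] smooth_ramp(2)]
    by (simp_all add: m_def H_def divide_inverse mult.commute del: of_nat_Suc)
  have Hb: "\<bar>H k t\<bar> \<le> 1" for k t using ramp'_bounds by (simp add: H_def)
  have mb: "\<bar>m k t\<bar> \<le> \<bar>t\<bar> + \<bar>s\<bar>" for k t
    using ramp_bound[of k "t - s"] unfolding m_def by linarith
  have meas [measurable]: "g \<in> borel_measurable borel" "\<psi> \<in> borel_measurable borel" "U j \<in> borel_measurable borel"
    "m k \<in> borel_measurable borel" "H k \<in> borel_measurable borel" for j k
    by (intro borel_measurable_continuous_onI U smooth_continuous \<psi> mH)+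
  have gc: "continuous_on UNIV (\<lambda>x. grad f x $ i)" if "smooth f" for f :: "real^'n \<Rightarrow> real" and i
    unfolding grad_def using that by (simp add: smooth_continuous smooth_frechet)
  have [measurable]: "(\<lambda>x. grad \<psi> x $ i) \<in> borel_measurable borel"
    by (rule borel_measurable_continuous_onI[OF gc[OF \<psi>]])
  have \<psi>2: "integrable lborel (\<lambda>x. (\<psi> x)\<^sup>2)"
    by (rule integrable_continuous_compact_support[OF continuous_on_power[OF smooth_continuous[OF \<psi>]] K(1)])
      (use \<psi>0 in auto)
  note el = energy_limit[OF V(3) K U(1,2,4,6) meas(2) \<psi>2 \<psi>0 smooth_continuous[OF mH(2)] Hb]
  \<comment> \<open>One majorant for both limits: the summand 1 absorbs the distance of
    \<open>U j\<close> from g, and \<open>\<bar>s\<bar>\<close> comes from the shift of the argument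
    by s.\<close>
  define dom where "dom = (\<lambda>x. (\<bar>g x\<bar> + 1 + \<bar>s\<bar>) * \<bar>grad \<psi> x $ i\<bar>)"
  have dom: "integrable lborel dom"
    unfolding dom_def by (rule integrable_continuous_compact_support[OF _ K(1)])
      (use g0 in \<open>auto intro!: continuous_intros gc \<psi> U(2)\<close>)
  have parts: "(\<integral>x. m k (g x) * grad \<psi> x $ i \<partial>lborel) = - (\<integral>x. H k (g x) * \<psi> x * w x $ i \<partial>lborel)" for k
  proof -
    have eq: "(\<integral>x. m k (U j x) * grad \<psi> x $ i \<partial>lborel) = - (\<integral>x. H k (U j x) * \<psi> x * grad (U j) x $ i \<partial>lborel)" for j
    proof -
      let ?f = "\<lambda>x. m k (U j x) * \<psi> x"
      have f: "smooth ?f" by (intro smooth_mult smooth_compose[OF U(1) mH(1)] \<psi>)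
      have "(m k has_derivative (\<lambda>v. H k (U j x) * v)) (at (U j x))" for x
        using m_der by (simp add: has_field_derivative_def)
      from has_derivative_compose[OF smooth_has_derivative[OF U(1)] this]
      have "((\<lambda>x. m k (U j x)) has_derivative (\<lambda>v. H k (U j x) * frechet_derivative (U j) (at x) v)) (at x)" for x .
      from frechet_derivative_eq[OF has_derivative_mult[OF this smooth_has_derivative[OF \<psi>]]]
      have df: "frechet_derivative ?f (at x) (axis i 1)
          = m k (U j x) * grad \<psi> x $ i + H k (U j x) * \<psi> x * grad (U j) x $ i" for x
        by (simp add: grad_def algebra_simps)
      have "(\<integral>x. frechet_derivative ?f (at x) (axis i 1) \<partial>lborel) = 0"
        by (rule integral_frechet_derivative_eq_0[OF f, of R]) (use \<psi>0 R in force)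
      moreover have "integrable lborel (\<lambda>x. m k (U j x) * grad \<psi> x $ i)"
        by (rule integrable_continuous_compact_support[OF continuous_on_mult[OF
              smooth_continuous[OF smooth_compose[OF U(1) mH(1)]] gc[OF \<psi>]] K(1)]) (simp add: g0)
      moreover have "integrable lborel (\<lambda>x. H k (U j x) * \<psi> x * grad (U j) x $ i)"
        by (rule integrable_continuous_compact_support[OF continuous_on_mult[OF continuous_on_mult[OF
              smooth_continuous[OF smooth_compose[OF U(1) mH(2)]] smooth_continuous[OF \<psi>]] gc[OF U(1)]] K(1)])
          (simp add: \<psi>0)
      ultimately show ?thesis by (simp add: df)
    qed
    have "(\<lambda>j. \<integral>x. m k (U j x) * grad \<psi> x $ i \<partial>lborel) \<longlonglongrightarrow> (\<integral>x. m k (g x) * grad \<psi> x $ i \<partial>lborel)"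
    proof (rule integral_dominated_convergence[OF _ _ dom])
      show "AE x in lborel. (\<lambda>j. m k (U j x) * grad \<psi> x $ i) \<longlonglongrightarrow> m k (g x) * grad \<psi> x $ i"
      proof (rule AE_I2)
        fix x show "(\<lambda>j. m k (U j x) * grad \<psi> x $ i) \<longlonglongrightarrow> m k (g x) * grad \<psi> x $ i"
        proof (cases "x \<in> K")
          case True
          show ?thesis
            by (intro tendsto_intros isCont_tendsto_compose[OF DERIV_isCont[OF m_der] U(4)[OF True]])
        qed (use g0 in simp)
      qed
      show "AE x in lborel. norm (m k (U j x) * grad \<psi> x $ i) \<le> dom x" for j
      proof (rule AE_I2)
        fix x show "norm (m k (U j x) * grad \<psi> x $ i) \<le> dom x"
        proof (cases "x \<in> K")
          case True
          have "\<bar>m k (U j x)\<bar> \<le> \<bar>g x\<bar> + 1 + \<bar>s\<bar>" using mb[of k "U j x"] U(5)[OF True, of j] by linarith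
          then show ?thesis by (simp add: dom_def abs_mult mult_right_mono)
        qed (use g0 in \<open>simp add: dom_def\<close>)
      qed
    qed measurable
    moreover have "(\<lambda>j. - (\<integral>x. H k (U j x) * \<psi> x * grad (U j) x $ i \<partial>lborel)) \<longlonglongrightarrow> - (\<integral>x. H k (g x) * \<psi> x * w x $ i \<partial>lborel)"
      by (intro tendsto_minus el)
    ultimately show ?thesis unfolding eq by (rule LIMSEQ_unique)
  qed
  \<comment> \<open>The case H = 1 of \<open>energy_limit\<close> gives the integrability of \<psi>
    w that dominated convergence in k requires.\<close>
  have wmeas: "(\<lambda>x. \<psi> x * w x $ i) \<in> borel_measurable borel" and wint: "integrable lborel (\<lambda>x. \<psi> x * w x $ i)"
    using energy_limit(2)[OF V(3) K U(1,2,4,6) meas(2) \<psi>2 \<psi>0 continuous_on_const[of _ 1], where B=1] by auto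
  have [measurable]: "(\<lambda>x. \<psi> x * w x $ i) \<in> borel_measurable borel" by (rule wmeas)
  have A: "(\<lambda>k. \<integral>x. m k (g x) * grad \<psi> x $ i \<partial>lborel) \<longlonglongrightarrow> (\<integral>x. max (g x - s) 0 * grad \<psi> x $ i \<partial>lborel)"
  proof (rule integral_dominated_convergence[OF _ _ dom])
    show "AE x in lborel. (\<lambda>k. m k (g x) * grad \<psi> x $ i) \<longlonglongrightarrow> max (g x - s) 0 * grad \<psi> x $ i"
      unfolding m_def by (intro AE_I2 tendsto_intros ramp_tendsto)
    show "AE x in lborel. norm (m k (g x) * grad \<psi> x $ i) \<le> dom x" for k
    proof (rule AE_I2)
      fix x
      have "\<bar>m k (g x)\<bar> \<le> \<bar>g x\<bar> + 1 + \<bar>s\<bar>" using mb[of k "g x"] by linarith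
      then show "norm (m k (g x) * grad \<psi> x $ i) \<le> dom x" by (simp add: dom_def abs_mult mult_right_mono)
    qed
  qed measurable
  have B: "(\<lambda>k. \<integral>x. H k (g x) * (\<psi> x * w x $ i) \<partial>lborel) \<longlonglongrightarrow> (\<integral>x. (if 0 < g x - s then 1 else 0) * (\<psi> x * w x $ i) \<partial>lborel)"
  proof (rule integral_dominated_convergence[where w="\<lambda>x. \<bar>\<psi> x * w x $ i\<bar>"])
    show "AE x in lborel. (\<lambda>k. H k (g x) * (\<psi> x * w x $ i)) \<longlonglongrightarrow> (if 0 < g x - s then 1 else 0) * (\<psi> x * w x $ i)"
      unfolding H_def by (intro AE_I2 tendsto_intros ramp'_tendsto)
    show "AE x in lborel. norm (H k (g x) * (\<psi> x * w x $ i)) \<le> \<bar>\<psi> x * w x $ i\<bar>" for k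
      unfolding real_norm_def abs_mult[of "H k _"] by (intro AE_I2 mult_left_le_one_le Hb) auto
  qed (use wint in auto)
  have "(\<lambda>k. \<integral>x. m k (g x) * grad \<psi> x $ i \<partial>lborel) \<longlonglongrightarrow> - (\<integral>x. (if 0 < g x - s then 1 else 0) * (\<psi> x * w x $ i) \<partial>lborel)"
    using tendsto_minus[OF B] by (simp add: parts mult.assoc)
  from LIMSEQ_unique[OF A this]
  have main: "(\<integral>x. max (g x - s) 0 * grad \<psi> x $ i \<partial>lborel) = - (\<integral>x. (if 0 < g x - s then 1 else 0) * (\<psi> x * w x $ i) \<partial>lborel)" .
  have i1: "integrable lborel (\<lambda>x. max (g x - s) 0 * grad \<psi> x $ i)" "integrable lborel (\<lambda>x. s * grad \<psi> x $ i)"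
    by (rule integrable_continuous_compact_support[OF _ K(1)];
        use g0 in \<open>auto intro!: continuous_intros gc \<psi> U(2)\<close>)+
  \<comment> \<open>Since max u s is the positive part of u - s plus the constant s, the constant
    must contribute nothing.\<close>
  have z: "(\<integral>x. grad \<psi> x $ i \<partial>lborel) = 0"
    unfolding grad_def using integral_frechet_derivative_eq_0[OF \<psi>, of R] \<psi>0 R by (simp add: subset_iff) force
  have "(\<integral>x. max (u x) s * grad \<psi> x $ i \<partial>lborel) = (\<integral>x. max (g x - s) 0 * grad \<psi> x $ i + s * grad \<psi> x $ i \<partial>lborel)"
  proof (rule Bochner_Integration.integral_cong[OF refl])
    fix x show "max (u x) s * grad \<psi> x $ i = max (g x - s) 0 * grad \<psi> x $ i + s * grad \<psi> x $ i"
      using U(3)[of x] g0[of x] by (cases "x \<in> K") (auto simp: max_def algebra_simps)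
  qed
  also have "\<dots> = (\<integral>x. max (g x - s) 0 * grad \<psi> x $ i \<partial>lborel)" using i1 z by simp
  also have "\<dots> = - (\<integral>x. (if s < u x then w x else 0) $ i * \<psi> x \<partial>lborel)"
    unfolding main
  proof (intro arg_cong[of _ _ uminus] Bochner_Integration.integral_cong[OF refl])
    fix x show "(if 0 < g x - s then 1 else 0) * (\<psi> x * w x $ i) = (if s < u x then w x else 0) $ i * \<psi> x"
      using U(3)[of x] \<psi>0[of x] by (cases "x \<in> K") auto
  qed
  finally show "(\<integral>x. max (u x) s * frechet_derivative \<psi> (at x) (axis i 1) \<partial>lborel)
      = - (\<integral>x. (if s < u x then w x else 0) $ i * \<psi> x \<partial>lborel)"
    by (simp add: grad_def)
qed

lemma dot_matrix_vector: "a \<bullet> (M *v b) = (\<Sum>j\<in>UNIV. (\<Sum>i\<in>UNIV. a $ i * M $ i $ j) * b $ j)"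
  for a b :: "real^'n"
  by (simp add: inner_vec_def matrix_vector_mult_def sum_distrib_left sum_distrib_right mult.assoc)
    (rule sum.swap)

lemma integrable_flux:
  fixes V :: "(real^'n) set" and M :: "real^'n \<Rightarrow> real^'n^'n"
  assumes w: "open V" "L2_loc V w" and M: "continuous_on V M" and \<phi>: "test_fun V \<phi>"
  shows "integrable lborel (\<lambda>x. w x \<bullet> (M x *v grad \<phi> x))"
proof -
  obtain K where \<phi>s: "smooth \<phi>" and K: "compact K" "K \<subseteq> V" and \<phi>0: "\<And>x. x \<notin> K \<Longrightarrow> \<phi> x = 0"
    and g0: "\<And>x. x \<notin> K \<Longrightarrow> grad \<phi> x = 0"
    by (rule test_funD[OF \<phi>]) blast
  have gcv: "continuous_on UNIV (grad \<phi>)"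
    unfolding grad_def using \<phi>s by (intro continuous_on_vec_lambda) (simp add: smooth_continuous smooth_frechet)
  \<comment> \<open>M is continuous only on V, but combined with the gradient of \<phi> it is
    supported in K and extends by 0 to a continuous function on the whole space.\<close>
  define q where "q = (\<lambda>i x. (M x *v grad \<phi> x) $ i)"
  have q0: "q i x = 0" if "x \<notin> K" for i x using g0[OF that] by (simp add: q_def)
  have "continuous_on V (q i)" for i
    unfolding q_def matrix_vector_mult_def
    by (auto intro!: continuous_intros M continuous_on_subset[OF gcv])
  then have qc: "continuous_on UNIV (q i)" for i
    by (rule continuous_on_extend_0[OF _ w(1) K q0])
  have [measurable]: "q i \<in> borel_measurable borel" for i
    by (rule borel_measurable_continuous_onI[OF qc])
  have q2: "integrable lborel (\<lambda>x. (q i x)\<^sup>2)" for i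
    by (rule integrable_continuous_compact_support[OF continuous_on_power[OF qc] K(1)]) (simp add: q0)
  have "w x \<bullet> (M x *v grad \<phi> x) = (\<Sum>i\<in>UNIV. (indicator K x * w x $ i) * q i x)" for x
    using q0[of x] by (cases "x \<in> K") (auto simp: inner_vec_def q_def)
  moreover have "integrable lborel (\<lambda>x. \<Sum>i\<in>UNIV. (indicator K x * w x $ i) * q i x)"
    by (intro Bochner_Integration.integrable_sum integrable_mult_l2 L2_loc_component[OF w(2) K] q2) measurable
  ultimately show ?thesis by (simp only:)
qed

text \<open>Before the limit the energy term pairs w with \<open>grad (U j)\<close> and has no sign;
  it becomes the quadratic form of M at w only after j has gone to infinity. The limit in j is
  therefore taken at fixed k, for which \<open>H' k\<close> is bounded, and the term is discarded
  before k moves, since that bound grows with k.\<close>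

lemma max_subsolution:
  fixes V :: "(real^'n) set" and M :: "real^'n \<Rightarrow> real^'n^'n"
  assumes V: "open V" "continuous_on V u" "L2_loc V w" "weak_gradient_on V u w"
    and M: "continuous_on V M" "\<And>x v. x \<in> V \<Longrightarrow> 0 \<le> v \<bullet> (M x *v v)"
    and sub: "\<And>\<psi>. test_fun V \<psi> \<Longrightarrow> (\<And>x. 0 \<le> \<psi> x) \<Longrightarrow> (\<integral>x. w x \<bullet> (M x *v grad \<psi> x) \<partial>lborel) \<le> 0"
    and \<phi>: "test_fun V \<phi>" "\<And>x. 0 \<le> \<phi> x"
  shows "integrable lborel (\<lambda>x. if s < u x then w x \<bullet> (M x *v grad \<phi> x) else 0)"
    and "(\<integral>x. (if s < u x then w x \<bullet> (M x *v grad \<phi> x) else 0) \<partial>lborel) \<le> 0"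
proof -
  obtain K where \<phi>s: "smooth \<phi>" and K: "compact K" "K \<subseteq> V" and \<phi>0: "\<And>x. x \<notin> K \<Longrightarrow> \<phi> x = 0"
    and g0: "\<And>x. x \<notin> K \<Longrightarrow> grad \<phi> x = 0"
    by (rule test_funD[OF \<phi>(1)]) blast
  obtain U g where U: "\<And>j::nat. smooth (U j)" "continuous_on UNIV g" "\<And>x. x \<in> K \<Longrightarrow> g x = u x"
    "\<And>x. x \<in> K \<Longrightarrow> (\<lambda>j. U j x) \<longlonglongrightarrow> g x" "\<And>j x. x \<in> K \<Longrightarrow> \<bar>U j x - g x\<bar> \<le> 1"
    "\<And>i. (\<lambda>j. l2sq (\<lambda>x. indicator K x * (grad (U j) x $ i - w x $ i))) \<longlonglongrightarrow> 0"
    using weak_gradient_approx[OF V K] by blast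
  define H where "H = (\<lambda>k t. ramp' (real (Suc k) * (t - s)))"
  define H' where "H' = (\<lambda>k t. real (Suc k) * flat 3 (real (Suc k) * (t - s)))"
  have H_der: "(H k has_real_derivative H' k t) (at t)" for k t
  proof -
    have "((\<lambda>t. ramp' (real (Suc k) * (t - s))) has_real_derivative flat 3 (real (Suc k) * (t - s)) * (real (Suc k) * 1)) (at t)"
      by (rule DERIV_chain2[OF ramp'_has_real_derivative]) (auto intro!: derivative_eq_intros simp del: of_nat_Suc)
    then show ?thesis by (simp add: H_def H'_def mult.commute del: of_nat_Suc)
  qed
  have sl: "smooth (\<lambda>t. real (Suc k) * (t - s))" for k
    by (intro smooth_mult smooth_diff smooth_const smooth_linear bounded_linear_ident)
  have Hs: "smooth (H k)" "smooth (H' k)" for k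
    unfolding H_def H'_def
    by (intro smooth_compose[OF sl smooth_ramp(2)] smooth_mult smooth_const smooth_compose[OF sl smooth_flat])+
  have H'n: "0 \<le> H' k t" for k t by (simp add: H'_def flat_nonneg)
  have Hb: "\<bar>H k t\<bar> \<le> 1" for k t using ramp'_bounds by (simp add: H_def)
  have H'b: "\<bar>H' k t\<bar> \<le> real (Suc k) * 27" for k t
    unfolding H'_def abs_mult using flat_3_bound by (intro mult_mono) auto
  have meas [measurable]: "g \<in> borel_measurable borel" "\<phi> \<in> borel_measurable borel" "U j \<in> borel_measurable borel"
    "H k \<in> borel_measurable borel" "H' k \<in> borel_measurable borel" for j k
    by (intro borel_measurable_continuous_onI U smooth_continuous \<phi>s Hs)+
  have gc: "continuous_on UNIV (\<lambda>x. grad f x $ i)" if "smooth f" for f :: "real^'n \<Rightarrow> real" and i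
    unfolding grad_def using that by (simp add: smooth_continuous smooth_frechet)
  have gcv: "continuous_on UNIV (grad f)" if "smooth f" for f :: "real^'n \<Rightarrow> real"
    unfolding grad_def using that by (intro continuous_on_vec_lambda) (simp add: smooth_continuous smooth_frechet)
  have Mc: "continuous_on V (\<lambda>x. M x $ i $ j)" for i j
    using M(1) by (intro continuous_intros)

  define W where "W = (\<lambda>i x. indicator K x * w x $ i)"
  have Wm [measurable]: "W i \<in> borel_measurable borel" and W2: "integrable lborel (\<lambda>x. (W i x)\<^sup>2)" for i
    unfolding W_def by (rule L2_loc_component[OF V(3) K])+
  define a where "a = (\<lambda>x. w x \<bullet> (M x *v grad \<phi> x))"
  have a_eq: "w x \<bullet> (M x *v grad \<phi> x) = a x" for x by (simp add: a_def)
  have a0: "a x = 0" if "x \<notin> K" for x using g0[OF that] by (simp add: a_def)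
  have a_int: "integrable lborel a"
    unfolding a_def by (rule integrable_flux[OF V(1,3) M(1) \<phi>(1)])
  then have a_meas [measurable]: "a \<in> borel_measurable borel" by simp

  define b where "b = (\<lambda>i j x. M x $ i $ j * \<phi> x)"
  have b0: "b i j x = 0" if "x \<notin> K" for i j x using \<phi>0[OF that] by (simp add: b_def)
  have "continuous_on V (b i j)" for i j
    unfolding b_def by (intro continuous_intros Mc smooth_continuous \<phi>s)
  then have bc: "continuous_on UNIV (b i j)" for i j
    by (rule continuous_on_extend_0[OF _ V(1) K b0])
  have [measurable]: "b i j \<in> borel_measurable borel" for i j
    by (rule borel_measurable_continuous_onI[OF bc])
  \<comment> \<open>The components of \<phi> times the row vector w M: an L2 field vanishing off K
    that is independent of j and k, as the fixed factor of \<open>energy_limit\<close> has to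
    be.\<close>
  define F where "F = (\<lambda>j x. \<Sum>i\<in>UNIV. b i j x * W i x)"
  have [measurable]: "F j \<in> borel_measurable borel" for j unfolding F_def by measurable
  have F0: "F j x = 0" if "x \<notin> K" for j x using b0[OF that] by (simp add: F_def)
  have bW2: "integrable lborel (\<lambda>x. (b i j x * W i x)\<^sup>2)" for i j
  proof -
    obtain B where "\<And>x. \<bar>b i j x\<bar> \<le> B"
      using continuous_compact_support_bounded[OF bc K(1) b0] by blast
    then show ?thesis by (intro integrable_sq_mult_bounded[OF _ _ _ W2]) measurable
  qed
  have F2: "integrable lborel (\<lambda>x. (F j x)\<^sup>2)" for j
  proof -
    have "integrable lborel (\<lambda>x. \<Sum>i\<in>UNIV. \<Sum>l\<in>UNIV. (b i j x * W i x) * (b l j x * W l x))"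
      by (intro Bochner_Integration.integrable_sum integrable_mult_l2 bW2) measurable
    then show ?thesis by (simp add: F_def power2_eq_square sum_product)
  qed
  note el = energy_limit[OF V(3) K U(1,2,4,6) _ F2 F0 smooth_continuous[OF Hs(2)] H'b]

  have ineq: "(\<integral>x. H k (g x) * a x \<partial>lborel) \<le> 0" for k
  proof -
    let ?P = "\<lambda>j. (\<integral>x. H k (U j x) * a x \<partial>lborel)"
    let ?Q = "\<lambda>j. \<Sum>i\<in>UNIV. (\<integral>x. H' k (U j x) * F i x * grad (U j) x $ i \<partial>lborel)"
    have intP: "integrable lborel (\<lambda>x. H k (U j x) * a x)" for j
    proof (rule Bochner_Integration.integrable_bound[OF a_int])
      show "AE x in lborel. norm (H k (U j x) * a x) \<le> norm (a x)"
        unfolding real_norm_def abs_mult by (intro AE_I2 mult_left_le_one_le Hb) auto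
    qed measurable
    have "\<forall>\<^sub>F j in sequentially. \<forall>i\<in>UNIV. integrable lborel (\<lambda>x. H' k (U j x) * F i x * grad (U j) x $ i)"
      by (intro eventually_ball_finite ballI el(3)) auto
    then have "\<forall>\<^sub>F j in sequentially. ?P j + ?Q j \<le> 0"
    proof eventually_elim
      case (elim j)
      let ?\<psi> = "\<lambda>x. \<phi> x * H k (U j x)"
      have HU: "smooth (\<lambda>x. H k (U j x))" by (rule smooth_compose[OF U(1) Hs(1)])
      have "test_fun V ?\<psi>"
        by (rule test_funI[OF smooth_mult[OF \<phi>s HU] K]) (simp add: \<phi>0)
      then have "(\<integral>x. w x \<bullet> (M x *v grad ?\<psi> x) \<partial>lborel) \<le> 0"
        by (rule sub) (use \<phi>(2) ramp'_bounds(1) in \<open>simp add: H_def\<close>)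
      moreover have "w x \<bullet> (M x *v grad ?\<psi> x) = H k (U j x) * a x + (\<Sum>i\<in>UNIV. H' k (U j x) * F i x * grad (U j) x $ i)" for x
      proof -
        have "(H k has_derivative (\<lambda>v. H' k (U j x) * v)) (at (U j x))"
          using H_der by (simp add: has_field_derivative_def)
        from has_derivative_compose[OF smooth_has_derivative[OF U(1)] this]
        have "((\<lambda>x. H k (U j x)) has_derivative (\<lambda>v. H' k (U j x) * frechet_derivative (U j) (at x) v)) (at x)" .
        from has_derivative_mult[OF smooth_has_derivative[OF \<phi>s] this]
        have "grad ?\<psi> x = H k (U j x) *\<^sub>R grad \<phi> x + (\<phi> x * H' k (U j x)) *\<^sub>R grad (U j) x"
          by (simp add: frechet_derivative_eq grad_def vec_eq_iff algebra_simps)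
        then have "w x \<bullet> (M x *v grad ?\<psi> x) = H k (U j x) * (w x \<bullet> (M x *v grad \<phi> x))
            + (\<phi> x * H' k (U j x)) * (w x \<bullet> (M x *v grad (U j) x))"
          by (simp add: matrix_vector_right_distrib matrix_vector_mult_scaleR inner_add_right)
        moreover have "\<phi> x * (w x \<bullet> (M x *v v)) = (\<Sum>i\<in>UNIV. F i x * v $ i)" for v
        proof (cases "x \<in> K")
          case True
          have "F i x = \<phi> x * (\<Sum>l\<in>UNIV. w x $ l * M x $ l $ i)" for i
            using True by (simp add: F_def b_def W_def sum_distrib_left mult.commute mult.left_commute)
          then show ?thesis
            by (simp add: dot_matrix_vector sum_distrib_left sum_distrib_right mult.assoc)
        qed (simp add: F0 \<phi>0)
        then have "(\<phi> x * H' k (U j x)) * (w x \<bullet> (M x *v grad (U j) x)) = H' k (U j x) * (\<Sum>i\<in>UNIV. F i x * grad (U j) x $ i)"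
          by (simp add: mult.commute mult.left_commute)
        ultimately show ?thesis by (simp add: a_eq sum_distrib_left mult.assoc)
      qed
      ultimately show ?case
        using elim intP by (simp add: Bochner_Integration.integral_add Bochner_Integration.integral_sum)
    qed
    moreover have "(\<lambda>j. ?P j + ?Q j) \<longlonglongrightarrow> (\<integral>x. H k (g x) * a x \<partial>lborel)
        + (\<Sum>i\<in>UNIV. \<integral>x. H' k (g x) * F i x * w x $ i \<partial>lborel)"
    proof (intro tendsto_add tendsto_sum el(1))
      show "?P \<longlonglongrightarrow> (\<integral>x. H k (g x) * a x \<partial>lborel)"
      proof (rule integral_dominated_convergence[where w="\<lambda>x. \<bar>a x\<bar>"])
        show "AE x in lborel. (\<lambda>j. H k (U j x) * a x) \<longlonglongrightarrow> H k (g x) * a x"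
        proof (rule AE_I2)
          fix x show "(\<lambda>j. H k (U j x) * a x) \<longlonglongrightarrow> H k (g x) * a x"
          proof (cases "x \<in> K")
            case True
            show ?thesis
              by (intro tendsto_intros isCont_tendsto_compose[OF DERIV_isCont[OF H_der] U(4)[OF True]])
          qed (simp add: a0)
        qed
        show "AE x in lborel. norm (H k (U j x) * a x) \<le> \<bar>a x\<bar>" for j
          unfolding real_norm_def abs_mult by (intro AE_I2 mult_left_le_one_le Hb) auto
      qed (use a_int in auto)
    qed measurable
    ultimately have "(\<integral>x. H k (g x) * a x \<partial>lborel) + (\<Sum>i\<in>UNIV. \<integral>x. H' k (g x) * F i x * w x $ i \<partial>lborel) \<le> 0"
      by (intro tendsto_upperbound[where F=sequentially]) auto
    moreover have "0 \<le> (\<Sum>i\<in>UNIV. \<integral>x. H' k (g x) * F i x * w x $ i \<partial>lborel)"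
    proof -
      have "(\<Sum>i\<in>UNIV. \<integral>x. H' k (g x) * F i x * w x $ i \<partial>lborel)
          = (\<integral>x. (\<Sum>i\<in>UNIV. H' k (g x) * F i x * w x $ i) \<partial>lborel)"
        by (rule Bochner_Integration.integral_sum[symmetric]) (rule el(2), measurable)
      also have "0 \<le> \<dots>"
      proof (rule integral_nonneg_AE, rule AE_I2)
        fix x
        show "0 \<le> (\<Sum>i\<in>UNIV. H' k (g x) * F i x * w x $ i)"
        proof (cases "x \<in> K")
          case True
          have "F i x = \<phi> x * (\<Sum>l\<in>UNIV. w x $ l * M x $ l $ i)" for i
            using True by (simp add: F_def b_def W_def sum_distrib_left mult.commute mult.left_commute)
          then have "(\<Sum>i\<in>UNIV. H' k (g x) * F i x * w x $ i) = H' k (g x) * \<phi> x * (w x \<bullet> (M x *v w x))"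
            by (simp add: dot_matrix_vector sum_distrib_left sum_distrib_right mult.assoc)
          then show ?thesis using M(2)[of x "w x"] True K(2) H'n \<phi>(2) by auto
        qed (simp add: F0)
      qed
      finally show ?thesis .
    qed
    ultimately show ?thesis by linarith
  qed
  have lim: "(\<lambda>k. \<integral>x. H k (g x) * a x \<partial>lborel) \<longlonglongrightarrow> (\<integral>x. (if 0 < g x - s then 1 else 0) * a x \<partial>lborel)"
  proof (rule integral_dominated_convergence[where w="\<lambda>x. \<bar>a x\<bar>"])
    show "AE x in lborel. (\<lambda>k. H k (g x) * a x) \<longlonglongrightarrow> (if 0 < g x - s then 1 else 0) * a x"
      unfolding H_def by (intro AE_I2 tendsto_intros ramp'_tendsto)
    show "AE x in lborel. norm (H k (g x) * a x) \<le> \<bar>a x\<bar>" for k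
      unfolding real_norm_def abs_mult[of "H k _"] by (intro AE_I2 mult_left_le_one_le Hb) auto
  qed (use a_int in auto)
  have eq: "(if 0 < g x - s then 1 else 0) * a x = (if s < u x then w x \<bullet> (M x *v grad \<phi> x) else 0)" for x
    using U(3)[of x] by (cases "x \<in> K") (auto simp: a_eq a0)
  have "(\<integral>x. (if 0 < g x - s then 1 else 0) * a x \<partial>lborel) \<le> 0"
    by (rule LIMSEQ_le_const2[OF lim]) (use ineq in auto)
  then show "(\<integral>x. (if s < u x then w x \<bullet> (M x *v grad \<phi> x) else 0) \<partial>lborel) \<le> 0" by (simp only: eq)
  have "integrable lborel (\<lambda>x. (if 0 < g x - s then 1 else 0) * a x)"
    by (rule Bochner_Integration.integrable_bound[OF a_int]) auto
  then show "integrable lborel (\<lambda>x. if s < u x then w x \<bullet> (M x *v grad \<phi> x) else 0)" by (simp only: eq)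
qed

section \<open>Change of variables without an order on the index type\<close>

text \<open>The library states the change of variables formula only for well-ordered index types; \<open>'n wo\<close> is a
  copy of \<open>'n\<close> carrying an arbitrary well-order.\<close>

typedef 'n wo = "UNIV :: 'n set" by auto

lemma range_Rep_wo: "range Rep_wo = UNIV"
  by (metis Rep_wo_cases UNIV_I surj_def)

lemma inj_Rep_wo: "inj Rep_wo"
  by (simp add: inj_on_def Rep_wo_inject)

lemma bij_Rep_wo: "bij Rep_wo"
  by (simp add: bij_def inj_Rep_wo range_Rep_wo)

instance wo :: (finite) finite
proof
  have "finite (range (Rep_wo :: 'a wo \<Rightarrow> 'a))" by simp
  then show "finite (UNIV :: 'a wo set)" using inj_Rep_wo by (rule finite_imageD)
qed

definition wo_index :: "'n::finite wo \<Rightarrow> nat" where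
  "wo_index = (SOME f. inj f)"

lemma inj_wo_index: "inj (wo_index :: 'n::finite wo \<Rightarrow> nat)"
proof -
  have "\<exists>f :: 'n wo \<Rightarrow> nat. inj f"
    using finite_imp_inj_to_nat_seg[of "UNIV :: 'n wo set"] by auto
  then show ?thesis unfolding wo_index_def by (rule someI_ex)
qed

instantiation wo :: (finite) wellorder
begin

definition less_eq_wo :: "'a wo \<Rightarrow> 'a wo \<Rightarrow> bool" where
  "less_eq_wo x y \<longleftrightarrow> wo_index x \<le> wo_index y"

definition less_wo :: "'a wo \<Rightarrow> 'a wo \<Rightarrow> bool" where
  "less_wo x y \<longleftrightarrow> wo_index x < wo_index y"

instance
proof
  fix x y z :: "'a wo" and P :: "'a wo \<Rightarrow> bool"
  show "x \<le> y \<Longrightarrow> y \<le> x \<Longrightarrow> x = y"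
    using inj_wo_index by (auto simp: less_eq_wo_def dest: injD)
  assume *: "\<And>x. (\<And>y. y < x \<Longrightarrow> P y) \<Longrightarrow> P x"
  show "P z"
    by (induction "wo_index z" arbitrary: z rule: less_induct) (auto intro: * simp: less_wo_def)
qed (auto simp: less_eq_wo_def less_wo_def)

end

definition relabel :: "('k \<Rightarrow> 'n) \<Rightarrow> real^'n \<Rightarrow> real^'k" where
  "relabel e x = (\<chi> k. x $ e k)"

lemma relabel_nth [simp]: "relabel e x $ k = x $ e k"
  by (simp add: relabel_def)

lemma relabel_inv: "bij e \<Longrightarrow> relabel (inv e) (relabel e x) = x" "bij e \<Longrightarrow> relabel e (relabel (inv e) y) = y"
  by (simp_all add: vec_eq_iff bij_is_surj surj_f_inv_f bij_is_inj)

lemma bounded_linear_relabel: "bounded_linear (relabel e)"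
  for e :: "'k::finite \<Rightarrow> 'n::finite"
  by (intro linear_conv_bounded_linear[THEN iffD1] linearI) (simp_all add: vec_eq_iff)

lemma relabel_measurable [measurable]: "relabel e \<in> borel_measurable borel"
  for e :: "'k::finite \<Rightarrow> 'n::finite"
  by (intro borel_measurable_continuous_onI linear_continuous_on bounded_linear_relabel)

lemma prod_Basis_vec: "(\<Prod>b\<in>Basis. x \<bullet> b) = (\<Prod>i\<in>UNIV. x $ i)" for x :: "real^'n"
  by (simp add: Basis_vec_def UNION_singleton_eq_range prod.reindex inj_on_def axis_eq_axis inner_axis)

text \<open>Renaming coordinates carries boxes to boxes with the same product of side
  lengths.\<close>

lemma distr_relabel:
  fixes e :: "'k::finite \<Rightarrow> 'n::finite"
  assumes "bij e"
  shows "distr lborel borel (relabel e) = lborel"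
proof (rule lborel_eqI[symmetric])
  fix l u :: "real^'k" assume le: "\<And>b. b \<in> Basis \<Longrightarrow> l \<bullet> b \<le> u \<bullet> b"
  then have le': "l $ i \<le> u $ i" for i
    by (metis axis_in_Basis_iff cart_eq_inner_axis insertI1 Basis_real_def)
  let ?l = "relabel (inv e) l" and ?u = "relabel (inv e) u"
  have "relabel e -` box l u = box ?l ?u"
  proof (rule set_eqI)
    fix x
    have "(\<forall>i. l $ i < x $ e i \<and> x $ e i < u $ i) \<longleftrightarrow> (\<forall>n. l $ inv e n < x $ n \<and> x $ n < u $ inv e n)"
      using assms by (metis bij_inv_eq_iff)
    then show "x \<in> relabel e -` box l u \<longleftrightarrow> x \<in> box ?l ?u" by (simp add: mem_box_cart)
  qed
  then have "emeasure (distr lborel borel (relabel e)) (box l u) = emeasure lborel (box ?l ?u)"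
    by (simp add: emeasure_distr)
  also have "\<dots> = ennreal (\<Prod>b\<in>Basis. (?u - ?l) \<bullet> b)"
    by (rule emeasure_lborel_box) (auto simp: Basis_vec_def inner_axis le')
  also have "(\<Prod>b\<in>Basis. (?u - ?l) \<bullet> b) = (\<Prod>n\<in>UNIV. (u - l) $ inv e n)"
    unfolding prod_Basis_vec by simp
  also have "\<dots> = (\<Prod>i\<in>UNIV. (u - l) $ i)"
    using bij_imp_bij_inv[OF assms] by (rule prod.reindex_bij_betw)
  also have "\<dots> = (\<Prod>b\<in>Basis. (u - l) \<bullet> b)" unfolding prod_Basis_vec by simp
  finally show "emeasure (distr lborel borel (relabel e)) (box l u) = (\<Prod>b\<in>Basis. (u - l) \<bullet> b)" .
qed simp

lemma nn_integral_relabel: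
  fixes e :: "'k::finite \<Rightarrow> 'n::finite"
  assumes "bij e" "f \<in> borel_measurable borel"
  shows "(\<integral>\<^sup>+x. f (relabel e x) \<partial>lborel) = (\<integral>\<^sup>+y. f y \<partial>lborel)"
proof -
  have "integral\<^sup>N (distr lborel borel (relabel e)) f = (\<integral>\<^sup>+x. f (relabel e x) \<partial>lborel)"
    by (rule nn_integral_distr) (use assms(2) in auto)
  then show ?thesis by (simp add: distr_relabel[OF assms(1)])
qed

text \<open>The Leibniz sum is reindexed by conjugation with e, which preserves the sign of a
  permutation; e may connect two different index types.\<close>

lemma det_relabel:
  fixes e :: "'k::finite \<Rightarrow> 'n::finite" and M :: "real^'n^'n"
  assumes e: "bij e"
  shows "det (\<chi> i j. M $ e i $ e j) = det M"
proof -
  have ie: "inv e (e k) = k" "e (inv e n) = n" for k n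
    using e by (simp_all add: bij_is_inj bij_is_surj surj_f_inv_f)
  have perm: "p permutes UNIV \<longleftrightarrow> bij p" for p :: "'z \<Rightarrow> 'z"
    by (simp add: permutes_def bij_iff)
  have mp: "map_permutation UNIV e p = e \<circ> p \<circ> inv e" for p
    using e by (simp add: map_permutation_def restrict_id_def fun_eq_iff bij_is_surj)
  have "det (\<chi> i j. M $ e i $ e j) = (\<Sum>p\<in>{p. p permutes UNIV}. of_int (sign p) * (\<Prod>i\<in>UNIV. M $ e i $ e (p i)))"
    by (simp add: det_def)
  also have "\<dots> = (\<Sum>q\<in>{q. q permutes UNIV}. of_int (sign q) * (\<Prod>i\<in>UNIV. M $ i $ q i))"
  proof (rule sum.reindex_bij_witness[where i="\<lambda>q. inv e \<circ> q \<circ> e" and j="\<lambda>p. e \<circ> p \<circ> inv e"])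
    fix p :: "'k \<Rightarrow> 'k" assume p: "p \<in> {p. p permutes UNIV}"
    have "sign (e \<circ> p \<circ> inv e) = sign p"
      using sign_map_permutation[of e UNIV p] p e by (simp add: mp bij_is_inj)
    moreover have "(\<Prod>i\<in>UNIV. M $ i $ (e \<circ> p \<circ> inv e) i) = (\<Prod>i\<in>UNIV. M $ e i $ e (p i))"
      by (subst prod.reindex_bij_betw[OF e, symmetric]) (simp add: ie)
    ultimately show "of_int (sign (e \<circ> p \<circ> inv e)) * (\<Prod>i\<in>UNIV. M $ i $ (e \<circ> p \<circ> inv e) i)
        = of_int (sign p) * (\<Prod>i\<in>UNIV. M $ e i $ e (p i))" by simp
    show "e \<circ> p \<circ> inv e \<in> {q. q permutes UNIV}"
      using p e by (auto simp: perm intro!: bij_comp bij_imp_bij_inv)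
    show "inv e \<circ> (e \<circ> p \<circ> inv e) \<circ> e = p" by (simp add: fun_eq_iff ie)
  next
    fix q :: "'n \<Rightarrow> 'n" assume "q \<in> {q. q permutes UNIV}"
    then show "inv e \<circ> q \<circ> e \<in> {p. p permutes UNIV}"
      using e by (auto simp: perm intro!: bij_comp bij_imp_bij_inv)
    show "e \<circ> (inv e \<circ> q \<circ> e) \<circ> inv e = q" by (simp add: fun_eq_iff ie)
  qed
  also have "\<dots> = det M" by (simp add: det_def)
  finally show ?thesis .
qed

text \<open>The last hypothesis has the shape in which the change of variables theorem is available.
  For nonnegative functions it also settles the case of infinite integrals, as both sides are then
  non-integrable.\<close>

lemma nn_integral_eqI:
  fixes F :: "'a \<Rightarrow> real" and G :: "'b \<Rightarrow> real"
  assumes "F \<in> borel_measurable M" "G \<in> borel_measurable N" "\<And>x. 0 \<le> F x" "\<And>x. 0 \<le> G x"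
    and "\<And>b. integrable M F \<and> integral\<^sup>L M F = b \<longleftrightarrow> integrable N G \<and> integral\<^sup>L N G = b"
  shows "(\<integral>\<^sup>+x. F x \<partial>M) = (\<integral>\<^sup>+x. G x \<partial>N)"
proof (cases "integrable M F")
  case True
  with assms(5) have "integrable N G" "integral\<^sup>L N G = integral\<^sup>L M F" by auto
  with True assms(3,4) show ?thesis by (simp add: nn_integral_eq_integral)
next
  case False
  with assms(5) have "\<not> integrable N G" by auto
  with False have "(\<integral>\<^sup>+x. F x \<partial>M) = \<infinity>" "(\<integral>\<^sup>+x. G x \<partial>N) = \<infinity>"
    using assms(1-4) by (auto simp: integrable_iff_bounded simp flip: top.not_eq_extremum)
  then show ?thesis by simp
qed

lemma nn_integral_change_of_variables_wo:
  fixes g :: "real^'m::{finite,wellorder} \<Rightarrow> real^'m::_" and f :: "real^'m::_ \<Rightarrow> real"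
  assumes S: "S \<in> sets borel" "g ` S \<in> sets borel"
    and der: "\<And>x. x \<in> S \<Longrightarrow> (g has_derivative g' x) (at x within S)" and inj: "inj_on g S"
    and meas: "(\<lambda>y. indicator (g ` S) y * f y) \<in> borel_measurable borel"
      "(\<lambda>x. indicator S x * (\<bar>det (matrix (g' x))\<bar> * f (g x))) \<in> borel_measurable borel"
    and nonneg: "\<And>y. y \<in> g ` S \<Longrightarrow> 0 \<le> f y"
  shows "(\<integral>\<^sup>+y. ennreal (indicator (g ` S) y * f y) \<partial>lborel)
    = (\<integral>\<^sup>+x. ennreal (indicator S x * (\<bar>det (matrix (g' x))\<bar> * f (g x))) \<partial>lborel)"
proof (rule nn_integral_eqI[symmetric])
  fix b
  let ?D = "\<lambda>x. \<bar>det (matrix (g' x))\<bar> * f (g x)"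
  have lb: "S \<in> sets lebesgue" using S(1) by simp
  \<comment> \<open>The theorem speaks about vector-valued functions, so the scalar f passes through
    \<open>real^1\<close>.\<close>
  have "(\<lambda>x. \<bar>det (matrix (g' x))\<bar> *\<^sub>R (vec (f (g x)) :: real^1)) absolutely_integrable_on S \<and>
      integral S (\<lambda>x. \<bar>det (matrix (g' x))\<bar> *\<^sub>R (vec (f (g x)) :: real^1)) = vec b \<longleftrightarrow>
      (\<lambda>y. vec (f y) :: real^1) absolutely_integrable_on (g ` S) \<and> integral (g ` S) (\<lambda>y. vec (f y) :: real^1) = vec b"
    by (rule has_absolute_integral_change_of_variables[OF lb der inj])
  then have "?D absolutely_integrable_on S \<and> integral S ?D = b
      \<longleftrightarrow> f absolutely_integrable_on (g ` S) \<and> integral (g ` S) f = b"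
    unfolding absolutely_integrable_on_1_iff integral_on_1_eq by (simp add: vec_eq_iff)
  \<comment> \<open>Absolute integrability refers to the completed Lebesgue measure; Borel
    measurability of the integrand brings the statement back to \<open>lborel\<close>.\<close>
  moreover have "?D absolutely_integrable_on S \<and> integral S ?D = b \<longleftrightarrow>
      integrable lborel (\<lambda>x. indicator S x * ?D x) \<and> (\<integral>x. indicator S x * ?D x \<partial>lborel) = b"
    using meas(2) set_lebesgue_integral_eq_integral[of S ?D]
    by (auto simp: set_integrable_def set_lebesgue_integral_def integrable_completion integral_completion)
  moreover have "f absolutely_integrable_on (g ` S) \<and> integral (g ` S) f = b \<longleftrightarrow>
      integrable lborel (\<lambda>y. indicator (g ` S) y * f y) \<and> (\<integral>y. indicator (g ` S) y * f y \<partial>lborel) = b"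
    using meas(1) set_lebesgue_integral_eq_integral[of "g ` S" f]
    by (auto simp: set_integrable_def set_lebesgue_integral_def integrable_completion integral_completion)
  ultimately show "integrable lborel (\<lambda>x. indicator S x * ?D x) \<and> (\<integral>x. indicator S x * ?D x \<partial>lborel) = b
    \<longleftrightarrow> integrable lborel (\<lambda>y. indicator (g ` S) y * f y) \<and> (\<integral>y. indicator (g ` S) y * f y \<partial>lborel) = b"
    by blast
qed (use meas nonneg in \<open>auto simp: indicator_def\<close>)

text \<open>The map is conjugated with the coordinate relabelling, which changes neither Lebesgue
  measure nor the determinant of the derivative.\<close>

lemma nn_integral_change_of_variables:
  fixes g :: "real^'n::finite \<Rightarrow> real^'n" and f :: "real^'n \<Rightarrow> real"
  assumes S: "S \<in> sets borel" "g ` S \<in> sets borel"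
    and der: "\<And>x. x \<in> S \<Longrightarrow> (g has_derivative g' x) (at x within S)" and inj: "inj_on g S"
    and meas: "(\<lambda>y. indicator (g ` S) y * f y) \<in> borel_measurable borel"
      "(\<lambda>x. indicator S x * (\<bar>det (matrix (g' x))\<bar> * f (g x))) \<in> borel_measurable borel"
    and nonneg: "\<And>y. y \<in> g ` S \<Longrightarrow> 0 \<le> f y"
  shows "(\<integral>\<^sup>+y. ennreal (indicator (g ` S) y * f y) \<partial>lborel)
    = (\<integral>\<^sup>+x. ennreal (indicator S x * (\<bar>det (matrix (g' x))\<bar> * f (g x))) \<partial>lborel)"
proof -
  let ?e = "Rep_wo :: 'n wo \<Rightarrow> 'n"
  let ?r = "relabel ?e" and ?q = "relabel (inv ?e) :: real^'n wo \<Rightarrow> real^'n"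
  note e = bij_Rep_wo[where 'a='n]
  note rq [simp] = relabel_inv[OF e]
  let ?S = "?r ` S" and ?g = "\<lambda>y. ?r (g (?q y))"
  have im: "?r ` X = ?q -` X" for X by (force simp: image_iff)
  have gS: "?g ` ?S = ?r ` (g ` S)" by (simp add: image_image)
  have ind: "indicator (?r ` X) y = (indicator X (?q y) :: real)" for X y
    unfolding im by (simp add: indicator_def)
  have qm: "?q \<in> measurable borel borel" by simp
  have sets: "?r ` X \<in> sets borel" if "X \<in> sets borel" for X
    unfolding im using measurable_sets[OF qm that] by simp
  let ?d = "\<lambda>x v. ?r (g' (?q x) (?q v))"
  have mat: "det (matrix (?d y)) = det (matrix (g' (?q y)))" for y
  proof -
    have ax: "?q (axis j 1) = axis (?e j) 1" for j
    proof -
      have "inv ?e i = j \<longleftrightarrow> i = ?e j" for i using e by (metis bij_inv_eq_iff)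
      then show ?thesis by (simp add: vec_eq_iff axis_def)
    qed
    have "matrix (?d y) = (\<chi> i j. matrix (g' (?q y)) $ ?e i $ ?e j)"
      by (simp add: matrix_def ax vec_eq_iff)
    then show ?thesis using det_relabel[OF e, of "matrix (g' (?q y))"] by simp
  qed
  have "(\<integral>\<^sup>+y. ennreal (indicator (?g ` ?S) y * f (?q y)) \<partial>lborel)
    = (\<integral>\<^sup>+x. ennreal (indicator ?S x * (\<bar>det (matrix (?d x))\<bar> * f (?q (?g x)))) \<partial>lborel)"
  proof (rule nn_integral_change_of_variables_wo)
    show "?S \<in> sets borel" "?g ` ?S \<in> sets borel" unfolding gS by (intro sets S)+
    show "inj_on ?g ?S"
    proof (rule inj_onI)
      fix x y assume "x \<in> ?S" "y \<in> ?S" "?g x = ?g y"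
      then have "?q x \<in> S" "?q y \<in> S" by auto
      moreover have "g (?q x) = g (?q y)" using \<open>?g x = ?g y\<close> by (metis rq(1))
      ultimately have "?q x = ?q y" using inj by (auto dest: inj_onD)
      then show "x = y" by (metis rq(2))
    qed
    show "(?g has_derivative ?d x) (at x within ?S)" if "x \<in> ?S" for x
    proof -
      have x: "?q x \<in> S" using that by auto
      have q: "(?q has_derivative ?q) (at x within ?S)"
        by (intro bounded_linear_imp_has_derivative bounded_linear_relabel)
      have "?q ` ?S = S" by (force simp: image_image)
      then have "(g has_derivative g' (?q x)) (at (?q x) within ?q ` ?S)" using der[OF x] by simp
      from has_derivative_in_compose[OF q this]
      show ?thesis by (rule bounded_linear.has_derivative[OF bounded_linear_relabel])
    qed
    have "(\<lambda>y. indicator (g ` S) (?q y) * f (?q y)) \<in> borel_measurable borel"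
      using measurable_compose[OF qm meas(1)] by simp
    then show "(\<lambda>y. indicator (?g ` ?S) y * f (?q y)) \<in> borel_measurable borel"
      unfolding gS ind .
    show "(\<lambda>x. indicator ?S x * (\<bar>det (matrix (?d x))\<bar> * f (?q (?g x)))) \<in> borel_measurable borel"
      unfolding mat ind using measurable_compose[OF qm meas(2)] by simp
    show "0 \<le> f (?q y)" if "y \<in> ?g ` ?S" for y using that nonneg by auto
  qed
  then have "(\<integral>\<^sup>+y. ennreal (indicator (g ` S) (?q y) * f (?q y)) \<partial>lborel)
    = (\<integral>\<^sup>+x. ennreal (indicator S (?q x) * (\<bar>det (matrix (g' (?q x)))\<bar> * f (g (?q x)))) \<partial>lborel)"
    unfolding gS ind mat rq .
  moreover have "(\<integral>\<^sup>+y. ennreal (indicator (g ` S) (?q y) * f (?q y)) \<partial>lborel)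
     = (\<integral>\<^sup>+y. ennreal (indicator (g ` S) y * f y) \<partial>lborel)"
    by (rule nn_integral_relabel[OF bij_imp_bij_inv[OF e], where f="\<lambda>y. ennreal (indicator (g ` S) y * f y)"])
      (use meas(1) in measurable)
  moreover have "(\<integral>\<^sup>+x. ennreal (indicator S (?q x) * (\<bar>det (matrix (g' (?q x)))\<bar> * f (g (?q x)))) \<partial>lborel)
     = (\<integral>\<^sup>+x. ennreal (indicator S x * (\<bar>det (matrix (g' x))\<bar> * f (g x))) \<partial>lborel)"
    by (rule nn_integral_relabel[OF bij_imp_bij_inv[OF e],
          where f="\<lambda>x. ennreal (indicator S x * (\<bar>det (matrix (g' x))\<bar> * f (g x)))"])
      (use meas(2) in measurable)
  ultimately show ?thesis by simp
qed

section \<open>Charts of a Riemannian manifold with boundary\<close>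

lemma smooth_onE:
  assumes "smooth_on S f" "x \<in> S"
  obtains T F where "open T" "x \<in> T" "\<And>k. Ck_on k T F" "\<And>y. y \<in> S \<inter> T \<Longrightarrow> F y = f y"
  using assms unfolding smooth_on_def by metis

lemma smooth_on_differentiable:
  assumes "smooth_on S f" "x \<in> S"
  shows "f differentiable (at x within S)"
proof -
  obtain T F where T: "open T" "x \<in> T" "\<And>k. Ck_on k T F" "\<And>y. y \<in> S \<inter> T \<Longrightarrow> F y = f y"
    using smooth_onE[OF assms] by blast
  have "(F has_derivative frechet_derivative F (at x)) (at x within S)"
    using has_derivative_at_withinI[OF Ck_on_has_derivative[OF T(3)[of "Suc 0"] T(2)]] .
  moreover obtain d where "0 < d" "ball x d \<subseteq> T" using T(1,2) open_contains_ball by blast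
  ultimately have "(f has_derivative frechet_derivative F (at x)) (at x within S)"
    using assms(2) T(4) by (elim has_derivative_transform_within[where d=d]) (auto simp: dist_commute subset_iff)
  then show ?thesis by (auto simp: differentiable_def)
qed

lemma smooth_on_continuous: "smooth_on S f \<Longrightarrow> continuous_on S f"
  by (simp add: continuous_on_eq_continuous_within differentiable_imp_continuous_within smooth_on_differentiable)

section \<open>Determinants, inverse matrices and the half-space\<close>

lemma det_pos_if_positive_definite:
  fixes M :: "real^'n^'n"
  assumes M: "\<And>v. v \<noteq> 0 \<Longrightarrow> 0 < v \<bullet> (M *v v)"
  shows "0 < det M"
proof (rule ccontr)
  assume neg: "\<not> 0 < det M"
  \<comment> \<open>The segment from the identity to M stays within the positive definite matrices.
    If det M were not positive, the determinant would vanish somewhere on the segment, and a kernel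
    vector there would contradict definiteness.\<close>
  define P where "P = (\<lambda>t::real. (1 - t) *\<^sub>R mat 1 + t *\<^sub>R M)"
  have "continuous_on {0..1} (\<lambda>t. det (P t))"
    unfolding P_def det_def by (auto intro!: continuous_intros)
  moreover have "det (P 1) \<le> 0" "0 \<le> det (P 0)" using neg by (auto simp: P_def)
  ultimately obtain t where t: "0 \<le> t" "t \<le> 1" "det (P t) = 0"
    using IVT2'[of "\<lambda>t. det (P t)" 1 0 0] by auto
  then have "\<not> invertible (P t)" by (simp add: invertible_det_nz)
  then obtain v where v: "v \<noteq> 0" "P t *v v = 0"
    using matrix_left_invertible_ker[of "P t"] invertible_left_inverse[of "P t"] by blast
  have "v \<bullet> (P t *v v) = (1 - t) * (v \<bullet> v) + t * (v \<bullet> (M *v v))"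
    by (simp add: P_def matrix_vector_mult_add_rdistrib scaleR_matrix_vector_assoc[symmetric] inner_add_right)
  moreover have "0 < (1 - t) * (v \<bullet> v) + t * (v \<bullet> (M *v v))"
  proof (cases "t = 1")
    case False
    then have "0 < (1 - t) * (v \<bullet> v)" using t v(1) by simp
    moreover have "0 \<le> t * (v \<bullet> (M *v v))" using t(1) M[OF v(1)] by simp
    ultimately show ?thesis by linarith
  qed (use M[OF v(1)] in simp)
  ultimately show False using v(2) by simp
qed

lemma matrix_inv_mult:
  fixes M :: "real^'n^'n"
  assumes "det M \<noteq> 0"
  shows "M ** matrix_inv M = mat 1" "matrix_inv M ** M = mat 1"
proof -
  have "\<exists>B. M ** B = mat 1 \<and> B ** M = mat 1"
    using assms invertible_det_nz[of M] by (auto simp: invertible_def)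
  then have "M ** matrix_inv M = mat 1 \<and> matrix_inv M ** M = mat 1"
    unfolding matrix_inv_def by (rule someI_ex)
  then show "M ** matrix_inv M = mat 1" "matrix_inv M ** M = mat 1" by auto
qed

lemma continuous_on_det:
  fixes M :: "'a::topological_space \<Rightarrow> real^'n^'n"
  shows "continuous_on S M \<Longrightarrow> continuous_on S (\<lambda>x. det (M x))"
  unfolding det_def by (auto intro!: continuous_intros)

text \<open>By Cramer's rule the entries of the inverse are quotients of determinants, which are
  polynomials in the entries.\<close>

lemma continuous_on_matrix_inv:
  fixes M :: "'a::topological_space \<Rightarrow> real^'n^'n"
  assumes M: "continuous_on S M" "\<And>x. x \<in> S \<Longrightarrow> det (M x) \<noteq> 0"
  shows "continuous_on S (\<lambda>x. matrix_inv (M x))"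
proof -
  let ?C = "\<lambda>x k j. det (\<chi> i l. if l = k then axis j 1 $ i else M x $ i $ l) / det (M x)"
  have "matrix_inv (M x) $ k $ j = ?C x k j" if "x \<in> S" for x k j
  proof -
    have "M x *v (matrix_inv (M x) *v axis j 1) = axis j 1"
      using matrix_inv_mult[OF M(2)[OF that]] by (simp add: matrix_vector_mul_assoc)
    then have "matrix_inv (M x) *v axis j 1
        = (\<chi> k. det (\<chi> i l. if l = k then axis j 1 $ i else M x $ i $ l) / det (M x))"
      using cramer[OF M(2)[OF that]] by blast
    moreover have "(matrix_inv (M x) *v axis j 1) $ k = matrix_inv (M x) $ k $ j"
      by (simp add: matrix_vector_mult_basis column_def)
    ultimately show ?thesis by simp
  qed
  then have eq: "matrix_inv (M x) = (\<chi> k j. ?C x k j)" if "x \<in> S" for x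
    using that by (simp add: vec_eq_iff)
  have "continuous_on S (\<lambda>x. \<chi> i l. if l = k then axis j 1 $ i else M x $ i $ l)" for k j
  proof (intro continuous_on_vec_lambda)
    fix i l show "continuous_on S (\<lambda>x. if l = k then axis j 1 $ i else M x $ i $ l)"
      by (cases "l = k") (auto intro!: continuous_intros M(1))
  qed
  then have "continuous_on S (\<lambda>x. ?C x k j)" for k j
    by (intro continuous_on_divide continuous_on_det[OF M(1)] continuous_on_det) (use M(2) in auto)
  then have "continuous_on S (\<lambda>x. \<chi> k j. ?C x k j)"
    by (intro continuous_on_vec_lambda)
  then show ?thesis by (rule continuous_on_eq) (simp add: eq)
qed

lemma closed_half_space: "closed (half_space :: (real^'n::finite) set)"
  unfolding half_space_def by (rule closed_halfspace_component_ge_cart)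

lemma interior_half_space: "interior (half_space :: (real^'n::finite) set) = {x. 0 < x $ bdry_coord}"
proof -
  have "interior {x::real^'n. axis bdry_coord 1 \<bullet> x \<ge> 0} = {x. axis bdry_coord 1 \<bullet> x > 0}"
    by (rule interior_halfspace_ge) (simp add: axis_eq_0_iff)
  then show ?thesis by (simp add: half_space_def inner_axis')
qed

locale riemannian_atlas =
  fixes A :: "('m::{t2_space,second_countable_topology}, 'n::finite) chart set"
    and G :: "('m, 'n) chart \<Rightarrow> 'm \<Rightarrow> real^'n^'n"
  assumes atlas: "smooth_atlas A" and metric: "riemannian_metric A G"
begin

abbreviation img :: "('m, 'n) chart \<Rightarrow> (real^'n) set" where "img c \<equiv> snd c ` fst c"

lemma chart:
  assumes "c \<in> A"
  shows open_chart: "open (fst c)" and openin_img: "openin (top_of_set half_space) (img c)"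
    and continuous_chart: "continuous_on (fst c) (snd c)"
    and continuous_chart_inv: "continuous_on (img c) (chart_inv c)"
    and chart_inv_chart: "\<And>p. p \<in> fst c \<Longrightarrow> chart_inv c (snd c p) = p"
    and chart_chart_inv: "\<And>x. x \<in> img c \<Longrightarrow> snd c (chart_inv c x) = x"
    and chart_inv_in: "\<And>x. x \<in> img c \<Longrightarrow> chart_inv c x \<in> fst c"
  using assms atlas unfolding smooth_atlas_def is_chart_def homeomorphism_def by auto

lemma chart_cover: obtains c where "c \<in> A" "p \<in> fst c"
  using atlas unfolding smooth_atlas_def by blast

lemma chart_image_eq:
  "c \<in> A \<Longrightarrow> snd c ` (fst c \<inter> X) = {x \<in> img c. chart_inv c x \<in> X}"
  by (auto simp: chart_inv_chart)

lemma img_borel: "c \<in> A \<Longrightarrow> img c \<in> sets borel"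
  using openin_img[of c] closed_half_space unfolding openin_open
  by (metis borel_closed borel_open sets.Int)

lemma img_subset: "c \<in> A \<Longrightarrow> img c \<subseteq> half_space"
  using openin_img[of c] openin_imp_subset by blast

lemma interior_img: "c \<in> A \<Longrightarrow> interior (img c) = {x \<in> img c. 0 < x $ bdry_coord}"
proof
  assume c: "c \<in> A"
  show "interior (img c) \<subseteq> {x \<in> img c. 0 < x $ bdry_coord}"
    using interior_mono[OF img_subset[OF c]] interior_subset[of "img c"] unfolding interior_half_space by blast
  obtain T where T: "open T" "img c = half_space \<inter> T"
    using openin_img[OF c] unfolding openin_open by blast
  have "open (T \<inter> {x. 0 < x $ bdry_coord})"
    using T(1) open_interior[of half_space] unfolding interior_half_space by (rule open_Int)
  moreover have "T \<inter> {x. 0 < x $ bdry_coord} \<subseteq> img c" unfolding T(2) half_space_def by auto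
  ultimately have "T \<inter> {x. 0 < x $ bdry_coord} \<subseteq> interior (img c)" by (rule interior_maximal[rotated])
  then show "{x \<in> img c. 0 < x $ bdry_coord} \<subseteq> interior (img c)" using T(2) by blast
qed

text \<open>\<open>bdry\<close> asks for some chart that sends p to the hyperplane; the point is
  that then every chart does. If p were an interior point in c, invariance of domain would make the
  transition to c' open near it. An open subset of R^n inside the half-space lies in the open
  half-space, so p could not reach the hyperplane in c'.\<close>

lemma bdry_iff:
  assumes c: "c \<in> A" "p \<in> fst c"
  shows "p \<in> bdry A \<longleftrightarrow> snd c p $ bdry_coord = 0"
proof
  assume "p \<in> bdry A"
  then obtain c' where c': "c' \<in> A" "p \<in> fst c'" "snd c' p $ bdry_coord = 0" by (auto simp: bdry_def)
  show "snd c p $ bdry_coord = 0"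
  proof (rule ccontr)
    assume "snd c p $ bdry_coord \<noteq> 0"
    moreover have "snd c p \<in> half_space" using img_subset[OF c(1)] c(2) by blast
    ultimately have x: "snd c p \<in> interior (img c)"
      using c by (auto simp: interior_img half_space_def)
    let ?U = "interior (img c) \<inter> chart_inv c -` fst c'"
    have ci: "continuous_on (interior (img c)) (chart_inv c)"
      by (rule continuous_on_subset[OF continuous_chart_inv[OF c(1)] interior_subset])
    have U: "open ?U"
      using ci open_chart[OF c'(1)] by (rule continuous_open_preimage[OF _ open_interior])
    have "continuous_on ?U (\<lambda>x. snd c' (chart_inv c x))"
      by (rule continuous_on_compose2[OF continuous_chart[OF c'(1)]])
        (auto intro: continuous_on_subset[OF ci])
    moreover have "inj_on (\<lambda>x. snd c' (chart_inv c x)) ?U"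
    proof (rule inj_onI)
      fix x y assume xy: "x \<in> ?U" "y \<in> ?U" "snd c' (chart_inv c x) = snd c' (chart_inv c y)"
      then have "chart_inv c x = chart_inv c y" using chart_inv_chart[OF c'(1)] by (metis IntD2 vimageE)
      moreover have "x \<in> img c" "y \<in> img c" using xy interior_subset by blast+
      ultimately show "x = y" using chart_chart_inv[OF c(1)] by metis
    qed
    ultimately have "open ((\<lambda>x. snd c' (chart_inv c x)) ` ?U)"
      using U by (intro invariance_of_domain)
    moreover have "(\<lambda>x. snd c' (chart_inv c x)) ` ?U \<subseteq> half_space"
      using img_subset[OF c'(1)] by blast
    ultimately have "(\<lambda>x. snd c' (chart_inv c x)) ` ?U \<subseteq> {x. 0 < x $ bdry_coord}"
      unfolding interior_half_space[symmetric] by (rule interior_maximal[rotated])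
    moreover have "snd c p \<in> ?U" using x c c' by (simp add: chart_inv_chart)
    ultimately have "0 < snd c' (chart_inv c (snd c p)) $ bdry_coord" by blast
    then show False using c' c by (simp add: chart_inv_chart)
  qed
qed (use c in \<open>auto simp: bdry_def\<close>)

lemma int_iff: "c \<in> A \<Longrightarrow> p \<in> fst c \<Longrightarrow> p \<in> int_mfd A \<longleftrightarrow> snd c p \<in> interior (img c)"
  using bdry_iff[of c p] img_subset[of c] by (auto simp: int_mfd_def interior_img half_space_def order_less_le)

lemma img_int: "c \<in> A \<Longrightarrow> snd c ` (fst c \<inter> int_mfd A) = interior (img c)"
  using int_iff[of c] interior_subset[of "img c"] by (auto simp: image_iff) blast

text \<open>The overlap image is only relatively open in the half-space, so at boundary points this
  derivative is one-sided, taken within that image.\<close>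

lemma transition_has_derivative:
  assumes "c \<in> A" "c' \<in> A" "p \<in> fst c \<inter> fst c'"
  shows "((snd c' \<circ> chart_inv c) has_derivative (\<lambda>v. jacobian c c' p *v v))
    (at (snd c p) within snd c ` (fst c \<inter> fst c'))"
proof -
  have "smooth_on (snd c ` (fst c \<inter> fst c')) (snd c' \<circ> chart_inv c)"
    using atlas assms(1,2) unfolding smooth_atlas_def by blast
  then have "(snd c' \<circ> chart_inv c) differentiable (at (snd c p) within snd c ` (fst c \<inter> fst c'))"
    using assms(3) by (intro smooth_on_differentiable) auto
  then have d: "((snd c' \<circ> chart_inv c) has_derivative
      frechet_derivative (snd c' \<circ> chart_inv c) (at (snd c p) within snd c ` (fst c \<inter> fst c')))
      (at (snd c p) within snd c ` (fst c \<inter> fst c'))"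
    by (simp add: frechet_derivative_works)
  have "jacobian c c' p *v v
      = frechet_derivative (snd c' \<circ> chart_inv c) (at (snd c p) within snd c ` (fst c \<inter> fst c')) v" for v
    unfolding jacobian_def by (rule matrix_works[OF has_derivative_linear[OF d, unfolded linear_matrix_vector_mul_eq[symmetric]]])
  then show ?thesis using d by (simp add: fun_eq_iff)
qed

lemma metric_transform:
  "c \<in> A \<Longrightarrow> c' \<in> A \<Longrightarrow> p \<in> fst c \<Longrightarrow> p \<in> fst c' \<Longrightarrow>
    G c p = transpose (jacobian c c' p) ** G c' p ** jacobian c c' p"
  using metric unfolding riemannian_metric_def by blast

lemma metric_pos: "c \<in> A \<Longrightarrow> p \<in> fst c \<Longrightarrow> v \<noteq> 0 \<Longrightarrow> 0 < v \<bullet> (G c p *v v)"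
  using metric unfolding riemannian_metric_def by blast

lemma det_metric_pos: "c \<in> A \<Longrightarrow> p \<in> fst c \<Longrightarrow> 0 < det (G c p)"
  using metric_pos by (blast intro: det_pos_if_positive_definite)

lemma det_metric_transform:
  "c \<in> A \<Longrightarrow> c' \<in> A \<Longrightarrow> p \<in> fst c \<Longrightarrow> p \<in> fst c' \<Longrightarrow>
    det (G c p) = (det (jacobian c c' p))\<^sup>2 * det (G c' p)"
  by (subst metric_transform[of c c' p]) (auto simp: det_mul det_transpose power2_eq_square)

lemma continuous_metric: "c \<in> A \<Longrightarrow> continuous_on (img c) (\<lambda>x. G c (chart_inv c x))"
  using metric smooth_on_continuous[of "img c" "G c \<circ> chart_inv c"]
  unfolding riemannian_metric_def o_def by blast

section \<open>Existence and uniqueness of the Riemannian volume\<close>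

definition vol_dens :: "('m, 'n) chart \<Rightarrow> real^'n \<Rightarrow> real" where
  "vol_dens c x = indicator (img c) x * sqrt (det (G c (chart_inv c x)))"

text \<open>The volume of one chart domain, regarded as a measure on all of M that vanishes off the
  domain. The arbitrary values of \<open>chart_inv c\<close> off the chart image carry density
  0.\<close>

definition chart_vol :: "('m, 'n) chart \<Rightarrow> 'm measure" where
  "chart_vol c = distr (density lborel (\<lambda>x. ennreal (vol_dens c x))) borel (chart_inv c)"

lemma vol_dens_nonneg: "c \<in> A \<Longrightarrow> 0 \<le> vol_dens c x"
  using det_metric_pos[of c "chart_inv c x"] chart_inv_in[of c x]
  by (auto simp: vol_dens_def indicator_def less_imp_le)

lemma vol_dens_measurable [measurable]: "c \<in> A \<Longrightarrow> vol_dens c \<in> borel_measurable borel"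
proof -
  assume c: "c \<in> A"
  have "continuous_on (img c) (\<lambda>x. sqrt (det (G c (chart_inv c x))))"
    by (intro continuous_intros continuous_on_det continuous_metric c)
  from borel_measurable_continuous_on_indicator[OF img_borel[OF c] this] show ?thesis
    by (simp add: vol_dens_def[abs_def])
qed

text \<open>Off the image \<open>inv_into\<close> chooses from the everywhere false predicate,
  always the same one. Being constant there is what makes \<open>chart_inv c\<close> Borel
  measurable on the whole space.\<close>

lemma chart_inv_outside: "x \<notin> img c \<Longrightarrow> chart_inv c x = chart_inv c y" if "y \<notin> img c"
proof -
  assume x: "x \<notin> img c"
  have "(\<lambda>p. p \<in> fst c \<and> snd c p = x) = (\<lambda>p. p \<in> fst c \<and> snd c p = y)"
    using x that by (auto simp: fun_eq_iff)
  then show ?thesis unfolding chart_inv_def inv_into_def by simp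
qed

lemma chart_inv_measurable [measurable]:
  assumes c: "c \<in> A" shows "chart_inv c \<in> measurable borel borel"
proof (rule borel_measurableI)
  fix U :: "'m set" assume U: "open U"
  have 1: "img c \<inter> chart_inv c -` U \<in> sets borel"
  proof -
    obtain T where "open T" "img c \<inter> chart_inv c -` U = img c \<inter> T"
      using continuous_openin_preimage_gen[OF continuous_chart_inv[OF c] U] unfolding openin_open by blast
    then show ?thesis using img_borel[OF c] by simp
  qed
  have 2: "- img c \<inter> chart_inv c -` U \<in> sets borel"
  proof (cases "\<exists>y. y \<notin> img c \<and> chart_inv c y \<in> U")
    case True
    then have "- img c \<inter> chart_inv c -` U = - img c" using chart_inv_outside by (auto, metis)
    then show ?thesis using img_borel[OF c] by (simp add: borel_comp)
  next
    case False
    then have "- img c \<inter> chart_inv c -` U = {}" by auto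
    then show ?thesis by simp
  qed
  have eq: "chart_inv c -` U \<inter> space borel = (img c \<inter> chart_inv c -` U) \<union> (- img c \<inter> chart_inv c -` U)" by auto
  show "chart_inv c -` U \<inter> space borel \<in> sets borel" unfolding eq by (rule sets.Un[OF 1 2])
qed

lemma chart_inv_measurable_density:
  "c \<in> A \<Longrightarrow> chart_inv c \<in> measurable (density lborel f) borel"
  using chart_inv_measurable[of c] measurable_cong_sets[of "density lborel f" borel borel borel] by simp

lemma chart_image_borel:
  assumes c: "c \<in> A" and X: "X \<in> sets borel" shows "snd c ` (fst c \<inter> X) \<in> sets borel"
proof -
  have "snd c ` (fst c \<inter> X) = img c \<inter> chart_inv c -` X"
    unfolding chart_image_eq[OF c] by blast
  moreover have "chart_inv c -` X \<in> sets borel"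
    using measurable_sets[OF chart_inv_measurable[OF c] X] by simp
  ultimately show ?thesis using img_borel[OF c] by simp
qed

lemma sets_chart_vol [simp, measurable_cong]: "sets (chart_vol c) = sets borel" by (simp add: chart_vol_def)

lemma space_chart_vol [simp]: "space (chart_vol c) = UNIV" by (simp add: chart_vol_def)

lemma emeasure_chart_vol:
  assumes c: "c \<in> A" and X: "X \<in> sets borel"
  shows "emeasure (chart_vol c) X = (\<integral>\<^sup>+x. ennreal (vol_dens c x * indicator (snd c ` (fst c \<inter> X)) x) \<partial>lborel)"
proof -
  have Y: "chart_inv c -` X \<in> sets borel"
    using measurable_sets[OF chart_inv_measurable[OF c] X] by simp
  have "emeasure (chart_vol c) X = emeasure (density lborel (\<lambda>x. ennreal (vol_dens c x))) (chart_inv c -` X)"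
    unfolding chart_vol_def using c X by (subst emeasure_distr) (auto intro: chart_inv_measurable_density)
  also have "\<dots> = (\<integral>\<^sup>+x. ennreal (vol_dens c x) * indicator (chart_inv c -` X) x \<partial>lborel)"
    using c Y by (intro emeasure_density) auto
  also have "\<dots> = (\<integral>\<^sup>+x. ennreal (vol_dens c x * indicator (snd c ` (fst c \<inter> X)) x) \<partial>lborel)"
  proof (rule nn_integral_cong)
    fix x
    show "ennreal (vol_dens c x) * indicator (chart_inv c -` X) x = ennreal (vol_dens c x * indicator (snd c ` (fst c \<inter> X)) x)"
      unfolding chart_image_eq[OF c] by (cases "x \<in> img c") (auto simp: vol_dens_def indicator_def)
  qed
  finally show ?thesis .
qed

text \<open>The determinant of the metric changes by the square of the Jacobian determinant, so its
  square root changes by precisely the factor in the change of variables formula.\<close>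

lemma chart_vol_cong:
  assumes c: "c \<in> A" "c' \<in> A" and X: "X \<in> sets borel" "X \<subseteq> fst c" "X \<subseteq> fst c'"
  shows "emeasure (chart_vol c) X = emeasure (chart_vol c') X"
proof -
  let ?g = "snd c' \<circ> chart_inv c" and ?S = "snd c ` X"
  let ?f = "\<lambda>y. sqrt (det (G c' (chart_inv c' y)))"
  have eq: "fst c \<inter> X = X" "fst c' \<inter> X = X" using X by auto
  have gS: "?g ` ?S = snd c' ` X"
    using X chart_inv_chart[OF c(1)] by (auto simp: image_image subset_iff intro!: image_cong)
  have S: "?S \<in> sets borel" "?g ` ?S \<in> sets borel"
    unfolding gS using chart_image_borel[OF c(1) X(1)] chart_image_borel[OF c(2) X(1)] by (simp_all add: eq)
  have f: "indicator (?g ` ?S) y * ?f y = vol_dens c' y * indicator (snd c' ` (fst c' \<inter> X)) y" for y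
    unfolding gS eq using X by (auto simp: vol_dens_def indicator_def)
  have jac: "indicator ?S x * (\<bar>det (matrix (\<lambda>v. jacobian c c' (chart_inv c x) *v v))\<bar> * ?f (?g x))
      = vol_dens c x * indicator (snd c ` (fst c \<inter> X)) x" for x
  proof (cases "x \<in> ?S")
    case True
    then obtain p where p: "p \<in> X" "x = snd c p" by blast
    then have pc: "p \<in> fst c" "p \<in> fst c'" using X by auto
    have "sqrt (det (G c p)) = \<bar>det (jacobian c c' p)\<bar> * sqrt (det (G c' p))"
      using det_metric_transform[OF c pc] by (simp add: real_sqrt_mult)
    then show ?thesis using p pc c by (simp add: eq vol_dens_def chart_inv_chart)
  qed (simp add: eq)
  have "(\<integral>\<^sup>+y. ennreal (indicator (?g ` ?S) y * ?f y) \<partial>lborel) =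
    (\<integral>\<^sup>+x. ennreal (indicator ?S x * (\<bar>det (matrix (\<lambda>v. jacobian c c' (chart_inv c x) *v v))\<bar> * ?f (?g x))) \<partial>lborel)"
  proof (rule nn_integral_change_of_variables[OF S])
    fix x assume "x \<in> ?S"
    then obtain p where p: "p \<in> X" "x = snd c p" by blast
    then have pc: "p \<in> fst c \<inter> fst c'" using X by auto
    have "(?g has_derivative (\<lambda>v. jacobian c c' p *v v)) (at (snd c p) within ?S)"
      by (rule has_derivative_subset[OF transition_has_derivative[OF c pc]]) (use X in auto)
    then show "(?g has_derivative (\<lambda>v. jacobian c c' (chart_inv c x) *v v)) (at x within ?S)"
      using p pc c by (simp add: chart_inv_chart)
  next
    show "inj_on ?g ?S"
    proof (rule inj_onI)
      fix x y assume "x \<in> ?S" "y \<in> ?S" and xy: "?g x = ?g y"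
      then obtain p q where pq: "p \<in> X" "x = snd c p" "q \<in> X" "y = snd c q" by blast
      then have "snd c' p = snd c' q" using xy X c by (auto simp: chart_inv_chart subset_iff)
      then have "p = q" using chart_inv_chart[OF c(2)] pq X by (metis subsetD)
      then show "x = y" using pq by simp
    qed
    show "(\<lambda>y. indicator (?g ` ?S) y * ?f y) \<in> borel_measurable borel"
      unfolding f using c chart_image_borel[OF c(2) X(1)] by measurable
    show "(\<lambda>x. indicator ?S x * (\<bar>det (matrix (\<lambda>v. jacobian c c' (chart_inv c x) *v v))\<bar> * ?f (?g x)))
        \<in> borel_measurable borel"
      unfolding jac using c chart_image_borel[OF c(1) X(1)] by measurable
    show "0 \<le> ?f y" if "y \<in> ?g ` ?S" for y
      using that c X det_metric_pos[OF c(2)] unfolding gS by (auto simp: chart_inv_chart subset_iff less_imp_le)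
  qed
  then show ?thesis
    unfolding f jac using emeasure_chart_vol[OF c(1) X(1)] emeasure_chart_vol[OF c(2) X(1)] by simp
qed

text \<open>The place where second countability enters: Lindelof's theorem selects countably many
  chart domains, and making them disjoint reduces questions on the volume to countable sums over
  single charts.\<close>

lemma countable_chart_partition:
  obtains C :: "nat \<Rightarrow> ('m, 'n) chart" and B where "\<And>k. C k \<in> A" "range B \<subseteq> sets borel"
    "disjoint_family B" "\<And>k. B k \<subseteq> fst (C k)" "(\<Union>k. B k) = UNIV"
proof -
  obtain F where F: "F \<subseteq> fst ` A" "countable F" "\<Union>F = \<Union>(fst ` A)"
    using Lindelof[of "fst ` A"] open_chart by blast
  have U: "\<Union>(fst ` A) = UNIV" using chart_cover by blast
  then have "F \<noteq> {}" using F(3) by auto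
  then obtain f :: "nat \<Rightarrow> _" where f: "range f = F" using F(2) by (metis range_from_nat_into)
  have "\<forall>k. \<exists>c. c \<in> A \<and> fst c = f k" using F(1) f by blast
  then obtain C where C: "\<And>k. C k \<in> A" "\<And>k. fst (C k) = f k" by metis
  then have C': "(\<Union>k. fst (C k)) = UNIV" using f F(3) U by auto
  let ?B = "disjointed (\<lambda>k. fst (C k))"
  show ?thesis
  proof (rule that[of C ?B])
    show "range ?B \<subseteq> sets borel"
      using open_chart[OF C(1)] by (intro sets.range_disjointed_sets') auto
  qed (use C(1) C' in \<open>auto simp: disjoint_family_disjointed UN_disjointed_eq intro: subsetD[OF disjointed_subset]\<close>)
qed

definition is_volume :: "'m measure \<Rightarrow> bool" where
  "is_volume \<mu> \<longleftrightarrow> sets \<mu> = sets borel \<and>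
     (\<forall>c\<in>A. \<forall>B\<in>sets borel. B \<subseteq> fst c \<longrightarrow> emeasure \<mu> B = emeasure (chart_vol c) B)"

lemma is_volume_iff:
  "is_volume \<mu> \<longleftrightarrow> sets \<mu> = sets borel \<and>
     (\<forall>c\<in>A. \<forall>B\<in>sets borel. B \<subseteq> fst c \<longrightarrow>
        emeasure \<mu> B =
          (\<integral>\<^sup>+x. ennreal (sqrt (det (G c (chart_inv c x)))) * indicator (snd c ` B) x \<partial>lborel))"
proof -
  have "emeasure (chart_vol c) B = (\<integral>\<^sup>+x. ennreal (sqrt (det (G c (chart_inv c x)))) * indicator (snd c ` B) x \<partial>lborel)"
    if c: "c \<in> A" and B: "B \<in> sets borel" "B \<subseteq> fst c" for c B
  proof -
    have "fst c \<inter> B = B" using B by auto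
    moreover have "ennreal (vol_dens c x * indicator (snd c ` B) x)
        = ennreal (sqrt (det (G c (chart_inv c x)))) * indicator (snd c ` B) x" for x
      using image_mono[OF B(2), of "snd c"] by (cases "x \<in> snd c ` B") (auto simp: vol_dens_def)
    ultimately show ?thesis
      using emeasure_chart_vol[OF c B(1)] by simp
  qed
  then show ?thesis by (auto simp: is_volume_def)
qed

lemma is_volume_unique:
  assumes "is_volume \<mu>" "is_volume \<nu>" shows "\<mu> = \<nu>"
proof -
  obtain C :: "nat \<Rightarrow> ('m, 'n) chart" and B where C: "\<And>k. C k \<in> A" and B: "range B \<subseteq> sets borel"
    "disjoint_family B" "\<And>k. B k \<subseteq> fst (C k)" "(\<Union>k. B k) = UNIV"
    using countable_chart_partition by metis
  have *: "emeasure \<mu> X = (\<Sum>k. emeasure (chart_vol (C k)) (X \<inter> B k))"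
    if v: "is_volume \<mu>" and X: "X \<in> sets borel" for \<mu> X
  proof -
    have s: "sets \<mu> = sets borel" using v by (simp add: is_volume_def)
    have "(\<Sum>k. emeasure \<mu> (X \<inter> B k)) = emeasure \<mu> (\<Union>k. X \<inter> B k)"
      using X B by (intro suminf_emeasure) (auto simp: s disjoint_family_on_def)
    moreover have "(\<Union>k. X \<inter> B k) = X" using B(4) by blast
    moreover have "emeasure \<mu> (X \<inter> B k) = emeasure (chart_vol (C k)) (X \<inter> B k)" for k
      using v C[of k] B(1) B(3)[of k] X unfolding is_volume_def by (metis inf.coboundedI2 range_subsetD sets.Int)
    ultimately show ?thesis by simp
  qed
  show ?thesis
    using assms *[of \<mu>] *[of \<nu>] by (intro measure_eqI) (auto simp: is_volume_def)
qed

text \<open>The measure is assembled from the chart volumes on the pieces of a partition;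
  \<open>chart_vol_cong\<close> on each piece shows that it gives the right value in any other
  chart.\<close>

lemma is_volume_exists: "\<exists>\<mu>. is_volume \<mu>"
proof -
  obtain C :: "nat \<Rightarrow> ('m, 'n) chart" and B where C: "\<And>k. C k \<in> A" and B: "range B \<subseteq> sets borel"
    "disjoint_family B" "\<And>k. B k \<subseteq> fst (C k)" "(\<Union>k. B k) = UNIV"
    using countable_chart_partition by metis
  have Bm [measurable]: "B k \<in> sets borel" for k using B(1) by blast
  define m where "m = (\<lambda>X. \<Sum>k. emeasure (chart_vol (C k)) (X \<inter> B k))"
  define \<mu> where "\<mu> = measure_of UNIV (sets borel) m"
  have s: "sets \<mu> = sets borel" unfolding \<mu>_def
    by (metis sets.sets_measure_of_eq space_borel)
  have em: "emeasure \<mu> X = m X" if X: "X \<in> sets borel" for X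
  proof (rule emeasure_measure_of[OF \<mu>_def])
    show "positive (sets \<mu>) m" by (simp add: positive_def m_def)
    show "countably_additive (sets \<mu>) m"
      unfolding countably_additive_def s
    proof (intro allI impI)
      fix X :: "nat \<Rightarrow> 'm set"
      assume X: "range X \<subseteq> sets borel" "disjoint_family X"
      have "m (\<Union>i. X i) = (\<Sum>k. \<Sum>i. emeasure (chart_vol (C k)) (X i \<inter> B k))"
        unfolding m_def
      proof (rule suminf_cong)
        fix k
        have "(\<Sum>i. emeasure (chart_vol (C k)) (X i \<inter> B k)) = emeasure (chart_vol (C k)) (\<Union>i. X i \<inter> B k)"
          using X by (intro suminf_emeasure) (auto simp: disjoint_family_on_def)
        also have "(\<Union>i. X i \<inter> B k) = (\<Union>i. X i) \<inter> B k" by blast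
        finally show "emeasure (chart_vol (C k)) ((\<Union>i. X i) \<inter> B k) = (\<Sum>i. emeasure (chart_vol (C k)) (X i \<inter> B k))" ..
      qed
      \<comment> \<open>The interchange of the two infinite sums is Tonelli's theorem for the
        counting measure.\<close>
      also have "\<dots> = (\<integral>\<^sup>+k. (\<Sum>i. emeasure (chart_vol (C k)) (X i \<inter> B k)) \<partial>count_space UNIV)"
        by (simp add: nn_integral_count_space_nat)
      also have "\<dots> = (\<Sum>i. \<integral>\<^sup>+k. emeasure (chart_vol (C k)) (X i \<inter> B k) \<partial>count_space UNIV)"
        by (rule nn_integral_suminf) simp
      also have "\<dots> = (\<Sum>i. m (X i))"
        by (simp add: nn_integral_count_space_nat m_def)
      finally show "(\<Sum>i. m (X i)) = m (\<Union>i. X i)" ..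
    qed
  qed (use X s in \<open>auto simp: sets.space_closed\<close>)
  have "emeasure \<mu> X = emeasure (chart_vol c) X" if c: "c \<in> A" and X: "X \<in> sets borel" "X \<subseteq> fst c" for c X
  proof -
    have "emeasure \<mu> X = (\<Sum>k. emeasure (chart_vol (C k)) (X \<inter> B k))" using em[OF X(1)] by (simp add: m_def)
    also have "\<dots> = (\<Sum>k. emeasure (chart_vol c) (X \<inter> B k))"
      using X B(3) by (intro suminf_cong chart_vol_cong C c) auto
    also have "\<dots> = emeasure (chart_vol c) (\<Union>k. X \<inter> B k)"
    proof (rule suminf_emeasure)
      show "disjoint_family (\<lambda>k. X \<inter> B k)" using B(2) unfolding disjoint_family_on_def by blast
    qed (use X(1) in auto)
    also have "(\<Union>k. X \<inter> B k) = X" using B(4) by blast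
    finally show ?thesis .
  qed
  then show ?thesis using s unfolding is_volume_def by blast
qed

text \<open>Resolves the definite description; from here on the volume is accessed through this
  characterisation.\<close>

lemma is_volume_riemannian_volume: "is_volume (riemannian_volume A G)"
proof -
  have "riemannian_volume A G = (THE \<mu>. is_volume \<mu>)"
    unfolding riemannian_volume_def is_volume_iff ..
  moreover have "\<exists>!\<mu>. is_volume \<mu>" using is_volume_exists is_volume_unique by blast
  ultimately show ?thesis by (metis theI')
qed

lemma sets_riemannian_volume [simp, measurable_cong]: "sets (riemannian_volume A G) = sets borel"
  using is_volume_riemannian_volume by (simp add: is_volume_def)

lemma density_riemannian_volume:
  assumes c: "c \<in> A"
  shows "density (riemannian_volume A G) (\<lambda>p. ennreal (indicator (fst c) p)) = chart_vol c"
proof (rule measure_eqI)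
  fix X assume "X \<in> sets (density (riemannian_volume A G) (\<lambda>p. ennreal (indicator (fst c) p)))"
  then have X: "X \<in> sets borel" by simp
  have o: "fst c \<in> sets borel" using open_chart[OF c] by simp
  have "emeasure (density (riemannian_volume A G) (\<lambda>p. ennreal (indicator (fst c) p))) X
      = (\<integral>\<^sup>+p. ennreal (indicator (fst c) p) * indicator X p \<partial>riemannian_volume A G)"
    using X o by (intro emeasure_density) auto
  also have "\<dots> = (\<integral>\<^sup>+p. indicator (fst c \<inter> X) p \<partial>riemannian_volume A G)"
    by (intro nn_integral_cong) (auto simp: indicator_def)
  also have "\<dots> = emeasure (riemannian_volume A G) (fst c \<inter> X)" using X o by simp
  also have "\<dots> = emeasure (chart_vol c) (fst c \<inter> X)"
    using is_volume_riemannian_volume c X o unfolding is_volume_def by auto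
  also have "\<dots> = emeasure (chart_vol c) X"
    using X o by (simp add: emeasure_chart_vol[OF c])
  finally show "emeasure (density (riemannian_volume A G) (\<lambda>p. ennreal (indicator (fst c) p))) X = emeasure (chart_vol c) X" .
qed simp

text \<open>F may be arbitrary off the chart image, where \<open>vol_dens c\<close> is 0.
  Integrability is stated as an equivalence because equality of Bochner integrals alone would not
  transfer it.\<close>

lemma chart_integral:
  assumes c: "c \<in> A" and F: "F \<in> borel_measurable borel"
    and f: "\<And>p. p \<in> fst c \<Longrightarrow> f p = F (snd c p)" "\<And>p. p \<notin> fst c \<Longrightarrow> f p = 0"
  shows "integrable (riemannian_volume A G) f \<longleftrightarrow> integrable lborel (\<lambda>x. vol_dens c x * F x)"
    and "(\<integral>p. f p \<partial>riemannian_volume A G) = (\<integral>x. vol_dens c x * F x \<partial>lborel)"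
proof -
  have o: "fst c \<in> sets borel" using open_chart[OF c] by simp
  have fm [measurable]: "f \<in> borel_measurable borel"
  proof -
    have "(\<lambda>p. indicator (fst c) p *\<^sub>R snd c p) \<in> borel_measurable borel"
      by (rule borel_measurable_continuous_on_indicator[OF o continuous_chart[OF c]])
    from measurable_compose[OF this F] have "(\<lambda>p. F (indicator (fst c) p *\<^sub>R snd c p)) \<in> borel_measurable borel" .
    then have "(\<lambda>p. indicator (fst c) p * F (indicator (fst c) p *\<^sub>R snd c p)) \<in> borel_measurable borel"
      using o by measurable
    also have "(\<lambda>p. indicator (fst c) p * F (indicator (fst c) p *\<^sub>R snd c p)) = f"
      using f by (auto simp: indicator_def fun_eq_iff)
    finally show ?thesis .
  qed
  have if': "indicator (fst c) p * f p = f p" for p using f(2)[of p] by (cases "p \<in> fst c") auto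
  have vd: "vol_dens c x *\<^sub>R f (chart_inv c x) = vol_dens c x * F x" for x
    using f(1)[OF chart_inv_in[OF c]] chart_chart_inv[OF c] by (cases "x \<in> img c") (auto simp: vol_dens_def)
  have nn: "AE x in lborel. 0 \<le> vol_dens c x" using vol_dens_nonneg[OF c] by simp
  have fm': "f \<in> borel_measurable (riemannian_volume A G)"
    and im: "(\<lambda>p. indicator (fst c) p :: real) \<in> borel_measurable (riemannian_volume A G)" using o by auto
  have cm: "chart_inv c \<in> measurable (density lborel (\<lambda>x. ennreal (vol_dens c x))) borel"
    by (rule chart_inv_measurable_density[OF c])
  have cfm: "(\<lambda>x. f (chart_inv c x)) \<in> borel_measurable lborel"
    using measurable_compose[OF chart_inv_measurable[OF c] fm] by simp
  have vm: "vol_dens c \<in> borel_measurable lborel" using vol_dens_measurable[OF c] by simp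
  have "integrable (riemannian_volume A G) f \<longleftrightarrow> integrable (chart_vol c) f"
    unfolding density_riemannian_volume[OF c, symmetric]
    by (subst integrable_density[OF fm' im]) (auto simp: if')
  also have "\<dots> \<longleftrightarrow> integrable lborel (\<lambda>x. vol_dens c x * F x)"
    unfolding chart_vol_def integrable_distr_eq[OF cm fm]
    by (subst integrable_density[OF cfm vm nn]) (simp only: vd)
  finally show "integrable (riemannian_volume A G) f \<longleftrightarrow> integrable lborel (\<lambda>x. vol_dens c x * F x)" .
  have "(\<integral>p. f p \<partial>riemannian_volume A G) = (\<integral>p. f p \<partial>chart_vol c)"
    unfolding density_riemannian_volume[OF c, symmetric]
    by (subst integral_density[OF fm' im]) (auto simp: if')
  also have "\<dots> = (\<integral>x. vol_dens c x * F x \<partial>lborel)"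
    unfolding chart_vol_def integral_distr[OF cm fm]
    by (subst integral_density[OF cfm vm nn]) (simp only: vd)
  finally show "(\<integral>p. f p \<partial>riemannian_volume A G) = (\<integral>x. vol_dens c x * F x \<partial>lborel)" .
qed

end

section \<open>Test functions and the pairing of differentials\<close>

lemma smooth_on_mult:
  fixes f g :: "'a::real_normed_vector \<Rightarrow> real"
  assumes "smooth_on S f" "smooth_on S g"
  shows "smooth_on S (\<lambda>x. f x * g x)"
  unfolding smooth_on_def
proof
  fix x assume x: "x \<in> S"
  obtain T F where T: "open T" "x \<in> T" "\<And>k. Ck_on k T F" "\<And>y. y \<in> S \<inter> T \<Longrightarrow> F y = f y"
    using smooth_onE[OF assms(1) x] by blast
  obtain T' F' where T': "open T'" "x \<in> T'" "\<And>k. Ck_on k T' F'" "\<And>y. y \<in> S \<inter> T' \<Longrightarrow> F' y = g y"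
    using smooth_onE[OF assms(2) x] by blast
  have "Ck_on k (T \<inter> T') (\<lambda>x. F x * F' x)" for k
    by (intro Ck_on_mult Ck_on_subset[OF T(3)] Ck_on_subset[OF T'(3)]) (use T T' in auto)
  then show "\<exists>T F. open T \<and> x \<in> T \<and> (\<forall>k. Ck_on k T F) \<and> (\<forall>y\<in>S \<inter> T. F y = f y * g y)"
    using T T' by (intro exI[of _ "T \<inter> T'"] exI[of _ "\<lambda>x. F x * F' x"]) auto
qed

lemma smooth_on_one_minus:
  fixes f :: "'a::real_normed_vector \<Rightarrow> real"
  assumes "smooth_on S f"
  shows "smooth_on S (\<lambda>x. 1 - f x)"
  unfolding smooth_on_def
proof
  fix x assume x: "x \<in> S"
  obtain T F where T: "open T" "x \<in> T" "\<And>k. Ck_on k T F" "\<And>y. y \<in> S \<inter> T \<Longrightarrow> F y = f y"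
    using smooth_onE[OF assms x] by blast
  have "Ck_on k T (\<lambda>x. 1 - F x)" for k by (intro Ck_on_diff T Ck_on_const)
  then show "\<exists>T F. open T \<and> x \<in> T \<and> (\<forall>k. Ck_on k T F) \<and> (\<forall>y\<in>S \<inter> T. F y = 1 - f y)"
    using T by (intro exI[of _ T] exI[of _ "\<lambda>x. 1 - F x"]) auto
qed

lemma compact_closure_support:
  fixes f :: "'a::t2_space \<Rightarrow> real"
  assumes "compact K" "\<And>p. p \<notin> K \<Longrightarrow> f p = 0"
  shows "closure {p. f p \<noteq> 0} \<subseteq> K" "compact (closure {p. f p \<noteq> 0})"
proof -
  show s: "closure {p. f p \<noteq> 0} \<subseteq> K"
    using assms by (intro closure_minimal compact_imp_closed) auto
  have "compact (K \<inter> closure {p. f p \<noteq> 0})" by (rule compact_Int_closed[OF assms(1) closed_closure])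
  moreover have "K \<inter> closure {p. f p \<noteq> 0} = closure {p. f p \<noteq> 0}" using s by blast
  ultimately show "compact (closure {p. f p \<noteq> 0})" by simp
qed

context riemannian_atlas
begin

lemma test_function_smooth: "test_function A S \<phi> \<Longrightarrow> c \<in> A \<Longrightarrow> smooth_on (img c) (\<phi> \<circ> chart_inv c)"
  by (simp add: test_function_def)

lemma test_function_differentiable:
  assumes "test_function A S \<phi>" "c \<in> A" "p \<in> fst c" "p \<in> int_mfd A"
  shows "(\<phi> \<circ> chart_inv c) differentiable (at (snd c p))"
proof -
  have "(\<phi> \<circ> chart_inv c) differentiable (at (snd c p) within img c)"
    by (rule smooth_on_differentiable[OF test_function_smooth[OF assms(1,2)]]) (use assms(3) in simp)
  moreover have "snd c p \<in> interior (img c)" using int_iff[OF assms(2,3)] assms(4) by simp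
  ultimately show ?thesis by (simp only: at_within_interior)
qed

lemma differential_interior:
  assumes "c \<in> A" "p \<in> fst c" "p \<in> int_mfd A"
  shows "differential \<phi> c p = grad (\<phi> \<circ> chart_inv c) (snd c p)"
proof -
  have "snd c p \<in> interior (img c)" using int_iff[OF assms(1,2)] assms(3) by simp
  then show ?thesis unfolding differential_def grad_def by (simp only: at_within_interior)
qed

text \<open>The point may lie on the boundary, where the derivative is taken within a relatively
  open part of the half-space. It is still unique there, because a small positive step along any
  basis vector remains in the half-space.\<close>

lemma differential_locally_zero:
  assumes c: "c \<in> A" "p \<in> fst c" and U: "open U" "p \<in> U" "\<And>q. q \<in> U \<Longrightarrow> \<phi> q = 0"
  shows "differential \<phi> c p = 0"
proof -
  let ?x = "snd c p" and ?f = "\<phi> \<circ> chart_inv c"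
  obtain T where T: "open T" "img c = half_space \<inter> T"
    using openin_img[OF c(1)] unfolding openin_open by blast
  obtain T' where T': "open T'" "img c \<inter> chart_inv c -` U = img c \<inter> T'"
    using continuous_openin_preimage_gen[OF continuous_chart_inv[OF c(1)] U(1)] unfolding openin_open by blast
  have x: "?x \<in> img c" "?x \<in> T'" using c U T' by (auto simp: chart_inv_chart)
  have d0: "(?f has_derivative (\<lambda>_. 0)) (at ?x within img c)"
  proof -
    obtain d where d: "0 < d" "ball ?x d \<subseteq> T'" using T'(1) x(2) open_contains_ball by blast
    have z: "?f y = 0" if "y \<in> img c" "y \<in> T'" for y using T'(2) U(3) that by auto
    show ?thesis
      by (rule has_derivative_transform_within[OF has_derivative_const[of 0] d(1) x(1)])
        (use z d(2) in \<open>auto simp: dist_commute subset_iff\<close>)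
  qed
  then have "?f differentiable (at ?x within img c)" by (auto simp: differentiable_def)
  then have d1: "(?f has_derivative frechet_derivative ?f (at ?x within img c)) (at ?x within img c)"
    by (simp add: frechet_derivative_works)
  have "frechet_derivative ?f (at ?x within img c) = (\<lambda>_. 0)"
  proof (rule frechet_derivative_unique_within[OF d1 d0])
    fix i :: "real^'n" and e :: real assume i: "i \<in> Basis" and e: "0 < e"
    obtain r where r: "0 < r" "ball ?x r \<subseteq> T" using T x(1) open_contains_ball by blast
    \<comment> \<open>A positive step, as a negative one along the boundary coordinate could leave
      the half-space.\<close>
    define d where "d = min e r / 2"
    have d: "0 < d" "d < e" "d < r" using e r by (auto simp: d_def)
    have "?x + d *\<^sub>R i \<in> ball ?x r" using i d by (simp add: dist_norm)
    moreover have "?x + d *\<^sub>R i \<in> half_space"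
    proof -
      have "0 \<le> ?x $ bdry_coord" using x(1) T(2) by (auto simp: half_space_def)
      moreover have "0 \<le> i $ bdry_coord" using i by (auto simp: Basis_vec_def axis_def)
      ultimately show ?thesis using d by (simp add: half_space_def)
    qed
    ultimately have "?x + d *\<^sub>R i \<in> img c" using T(2) r(2) by blast
    then show "\<exists>d. 0 < \<bar>d\<bar> \<and> \<bar>d\<bar> < e \<and> ?x + d *\<^sub>R i \<in> img c"
      using d by (intro exI[of _ d]) auto
  qed
  then show ?thesis by (simp add: differential_def vec_eq_iff)
qed

lemma grad_inner_locally_zero:
  assumes "open U" "p \<in> U" "\<And>q. q \<in> U \<Longrightarrow> \<phi> q = 0"
  shows "grad_inner A G \<omega> (differential \<phi>) p = 0"
proof -
  let ?c = "SOME c. c \<in> A \<and> p \<in> fst c"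
  have "?c \<in> A \<and> p \<in> fst ?c" by (rule someI_ex) (use chart_cover in blast)
  then have "differential \<phi> ?c p = 0" using differential_locally_zero[of ?c p U \<phi>] assms by blast
  then show ?thesis by (simp add: grad_inner_def Let_def)
qed

lemma jacobian_det_nonzero:
  assumes "c \<in> A" "c' \<in> A" "p \<in> fst c" "p \<in> fst c'"
  shows "det (jacobian c c' p) \<noteq> 0"
  using det_metric_transform[OF assms] det_metric_pos[of c p] assms by auto

text \<open>Let y be the vector dual to b with respect to G c p. The transformation laws of the
  metric and of b show that the image of y under the Jacobian is dual to b' with respect to G c' p;
  pairing with a then agrees with pairing that image with a'.\<close>

lemma covector_pairing_invariant:
  assumes c: "c \<in> A" "c' \<in> A" "p \<in> fst c" "p \<in> fst c'"
    and a: "a = transpose (jacobian c c' p) *v a'" and b: "b = transpose (jacobian c c' p) *v b'"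
  shows "a \<bullet> (matrix_inv (G c p) *v b) = a' \<bullet> (matrix_inv (G c' p) *v b')"
proof -
  let ?J = "jacobian c c' p" and ?y = "matrix_inv (G c p) *v b"
  have n: "det (G c p) \<noteq> 0" "det (G c' p) \<noteq> 0" "det (transpose ?J) \<noteq> 0"
    using det_metric_pos[of c p] det_metric_pos[of c' p] jacobian_det_nonzero[OF c] c by (auto simp: det_transpose)
  have "G c p *v ?y = b" by (simp add: matrix_vector_mul_assoc matrix_inv_mult[OF n(1)])
  then have "transpose ?J *v (G c' p *v (?J *v ?y)) = transpose ?J *v b'"
    using b by (simp add: metric_transform[OF c] matrix_vector_mul_assoc matrix_mul_assoc)
  then have "matrix_inv (transpose ?J) *v (transpose ?J *v (G c' p *v (?J *v ?y)))
      = matrix_inv (transpose ?J) *v (transpose ?J *v b')" by simp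
  then have "G c' p *v (?J *v ?y) = b'"
    unfolding matrix_vector_mul_assoc[of "matrix_inv (transpose ?J)"] matrix_inv_mult[OF n(3)] by simp
  then have "matrix_inv (G c' p) *v (G c' p *v (?J *v ?y)) = matrix_inv (G c' p) *v b'" by simp
  then have "?J *v ?y = matrix_inv (G c' p) *v b'"
    unfolding matrix_vector_mul_assoc[of "matrix_inv (G c' p)"] matrix_inv_mult[OF n(2)] by simp
  moreover have "a \<bullet> ?y = a' \<bullet> (?J *v ?y)"
    unfolding a transpose_matrix_vector by (rule dot_lmul_matrix)
  ultimately show ?thesis by simp
qed

text \<open>At an interior point the one-sided derivative of the transition map is a full derivative
  on the open set \<open>?U\<close>, and the ordinary chain rule applies.\<close>

lemma differential_transform:
  assumes c: "c \<in> A" "c' \<in> A" "p \<in> fst c" "p \<in> fst c'" "p \<in> int_mfd A"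
    and \<phi>: "(\<phi> \<circ> chart_inv c') differentiable (at (snd c' p))"
  shows "differential \<phi> c p = transpose (jacobian c c' p) *v differential \<phi> c' p"
proof -
  let ?J = "jacobian c c' p" and ?x = "snd c p"
  let ?D = "frechet_derivative (\<phi> \<circ> chart_inv c') (at (snd c' p))"
  have x: "?x \<in> interior (img c)" using int_iff[of c p] c by simp
  let ?U = "interior (img c) \<inter> chart_inv c -` fst c'"
  have U: "open ?U"
    using continuous_on_subset[OF continuous_chart_inv[OF c(1)] interior_subset] open_chart[OF c(2)]
    by (rule continuous_open_preimage[OF _ open_interior])
  have xU: "?x \<in> ?U" using x c by (simp add: chart_inv_chart)
  have sub: "?U \<subseteq> snd c ` (fst c \<inter> fst c')"
    unfolding chart_image_eq[OF c(1)] using interior_subset by blast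
  have "((snd c' \<circ> chart_inv c) has_derivative (\<lambda>v. ?J *v v)) (at ?x within ?U)"
    by (rule has_derivative_subset[OF transition_has_derivative sub]) (use c in auto)
  then have t: "((snd c' \<circ> chart_inv c) has_derivative (\<lambda>v. ?J *v v)) (at ?x)"
    using at_within_open[OF xU U] by simp
  have "((\<phi> \<circ> chart_inv c') has_derivative ?D) (at ((snd c' \<circ> chart_inv c) ?x))"
    using \<phi> c by (simp add: frechet_derivative_works chart_inv_chart)
  from has_derivative_compose[OF t this]
  have "((\<lambda>x. (\<phi> \<circ> chart_inv c') ((snd c' \<circ> chart_inv c) x)) has_derivative (\<lambda>v. ?D (?J *v v))) (at ?x)" .
  then have "((\<phi> \<circ> chart_inv c) has_derivative (\<lambda>v. ?D (?J *v v))) (at ?x)"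
    by (rule has_derivative_transform_within_open[OF _ U xU]) (use c in \<open>auto simp: chart_inv_chart\<close>)
  then have e: "frechet_derivative (\<phi> \<circ> chart_inv c) (at ?x) = (\<lambda>v. ?D (?J *v v))"
    by (rule frechet_derivative_eq)
  have lin: "linear ?D" using \<phi> by (rule linear_frechet_derivative)
  have "?D v = grad (\<phi> \<circ> chart_inv c') (snd c' p) \<bullet> v" for v
  proof -
    have "v = (\<Sum>i\<in>UNIV. v $ i *\<^sub>R axis i 1)"
      by (simp add: vec_eq_iff axis_def if_distrib[of "\<lambda>x. _ * x"] cong: if_cong)
    then have "?D v = ?D (\<Sum>i\<in>UNIV. v $ i *\<^sub>R axis i 1)" by simp
    also have "\<dots> = (\<Sum>i\<in>UNIV. v $ i * ?D (axis i 1))"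
      by (simp add: linear_sum[OF lin] linear_cmul[OF lin])
    finally show ?thesis by (simp add: grad_def inner_vec_def mult.commute)
  qed
  moreover have "(?J *v axis i 1) $ k = ?J $ k $ i" for i k
    by (simp add: matrix_vector_mult_basis column_def)
  ultimately have "frechet_derivative (\<phi> \<circ> chart_inv c) (at ?x) (axis i 1)
      = (\<Sum>k\<in>UNIV. grad (\<phi> \<circ> chart_inv c') (snd c' p) $ k * ?J $ k $ i)" for i
    unfolding e by (simp add: inner_vec_def)
  then have "grad (\<phi> \<circ> chart_inv c) ?x = transpose ?J *v grad (\<phi> \<circ> chart_inv c') (snd c' p)"
    by (simp add: vec_eq_iff grad_def[of "\<phi> \<circ> chart_inv c"] matrix_vector_mult_def transpose_def mult.commute)
  then show ?thesis using c by (simp add: differential_interior)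
qed

text \<open>\<open>grad_inner\<close> evaluates in a chart picked by choice. As both factors
  transform as covectors at p, that chart may be exchanged for a prescribed one.\<close>

lemma grad_inner_eq:
  assumes c: "c \<in> A" "p \<in> fst c" "p \<in> int_mfd A" and \<omega>: "covector_field A \<omega>"
    and \<phi>: "(\<phi> \<circ> chart_inv c) differentiable (at (snd c p))"
  shows "grad_inner A G \<omega> (differential \<phi>) p
    = \<omega> c p \<bullet> (matrix_inv (G c p) *v grad (\<phi> \<circ> chart_inv c) (snd c p))"
proof -
  define c' where "c' = (SOME c. c \<in> A \<and> p \<in> fst c)"
  have c': "c' \<in> A \<and> p \<in> fst c'" unfolding c'_def by (rule someI_ex) (use chart_cover in blast)
  have "\<omega> c' p = transpose (jacobian c' c p) *v \<omega> c p"
    using \<omega> c c' unfolding covector_field_def by blast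
  moreover have "differential \<phi> c' p = transpose (jacobian c' c p) *v differential \<phi> c p"
    by (rule differential_transform) (use c c' \<phi> in auto)
  ultimately have "\<omega> c' p \<bullet> (matrix_inv (G c' p) *v differential \<phi> c' p)
      = \<omega> c p \<bullet> (matrix_inv (G c p) *v differential \<phi> c p)"
    by (intro covector_pairing_invariant) (use c c' in auto)
  then show ?thesis
    using c by (simp add: grad_inner_def Let_def c'_def[symmetric] differential_interior)
qed

section \<open>Transport of test functions from a chart to the manifold\<close>

definition pullback :: "('m, 'n) chart \<Rightarrow> (real^'n \<Rightarrow> real) \<Rightarrow> 'm \<Rightarrow> real" where
  "pullback c \<psi> p = (if p \<in> fst c then \<psi> (snd c p) else 0)"

lemma pullback_support:
  assumes c: "c \<in> A" and K: "compact K" "K \<subseteq> interior (img c)" "\<And>x. x \<notin> K \<Longrightarrow> \<psi> x = 0"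
  shows "compact (chart_inv c ` K)" "chart_inv c ` K \<subseteq> fst c \<inter> int_mfd A"
    "\<And>p. p \<notin> chart_inv c ` K \<Longrightarrow> pullback c \<psi> p = 0"
proof -
  have Ki: "K \<subseteq> img c" using K(2) interior_subset by blast
  show "compact (chart_inv c ` K)"
    by (intro compact_continuous_image continuous_on_subset[OF continuous_chart_inv[OF c] Ki] K(1))
  show "chart_inv c ` K \<subseteq> fst c \<inter> int_mfd A"
    using K(2) Ki int_iff[OF c] chart_inv_in[OF c] chart_chart_inv[OF c] by (auto simp: subset_iff)
  show "pullback c \<psi> p = 0" if "p \<notin> chart_inv c ` K" for p
    using that K(3) chart_inv_chart[OF c] unfolding pullback_def by (metis imageI)
qed

text \<open>Extension by 0 is smooth because the support is compact, hence closed in the Hausdorff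
  space M: where a point is in the domain of c the transition map gives the smooth extension, and
  any other point has a neighbourhood missing the support.\<close>

lemma test_function_pullback:
  assumes c: "c \<in> A" and \<psi>: "test_fun (interior (img c)) \<psi>"
  shows "test_function A (int_mfd A) (pullback c \<psi>)"
    "closure {p. pullback c \<psi> p \<noteq> 0} \<subseteq> fst c \<inter> int_mfd A"
proof -
  obtain K where K: "smooth \<psi>" "compact K" "K \<subseteq> interior (img c)" "\<And>x. x \<notin> K \<Longrightarrow> \<psi> x = 0"
    by (rule test_funD[OF \<psi>]) blast
  have ps3: "pullback c \<psi> p = 0" if "p \<notin> chart_inv c ` K" for p
    by (rule pullback_support(3)[OF c K(2,3) K(4) that])
  have ps: "compact (chart_inv c ` K)" "chart_inv c ` K \<subseteq> fst c \<inter> int_mfd A"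
    by (rule pullback_support(1)[OF c K(2,3) K(4)], assumption,
        rule pullback_support(2)[OF c K(2,3) K(4)], assumption)
  have cs: "closure {p. pullback c \<psi> p \<noteq> 0} \<subseteq> chart_inv c ` K" "compact (closure {p. pullback c \<psi> p \<noteq> 0})"
    by (rule compact_closure_support(1)[OF ps(1) ps3], assumption,
        rule compact_closure_support(2)[OF ps(1) ps3], assumption)
  show cl: "closure {p. pullback c \<psi> p \<noteq> 0} \<subseteq> fst c \<inter> int_mfd A" using cs(1) ps(2) by blast
  have "smooth_on (img c') (pullback c \<psi> \<circ> chart_inv c')" if c': "c' \<in> A" for c'
    unfolding smooth_on_def
  proof
    fix x assume x: "x \<in> img c'"
    have pre: "\<exists>T'. open T' \<and> img c' \<inter> chart_inv c' -` U = img c' \<inter> T'" if "open U" for U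
      using continuous_openin_preimage_gen[OF continuous_chart_inv[OF c'] that] unfolding openin_open by blast
    show "\<exists>T F. open T \<and> x \<in> T \<and> (\<forall>k. Ck_on k T F) \<and> (\<forall>y\<in>img c' \<inter> T. F y = (pullback c \<psi> \<circ> chart_inv c') y)"
    proof (cases "chart_inv c' x \<in> fst c")
      case True
      obtain T' where T': "open T'" "img c' \<inter> chart_inv c' -` fst c = img c' \<inter> T'"
        using pre[OF open_chart[OF c]] by blast
      have S: "snd c' ` (fst c' \<inter> fst c) = img c' \<inter> T'"
        unfolding chart_image_eq[OF c'] using T'(2) by blast
      have "smooth_on (snd c' ` (fst c' \<inter> fst c)) (snd c \<circ> chart_inv c')"
        using atlas c c' unfolding smooth_atlas_def by blast
      moreover have "x \<in> snd c' ` (fst c' \<inter> fst c)" unfolding chart_image_eq[OF c'] using x True by blast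
      ultimately obtain T F where T: "open T" "x \<in> T" "\<And>k. Ck_on k T F"
        "\<And>y. y \<in> (snd c' ` (fst c' \<inter> fst c)) \<inter> T \<Longrightarrow> F y = (snd c \<circ> chart_inv c') y"
        by (rule smooth_onE) blast
      have "Ck_on k (T \<inter> T') (\<lambda>y. \<psi> (F y))" for k
        by (rule Ck_on_compose[OF _ open_UNIV Ck_on_subset[OF T(3)]]) (use K(1) T T' in \<open>auto simp: smooth_def\<close>)
      moreover have "\<psi> (F y) = (pullback c \<psi> \<circ> chart_inv c') y" if "y \<in> img c' \<inter> (T \<inter> T')" for y
      proof -
        have y: "y \<in> img c' \<inter> T'" using that by blast
        then have "chart_inv c' y \<in> fst c" using T'(2) by blast
        moreover have "F y = snd c (chart_inv c' y)" using T(4)[of y] y that unfolding S by simp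
        ultimately show ?thesis by (simp add: pullback_def)
      qed
      moreover have "x \<in> T'" using x True T'(2) by blast
      ultimately show ?thesis using T(1,2) T'(1)
        by (intro exI[of _ "T \<inter> T'"] exI[of _ "\<lambda>y. \<psi> (F y)"]) auto
    next
      case False
      then have n: "chart_inv c' x \<notin> chart_inv c ` K" using ps(2) by blast
      have "open (- (chart_inv c ` K))" using ps(1) compact_imp_closed open_Compl by blast
      from pre[OF this] obtain T' where T': "open T'" "img c' \<inter> chart_inv c' -` (- (chart_inv c ` K)) = img c' \<inter> T'"
        by blast
      have "x \<in> T'" using x n T'(2) by blast
      moreover have "(pullback c \<psi> \<circ> chart_inv c') y = 0" if "y \<in> img c' \<inter> T'" for y
      proof -
        have "chart_inv c' y \<notin> chart_inv c ` K" using that T'(2) by blast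
        then show ?thesis using ps3 by simp
      qed
      ultimately show ?thesis using T'(1)
        by (intro exI[of _ T'] exI[of _ "\<lambda>_. 0"]) auto
    qed
  qed
  then show "test_function A (int_mfd A) (pullback c \<psi>)"
    using cs(2) cl unfolding test_function_def by blast
qed

section \<open>The maximum of a subsolution and a constant on the manifold\<close>

text \<open>The coefficient matrix of the Laplace-Beltrami operator in divergence form: the square
  root of det g times the inverse metric.\<close>

definition flux_matrix :: "('m, 'n) chart \<Rightarrow> real^'n \<Rightarrow> real^'n^'n" where
  "flux_matrix c x = vol_dens c x *\<^sub>R matrix_inv (G c (chart_inv c x))"

lemma vol_dens_pos: "c \<in> A \<Longrightarrow> x \<in> img c \<Longrightarrow> 0 < vol_dens c x"
  using det_metric_pos[of c "chart_inv c x"] chart_inv_in[of c x] by (simp add: vol_dens_def)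

lemma continuous_flux_matrix: "c \<in> A \<Longrightarrow> continuous_on (interior (img c)) (flux_matrix c)"
proof -
  assume c: "c \<in> A"
  have 1: "continuous_on (img c) (\<lambda>x. sqrt (det (G c (chart_inv c x))))"
    by (intro continuous_intros continuous_on_det continuous_metric c)
  have 2: "continuous_on (img c) (\<lambda>x. matrix_inv (G c (chart_inv c x)))"
  proof (rule continuous_on_matrix_inv[OF continuous_metric[OF c]])
    show "det (G c (chart_inv c x)) \<noteq> 0" if "x \<in> img c" for x
      using det_metric_pos[OF c chart_inv_in[OF c that]] by simp
  qed
  have "continuous_on (img c) (\<lambda>x. sqrt (det (G c (chart_inv c x))) *\<^sub>R matrix_inv (G c (chart_inv c x)))"
    by (rule continuous_on_scaleR[OF 1 2])
  then have "continuous_on (img c) (flux_matrix c)"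
    by (rule continuous_on_eq) (simp add: flux_matrix_def vol_dens_def)
  then show ?thesis by (rule continuous_on_subset[OF _ interior_subset])
qed

text \<open>Writing v = G y turns the inverse form at v into the metric at y.\<close>

lemma flux_matrix_nonneg:
  assumes c: "c \<in> A" and x: "x \<in> interior (img c)"
  shows "0 \<le> v \<bullet> (flux_matrix c x *v v)"
proof -
  have x': "x \<in> img c" using x interior_subset by blast
  let ?p = "chart_inv c x" and ?y = "matrix_inv (G c (chart_inv c x)) *v v"
  have p: "?p \<in> fst c" by (rule chart_inv_in[OF c x'])
  have "det (G c ?p) \<noteq> 0" using det_metric_pos[OF c p] by simp
  then have v: "v = G c ?p *v ?y" by (simp add: matrix_vector_mul_assoc matrix_inv_mult)
  have "0 \<le> ?y \<bullet> (G c ?p *v ?y)"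
    using metric_pos[OF c p, of ?y] by (cases "?y = 0") auto
  then have "0 \<le> v \<bullet> ?y" unfolding v[symmetric] by (simp only: inner_commute)
  then show ?thesis
    using vol_dens_nonneg[OF c, of x]
    by (simp add: flux_matrix_def scaleR_matrix_vector_assoc[symmetric])
qed

text \<open>P is either constantly true, for the flux of u, or the condition s < u, for the flux of
  the truncation.\<close>

lemma flux_integral:
  fixes P :: "real^'n \<Rightarrow> bool" and \<psi> :: "real^'n \<Rightarrow> real" and \<omega> :: "('m, 'n) chart \<Rightarrow> 'm \<Rightarrow> real^'n"
    and f :: "'m \<Rightarrow> real"
  assumes c: "c \<in> A"
    and \<Phi>: "integrable lborel (\<lambda>x. if P x then \<omega> c (chart_inv c x) \<bullet> (flux_matrix c x *v grad \<psi> x) else 0)"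
    and f: "\<And>p. p \<in> fst c \<Longrightarrow> f p = (if P (snd c p) then \<omega> c p \<bullet> (matrix_inv (G c p) *v grad \<psi> (snd c p)) else 0)"
      "\<And>p. p \<notin> fst c \<Longrightarrow> f p = 0"
  shows "integrable (riemannian_volume A G) f"
    "(\<integral>p. f p \<partial>riemannian_volume A G)
      = (\<integral>x. (if P x then \<omega> c (chart_inv c x) \<bullet> (flux_matrix c x *v grad \<psi> x) else 0) \<partial>lborel)"
proof -
  let ?\<Phi> = "\<lambda>x. if P x then \<omega> c (chart_inv c x) \<bullet> (flux_matrix c x *v grad \<psi> x) else 0"
  \<comment> \<open>Dividing by the density recovers the integrand on M, and measurability comes
    with the integrability of the product. Off the chart image the density and the flux matrix are
    both 0, so multiplying back is correct everywhere.\<close>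
  let ?F = "\<lambda>x. ?\<Phi> x / vol_dens c x"
  have m: "?F \<in> borel_measurable borel"
    using borel_measurable_integrable[OF \<Phi>] vol_dens_measurable[OF c] by (intro borel_measurable_divide) simp_all
  have fF: "f p = ?F (snd c p)" if p: "p \<in> fst c" for p
  proof -
    have "snd c p \<in> img c" using p by blast
    then have "vol_dens c (snd c p) \<noteq> 0" using vol_dens_pos[OF c] by fastforce
    then show ?thesis
      using p f(1)[OF p] by (simp add: flux_matrix_def chart_inv_chart[OF c] scaleR_matrix_vector_assoc[symmetric])
  qed
  have eq: "vol_dens c x * ?F x = ?\<Phi> x" for x
    by (cases "vol_dens c x = 0") (auto simp: flux_matrix_def)
  have "integrable (riemannian_volume A G) f \<longleftrightarrow> integrable lborel (\<lambda>x. vol_dens c x * ?F x)"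
  proof (rule chart_integral(1)[OF c m])
    show "f p = ?F (snd c p)" if "p \<in> fst c" for p by (rule fF[OF that])
    show "f p = 0" if "p \<notin> fst c" for p by (rule f(2)[OF that])
  qed
  then show "integrable (riemannian_volume A G) f" using \<Phi> by (simp only: eq)
  have "(\<integral>p. f p \<partial>riemannian_volume A G) = (\<integral>x. vol_dens c x * ?F x \<partial>lborel)"
  proof (rule chart_integral(2)[OF c m])
    show "f p = ?F (snd c p)" if "p \<in> fst c" for p by (rule fF[OF that])
    show "f p = 0" if "p \<notin> fst c" for p by (rule f(2)[OF that])
  qed
  then show "(\<integral>p. f p \<partial>riemannian_volume A G) = (\<integral>x. ?\<Phi> x \<partial>lborel)" by (simp only: eq)
qed

lemma weak_differential_chart:
  assumes c: "c \<in> A" and wd: "weak_differential A (int_mfd A) u \<omega>"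
  shows "L2_loc (interior (img c)) (\<omega> c \<circ> chart_inv c)"
    "weak_gradient_on (interior (img c)) (u \<circ> chart_inv c) (\<omega> c \<circ> chart_inv c)"
proof -
  have "L2_loc (snd c ` (fst c \<inter> int_mfd A)) (\<omega> c \<circ> chart_inv c) \<and>
    weak_gradient_on (interior (snd c ` (fst c \<inter> int_mfd A))) (u \<circ> chart_inv c) (\<omega> c \<circ> chart_inv c)"
    using wd c unfolding weak_differential_def by blast
  then show "L2_loc (interior (img c)) (\<omega> c \<circ> chart_inv c)"
    "weak_gradient_on (interior (img c)) (u \<circ> chart_inv c) (\<omega> c \<circ> chart_inv c)"
    unfolding img_int[OF c] interior_interior by auto
qed

lemma grad_inner_outside_support:
  fixes \<phi> :: "'m \<Rightarrow> real"
  assumes "p \<notin> closure {p. \<phi> p \<noteq> 0}"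
  shows "grad_inner A G \<omega> (differential \<phi>) p = 0"
proof (rule grad_inner_locally_zero)
  show "open (- closure {p. \<phi> p \<noteq> 0})" by (simp add: open_Compl)
  show "p \<in> - closure {p. \<phi> p \<noteq> 0}" using assms by simp
  fix q assume "q \<in> - closure {p. \<phi> p \<noteq> 0}"
  then have "q \<notin> {p. \<phi> p \<noteq> 0}" using contra_subsetD[OF closure_subset] by blast
  then show "\<phi> q = 0" by simp
qed

text \<open>Testing with the pullback of \<psi> turns the inequality on M into a divergence form
  inequality on an open subset of R^n, the setting of \<open>max_subsolution\<close>.\<close>

lemma subsolution_in_chart:
  assumes c: "c \<in> A" and wd: "weak_differential A (int_mfd A) u \<omega>"
    and sub: "\<And>\<phi>. test_function A (int_mfd A) \<phi> \<Longrightarrow> (\<And>p. 0 \<le> \<phi> p) \<Longrightarrow>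
      (\<integral>p. grad_inner A G \<omega> (differential \<phi>) p \<partial>riemannian_volume A G) \<le> 0"
    and \<psi>: "test_fun (interior (img c)) \<psi>" "\<And>x. 0 \<le> \<psi> x"
  shows "(\<integral>x. (\<omega> c \<circ> chart_inv c) x \<bullet> (flux_matrix c x *v grad \<psi> x) \<partial>lborel) \<le> 0"
proof -
  let ?\<phi> = "pullback c \<psi>"
  have cov: "covector_field A \<omega>" using wd unfolding weak_differential_def by blast
  note tp = test_function_pullback[OF c \<psi>(1)]
  obtain K where K: "smooth \<psi>" "compact K" "K \<subseteq> interior (img c)" "\<And>x. x \<notin> K \<Longrightarrow> \<psi> x = 0"
    "\<And>x. x \<notin> K \<Longrightarrow> grad \<psi> x = 0"
    by (rule test_funD[OF \<psi>(1)]) blast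
  have nn: "0 \<le> ?\<phi> p" for p using \<psi>(2) by (simp add: pullback_def)
  have "integrable lborel (\<lambda>x. (\<omega> c \<circ> chart_inv c) x \<bullet> (flux_matrix c x *v grad \<psi> x))"
    by (rule integrable_flux[OF open_interior weak_differential_chart(1)[OF c wd] continuous_flux_matrix[OF c] \<psi>(1)])
  then have int: "integrable lborel (\<lambda>x. if True then \<omega> c (chart_inv c x) \<bullet> (flux_matrix c x *v grad \<psi> x) else 0)"
    by (simp add: o_def)
  have f1: "grad_inner A G \<omega> (differential ?\<phi>) p = (if True then \<omega> c p \<bullet> (matrix_inv (G c p) *v grad \<psi> (snd c p)) else 0)"
    if p: "p \<in> fst c" for p
  proof (cases "p \<in> int_mfd A")
    case True
    have x: "snd c p \<in> interior (img c)" using int_iff[OF c p] True by simp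
    have pb: "\<psi> y = (?\<phi> \<circ> chart_inv c) y" if "y \<in> interior (img c)" for y
    proof -
      have "y \<in> img c" using that interior_subset by blast
      then show ?thesis using chart_inv_in[OF c] chart_chart_inv[OF c] by (simp add: pullback_def)
    qed
    have d: "((?\<phi> \<circ> chart_inv c) has_derivative frechet_derivative \<psi> (at (snd c p))) (at (snd c p))"
      by (rule has_derivative_transform_within_open[OF smooth_has_derivative[OF K(1)] open_interior x pb])
    then have "grad (?\<phi> \<circ> chart_inv c) (snd c p) = grad \<psi> (snd c p)"
      by (simp add: grad_def frechet_derivative_eq)
    moreover have "(?\<phi> \<circ> chart_inv c) differentiable (at (snd c p))" using d by (auto simp: differentiable_def)
    ultimately show ?thesis using grad_inner_eq[OF c p True cov, of ?\<phi>] by simp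
  next
    case False
    \<comment> \<open>Boundary points of the chart domain lie off the support, so both sides vanish
      and the interior formula for the pairing is not invoked there.\<close>
    then have "p \<notin> closure {p. ?\<phi> p \<noteq> 0}" using tp(2) by blast
    then have "grad_inner A G \<omega> (differential ?\<phi>) p = 0" by (rule grad_inner_outside_support)
    moreover have "snd c p \<notin> K" using False int_iff[OF c p] K(3) by blast
    ultimately show ?thesis using K(5) by simp
  qed
  have f2: "grad_inner A G \<omega> (differential ?\<phi>) p = 0" if "p \<notin> fst c" for p
    by (rule grad_inner_outside_support) (use that tp(2) in blast)
  have "(\<integral>p. grad_inner A G \<omega> (differential ?\<phi>) p \<partial>riemannian_volume A G)
     = (\<integral>x. (if True then \<omega> c (chart_inv c x) \<bullet> (flux_matrix c x *v grad \<psi> x) else 0) \<partial>lborel)"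
    by (rule flux_integral(2)[where f="\<lambda>p. grad_inner A G \<omega> (differential ?\<phi>) p" and P="\<lambda>_. True" and \<omega>=\<omega> and \<psi>=\<psi>, OF c int])
      (erule f1, erule f2)
  with sub[OF tp(1) nn] show ?thesis by (simp add: o_def)
qed

text \<open>The truncated inequality is obtained in the chart and carried back to M. The class of
  \<phi> is that of test functions on all of M, with the interior support as a separate condition,
  because the pieces cut from a global test function come in this form.\<close>

lemma local_max_subsolution:
  assumes c: "c \<in> A" and wd: "weak_differential A (int_mfd A) u \<omega>" and u: "continuous_on UNIV u"
    and sub: "\<And>\<phi>. test_function A (int_mfd A) \<phi> \<Longrightarrow> (\<And>p. 0 \<le> \<phi> p) \<Longrightarrow>
      (\<integral>p. grad_inner A G \<omega> (differential \<phi>) p \<partial>riemannian_volume A G) \<le> 0"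
    and \<phi>: "test_function A UNIV \<phi>" "\<And>p. 0 \<le> \<phi> p" "closure {p. \<phi> p \<noteq> 0} \<subseteq> fst c \<inter> int_mfd A"
  shows "integrable (riemannian_volume A G) (\<lambda>p. if s < u p then grad_inner A G \<omega> (differential \<phi>) p else 0)"
    and "(\<integral>p. (if s < u p then grad_inner A G \<omega> (differential \<phi>) p else 0) \<partial>riemannian_volume A G) \<le> 0"
proof -
  let ?V = "interior (img c)"
  define L where "L = closure {p. \<phi> p \<noteq> 0}"
  have L: "compact L" "L \<subseteq> fst c \<inter> int_mfd A" using \<phi> unfolding test_function_def L_def by auto
  have L0: "\<phi> p = 0" if "p \<notin> L" for p
  proof -
    have "p \<notin> {p. \<phi> p \<noteq> 0}" using that unfolding L_def by (rule contra_subsetD[OF closure_subset])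
    then show ?thesis by simp
  qed
  define K where "K = snd c ` L"
  have K: "compact K" "K \<subseteq> ?V"
  proof -
    show "compact K" unfolding K_def
      using L by (intro compact_continuous_image continuous_on_subset[OF continuous_chart[OF c]]) auto
    show "K \<subseteq> ?V" unfolding K_def using L(2) int_iff[OF c] by blast
  qed
  \<comment> \<open>Smooth on the whole space: inside the interior of the image it agrees with a
    local smooth extension of \<phi> in the chart, and off K it is 0; the two open sets cover
    everything.\<close>
  define \<psi> where "\<psi> = (\<lambda>x. if x \<in> ?V then \<phi> (chart_inv c x) else 0)"
  have \<psi>0: "\<psi> x = 0" if "x \<notin> K" for x
  proof (cases "x \<in> ?V")
    case True
    then have x: "x \<in> img c" using interior_subset by blast
    have "chart_inv c x \<notin> L" using that chart_chart_inv[OF c x] unfolding K_def by (metis imageI)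
    then show ?thesis using L0 by (simp add: \<psi>_def)
  qed (simp add: \<psi>_def)
  have \<psi>n: "0 \<le> \<psi> x" for x using \<phi>(2) by (simp add: \<psi>_def)
  have "Ck_on k UNIV \<psi>" for k
  proof (rule Ck_on_local)
    fix x :: "real^'n"
    show "\<exists>U. open U \<and> x \<in> U \<and> Ck_on k U \<psi>"
    proof (cases "x \<in> ?V")
      case True
      then have x: "x \<in> img c" using interior_subset by blast
      obtain T F where T: "open T" "x \<in> T" "\<And>k. Ck_on k T F" "\<And>y. y \<in> img c \<inter> T \<Longrightarrow> F y = (\<phi> \<circ> chart_inv c) y"
        by (rule smooth_onE[OF test_function_smooth[OF \<phi>(1) c] x]) blast
      have F\<psi>: "F y = \<psi> y" if "y \<in> T \<inter> ?V" for y
      proof -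
        have "y \<in> img c \<inter> T" using that interior_subset by blast
        then show ?thesis using T(4) that by (simp add: \<psi>_def)
      qed
      have "Ck_on k (T \<inter> ?V) \<psi>"
      proof (rule Ck_on_cong)
        show "Ck_on k (T \<inter> ?V) F" by (rule Ck_on_subset[OF T(3)]) blast
        show "open (T \<inter> ?V)" using T(1) by blast
        show "F y = \<psi> y" if "y \<in> T \<inter> ?V" for y by (rule F\<psi>[OF that])
      qed
      then show ?thesis using True T(1,2) by (intro exI[of _ "T \<inter> ?V"]) auto
    next
      case False
      then have "x \<in> - K" using K(2) by blast
      moreover have o: "open (- K)" using K(1) compact_imp_closed open_Compl by blast
      moreover have "Ck_on k (- K) \<psi>"
      proof (rule Ck_on_cong[OF Ck_on_const[of k "- K" 0] o])
        show "0 = \<psi> y" if "y \<in> - K" for y using \<psi>0[of y] that by simp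
      qed
      ultimately show ?thesis by blast
    qed
  qed
  then have \<psi>s: "smooth \<psi>" by (simp add: smooth_def)
  have \<psi>t: "test_fun ?V \<psi>" by (rule test_funI[OF \<psi>s K]) (rule \<psi>0)
  have cov: "covector_field A \<omega>" using wd unfolding weak_differential_def by blast
  have uc: "continuous_on ?V (u \<circ> chart_inv c)"
    unfolding o_def by (rule continuous_on_compose2[OF u continuous_on_subset[OF continuous_chart_inv[OF c] interior_subset]]) simp
  note wc = weak_differential_chart[OF c wd]
  have sub': "(\<integral>x. (\<omega> c \<circ> chart_inv c) x \<bullet> (flux_matrix c x *v grad \<psi> x) \<partial>lborel) \<le> 0"
    if "test_fun ?V \<psi>" "\<And>x. 0 \<le> \<psi> x" for \<psi>
    by (rule subsolution_in_chart[OF c wd sub that])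
  have ms: "integrable lborel (\<lambda>x. if s < (u \<circ> chart_inv c) x then (\<omega> c \<circ> chart_inv c) x \<bullet> (flux_matrix c x *v grad \<psi> x) else 0)"
    "(\<integral>x. (if s < (u \<circ> chart_inv c) x then (\<omega> c \<circ> chart_inv c) x \<bullet> (flux_matrix c x *v grad \<psi> x) else 0) \<partial>lborel) \<le> 0"
    by (rule max_subsolution[OF open_interior uc wc continuous_flux_matrix[OF c]];
        (rule flux_matrix_nonneg[OF c] sub' \<psi>t \<psi>n; assumption?)+)+
  have int: "integrable lborel (\<lambda>x. if s < u (chart_inv c x) then \<omega> c (chart_inv c x) \<bullet> (flux_matrix c x *v grad \<psi> x) else 0)"
    using ms(1) unfolding comp_def .
  have f1: "(if s < u p then grad_inner A G \<omega> (differential \<phi>) p else 0)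
      = (if s < u (chart_inv c (snd c p)) then \<omega> c p \<bullet> (matrix_inv (G c p) *v grad \<psi> (snd c p)) else 0)"
    if p: "p \<in> fst c" for p
  proof (cases "p \<in> int_mfd A")
    case True
    have x: "snd c p \<in> ?V" using int_iff[OF c p] True by simp
    have pb: "\<psi> y = (\<phi> \<circ> chart_inv c) y" if "y \<in> ?V" for y using that by (simp add: \<psi>_def)
    have d: "((\<phi> \<circ> chart_inv c) has_derivative frechet_derivative \<psi> (at (snd c p))) (at (snd c p))"
      by (rule has_derivative_transform_within_open[OF smooth_has_derivative[OF \<psi>s] open_interior x pb])
    then have "grad (\<phi> \<circ> chart_inv c) (snd c p) = grad \<psi> (snd c p)"
      by (simp add: grad_def frechet_derivative_eq)
    moreover have "(\<phi> \<circ> chart_inv c) differentiable (at (snd c p))" using d by (auto simp: differentiable_def)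
    ultimately show ?thesis using grad_inner_eq[OF c p True cov, of \<phi>] p by (simp add: chart_inv_chart[OF c])
  next
    case False
    then have "p \<notin> closure {p. \<phi> p \<noteq> 0}" using \<phi>(3) by blast
    then have "grad_inner A G \<omega> (differential \<phi>) p = 0" by (rule grad_inner_outside_support)
    moreover have "snd c p \<notin> K" using False int_iff[OF c p] K(2) by blast
    then have "grad \<psi> (snd c p) = 0"
    proof -
      assume n: "snd c p \<notin> K"
      have "frechet_derivative \<psi> (at (snd c p)) v = 0" for v
        by (rule frechet_derivative_outside_support[OF compact_imp_closed[OF K(1)] _ n]) (rule \<psi>0)
      then show ?thesis by (simp add: grad_def vec_eq_iff)
    qed
    ultimately show ?thesis by simp
  qed
  have f2: "(if s < u p then grad_inner A G \<omega> (differential \<phi>) p else 0) = 0" if "p \<notin> fst c" for p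
  proof -
    have "p \<notin> closure {p. \<phi> p \<noteq> 0}" using \<phi>(3) that by blast
    then show ?thesis using grad_inner_outside_support[of p \<phi> \<omega>] by simp
  qed
  show "integrable (riemannian_volume A G) (\<lambda>p. if s < u p then grad_inner A G \<omega> (differential \<phi>) p else 0)"
    by (rule flux_integral(1)[where f="\<lambda>p. if s < u p then grad_inner A G \<omega> (differential \<phi>) p else 0"
          and P="\<lambda>x. s < u (chart_inv c x)" and \<omega>=\<omega> and \<psi>=\<psi>, OF c int])
      (erule f1, erule f2)
  have "(\<integral>p. (if s < u p then grad_inner A G \<omega> (differential \<phi>) p else 0) \<partial>riemannian_volume A G)
    = (\<integral>x. (if s < u (chart_inv c x) then \<omega> c (chart_inv c x) \<bullet> (flux_matrix c x *v grad \<psi> x) else 0) \<partial>lborel)"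
    by (rule flux_integral(2)[where f="\<lambda>p. if s < u p then grad_inner A G \<omega> (differential \<phi>) p else 0"
          and P="\<lambda>x. s < u (chart_inv c x)" and \<omega>=\<omega> and \<psi>=\<psi>, OF c int])
      (erule f1, erule f2)
  also have "\<dots> \<le> 0" using ms(2) unfolding comp_def .
  finally show "(\<integral>p. (if s < u p then grad_inner A G \<omega> (differential \<phi>) p else 0) \<partial>riemannian_volume A G) \<le> 0" .
qed

section \<open>From one chart to the manifold by cutoffs\<close>

lemma test_function_mult:
  assumes "test_function A S \<phi>" "\<And>c. c \<in> A \<Longrightarrow> smooth_on (img c) (\<zeta> \<circ> chart_inv c)"
  shows "test_function A S (\<lambda>p. \<phi> p * \<zeta> p)"
proof -
  let ?K = "closure {p. \<phi> p \<noteq> 0}"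
  have K: "compact ?K" "?K \<subseteq> S" using assms(1) by (simp_all add: test_function_def)
  have cl: "closure {p. \<phi> p * \<zeta> p \<noteq> 0} \<subseteq> ?K" by (rule closure_mono) auto
  then have "closure {p. \<phi> p * \<zeta> p \<noteq> 0} = ?K \<inter> closure {p. \<phi> p * \<zeta> p \<noteq> 0}" by blast
  then have "compact (closure {p. \<phi> p * \<zeta> p \<noteq> 0})"
    using compact_Int_closed[OF K(1) closed_closure[of "{p. \<phi> p * \<zeta> p \<noteq> 0}"]] by simp
  moreover have "smooth_on (img c) ((\<lambda>p. \<phi> p * \<zeta> p) \<circ> chart_inv c)" if "c \<in> A" for c
    using smooth_on_mult[OF test_function_smooth[OF assms(1) that] assms(2)[OF that]]
    unfolding comp_def .
  ultimately show ?thesis using cl K(2) unfolding test_function_def by blast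
qed

lemma cutoff_exists:
  assumes "p \<in> int_mfd A"
  obtains c \<zeta> W where "c \<in> A" "test_function A (int_mfd A) \<zeta>" "\<And>q. 0 \<le> \<zeta> q" "\<And>q. \<zeta> q \<le> 1"
    "closure {q. \<zeta> q \<noteq> 0} \<subseteq> fst c \<inter> int_mfd A" "open W" "p \<in> W" "\<And>q. q \<in> W \<Longrightarrow> \<zeta> q = 1"
proof -
  obtain c where c: "c \<in> A" "p \<in> fst c" by (rule chart_cover)
  have "snd c p \<in> interior (img c)" using int_iff[OF c] assms by simp
  then obtain e where e: "0 < e" "cball (snd c p) e \<subseteq> interior (img c)"
    using open_contains_cball[of "interior (img c)"] open_interior by blast
  obtain b :: "real^'n \<Rightarrow> real" where b: "smooth b" "\<And>x. 0 \<le> b x" "\<And>x. b x \<le> 1"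
    "\<And>x. x \<in> cball (snd c p) (e/2) \<Longrightarrow> b x = 1" "\<And>x. x \<notin> ball (snd c p) (2 * (e/2)) \<Longrightarrow> b x = 0"
    using smooth_bump_exists[of "e/2" "snd c p"] e(1) by (metis half_gt_zero)
  have t: "test_fun (interior (img c)) b"
    by (rule test_funI[OF b(1) compact_cball[of "snd c p" e] e(2)]) (use b(5) in simp)
  let ?W = "fst c \<inter> snd c -` ball (snd c p) (e/2)"
  show ?thesis
  proof (rule that[of c "pullback c b" ?W])
    show "open ?W" by (rule continuous_open_preimage[OF continuous_chart[OF c(1)] open_chart[OF c(1)] open_ball])
    show "pullback c b q = 1" if "q \<in> ?W" for q
      using that b(4)[of "snd c q"] by (simp add: pullback_def)
    show "0 \<le> pullback c b q" "pullback c b q \<le> 1" for q using b(2,3) by (simp_all add: pullback_def)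
  qed (use test_function_pullback[OF c(1) t] c e(1) in auto)
qed

text \<open>A partition of unity without division: \<open>\<phi> = \<phi> \<zeta> + \<phi> (1 - \<zeta>)\<close> removes the open set on which
  the cutoff \<open>\<zeta>\<close> equals \<open>1\<close> from the support of \<open>\<phi>\<close>.\<close>

lemma max_subsolution_induct:
  assumes wd: "weak_differential A (int_mfd A) u \<omega>" and u: "continuous_on UNIV u"
    and sub: "\<And>\<phi>. test_function A (int_mfd A) \<phi> \<Longrightarrow> (\<And>p. 0 \<le> \<phi> p) \<Longrightarrow>
      (\<integral>p. grad_inner A G \<omega> (differential \<phi>) p \<partial>riemannian_volume A G) \<le> 0"
    and int: "\<And>p. s < u p \<Longrightarrow> p \<in> int_mfd A"
    and J: "finite J" "\<And>p. p \<in> J \<Longrightarrow> c p \<in> A" "\<And>p. p \<in> J \<Longrightarrow> test_function A (int_mfd A) (\<zeta> p)"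
      "\<And>p q. p \<in> J \<Longrightarrow> 0 \<le> \<zeta> p q" "\<And>p q. p \<in> J \<Longrightarrow> \<zeta> p q \<le> 1"
      "\<And>p. p \<in> J \<Longrightarrow> closure {q. \<zeta> p q \<noteq> 0} \<subseteq> fst (c p) \<inter> int_mfd A"
      "\<And>p. p \<in> J \<Longrightarrow> open (W p)" "\<And>p q. p \<in> J \<Longrightarrow> q \<in> W p \<Longrightarrow> \<zeta> p q = 1"
    and \<phi>: "test_function A UNIV \<phi>" "\<And>p. 0 \<le> \<phi> p"
      "closure {p. \<phi> p \<noteq> 0} \<inter> {p. s < u p} \<subseteq> (\<Union>p\<in>J. W p)"
  shows "integrable (riemannian_volume A G) (\<lambda>p. if s < u p then grad_inner A G \<omega> (differential \<phi>) p else 0)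
    \<and> (\<integral>p. (if s < u p then grad_inner A G \<omega> (differential \<phi>) p else 0) \<partial>riemannian_volume A G) \<le> 0"
  using J \<phi>
proof (induction J arbitrary: \<phi> rule: finite_induct)
  \<comment> \<open>With no cutoff left the support of \<phi> is disjoint from
    \<open>{p. s < u p}\<close>, so the integrand vanishes identically even if \<phi> does
    not.\<close>
  case empty
  have "(if s < u p then grad_inner A G \<omega> (differential \<phi>) p else 0) = 0" for p
  proof (cases "s < u p")
    case True
    then have "p \<notin> closure {p. \<phi> p \<noteq> 0}" using empty.prems by blast
    then show ?thesis using grad_inner_outside_support[of p \<phi> \<omega>] by simp
  qed simp
  then show ?case by simp
next
  case (insert j J)
  note wd_cov = wd[unfolded weak_differential_def, THEN conjunct1]
  let ?\<zeta> = "\<zeta> j"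
  have j: "c j \<in> A" "test_function A (int_mfd A) ?\<zeta>" "\<And>q. 0 \<le> ?\<zeta> q" "\<And>q. ?\<zeta> q \<le> 1"
    "closure {q. ?\<zeta> q \<noteq> 0} \<subseteq> fst (c j) \<inter> int_mfd A" "open (W j)" "\<And>q. q \<in> W j \<Longrightarrow> ?\<zeta> q = 1"
    using insert.prems(1-7) by auto
  have s1: "smooth_on (img c') (?\<zeta> \<circ> chart_inv c')" if "c' \<in> A" for c'
    by (rule test_function_smooth[OF j(2) that])
  have s2: "smooth_on (img c') ((\<lambda>q. 1 - ?\<zeta> q) \<circ> chart_inv c')" if "c' \<in> A" for c'
    using smooth_on_one_minus[OF s1[OF that]] unfolding comp_def .
  let ?a = "\<lambda>p. \<phi> p * ?\<zeta> p" and ?b = "\<lambda>p. \<phi> p * (1 - ?\<zeta> p)"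
  have ta: "test_function A UNIV ?a" by (rule test_function_mult[OF insert.prems(8) s1])
  have tb: "test_function A UNIV ?b" by (rule test_function_mult[OF insert.prems(8) s2])
  have "closure {p. ?a p \<noteq> 0} \<subseteq> closure {q. ?\<zeta> q \<noteq> 0}" by (rule closure_mono) auto
  then have ca: "closure {p. ?a p \<noteq> 0} \<subseteq> fst (c j) \<inter> int_mfd A" using j(5) by blast
  have na: "0 \<le> ?a p" for p using insert.prems(9) j(3) by simp
  have nb: "0 \<le> ?b p" for p using insert.prems(9) j(4) by simp
  note A1 = local_max_subsolution[OF j(1) wd u sub ta na ca, of s]
  have cb: "closure {p. ?b p \<noteq> 0} \<inter> {p. s < u p} \<subseteq> (\<Union>p\<in>J. W p)"
  proof -
    have "closure {p. ?b p \<noteq> 0} \<subseteq> closure {p. \<phi> p \<noteq> 0}" by (rule closure_mono) auto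
    moreover have "closure {p. ?b p \<noteq> 0} \<subseteq> - W j"
      by (rule closure_minimal) (use j(6,7) in auto)
    moreover have "closure {p. \<phi> p \<noteq> 0} \<inter> {p. s < u p} \<subseteq> W j \<union> (\<Union>p\<in>J. W p)"
      using insert.prems(10) by simp
    ultimately show ?thesis by blast
  qed
  have B1: "integrable (riemannian_volume A G) (\<lambda>p. if s < u p then grad_inner A G \<omega> (differential ?b) p else 0)
    \<and> (\<integral>p. (if s < u p then grad_inner A G \<omega> (differential ?b) p else 0) \<partial>riemannian_volume A G) \<le> 0"
  proof (rule insert.IH)
    show "test_function A UNIV ?b" by (rule tb)
    show "0 \<le> ?b p" for p by (rule nb)
    show "closure {p. ?b p \<noteq> 0} \<inter> {p. s < u p} \<subseteq> (\<Union>p\<in>J. W p)" by (rule cb)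
  qed (use insert.prems(1-7) in auto)
  \<comment> \<open>The differential is additive where both pieces are differentiable in the full
    sense. The truncation restricts the claim to points with s < u, which are interior.\<close>
  have add: "(if s < u p then grad_inner A G \<omega> (differential \<phi>) p else 0)
      = (if s < u p then grad_inner A G \<omega> (differential ?a) p else 0)
        + (if s < u p then grad_inner A G \<omega> (differential ?b) p else 0)" for p
  proof (cases "s < u p")
    case True
    then have p: "p \<in> int_mfd A" by (rule int)
    obtain c' where c': "c' \<in> A" "p \<in> fst c'" by (rule chart_cover)
    note df = test_function_differentiable[OF _ c' p]
    let ?x = "snd c' p"
    have "((\<lambda>y. (?a \<circ> chart_inv c') y + (?b \<circ> chart_inv c') y) has_derivative
      (\<lambda>v. frechet_derivative (?a \<circ> chart_inv c') (at ?x) v + frechet_derivative (?b \<circ> chart_inv c') (at ?x) v)) (at ?x)"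
      by (rule has_derivative_add[OF frechet_derivative_works[THEN iffD1, OF df[OF ta]]
            frechet_derivative_works[THEN iffD1, OF df[OF tb]]])
    moreover have ab: "(\<lambda>y. (?a \<circ> chart_inv c') y + (?b \<circ> chart_inv c') y) = \<phi> \<circ> chart_inv c'"
      by (rule ext) (simp add: algebra_simps)
    ultimately have "((\<phi> \<circ> chart_inv c') has_derivative
      (\<lambda>v. frechet_derivative (?a \<circ> chart_inv c') (at ?x) v + frechet_derivative (?b \<circ> chart_inv c') (at ?x) v)) (at ?x)"
      by (simp only: ab)
    then have "frechet_derivative (\<phi> \<circ> chart_inv c') (at ?x)
      = (\<lambda>v. frechet_derivative (?a \<circ> chart_inv c') (at ?x) v + frechet_derivative (?b \<circ> chart_inv c') (at ?x) v)"
      by (rule frechet_derivative_eq)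
    then have "grad (\<phi> \<circ> chart_inv c') ?x = grad (?a \<circ> chart_inv c') ?x + grad (?b \<circ> chart_inv c') ?x"
      by (simp add: grad_def vec_eq_iff)
    then have "grad_inner A G \<omega> (differential \<phi>) p
      = grad_inner A G \<omega> (differential ?a) p + grad_inner A G \<omega> (differential ?b) p"
      unfolding grad_inner_eq[OF c' p wd_cov df[OF ta]] grad_inner_eq[OF c' p wd_cov df[OF tb]]
        grad_inner_eq[OF c' p wd_cov df[OF insert.prems(8)]]
      by (simp only: matrix_vector_right_distrib inner_add_right)
    then show ?thesis using True by simp
  qed simp
  show ?case unfolding add using A1 B1 by simp
qed

lemma max_subsolution_manifold:
  assumes wd: "weak_differential A (int_mfd A) u \<omega>" and u: "continuous_on UNIV u"
    and sub: "\<And>\<phi>. test_function A (int_mfd A) \<phi> \<Longrightarrow> (\<And>p. 0 \<le> \<phi> p) \<Longrightarrow>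
      (\<integral>p. grad_inner A G \<omega> (differential \<phi>) p \<partial>riemannian_volume A G) \<le> 0"
    and s: "{p. s \<le> u p} \<subseteq> int_mfd A"
    and \<phi>: "test_function A UNIV \<phi>" "\<And>p. 0 \<le> \<phi> p"
  shows "(\<integral>p. (if s < u p then grad_inner A G \<omega> (differential \<phi>) p else 0) \<partial>riemannian_volume A G) \<le> 0"
proof -
  \<comment> \<open>The non-strict inequality makes this set closed, hence compact, and by
    hypothesis it still lies in the interior.\<close>
  define K where "K = closure {p. \<phi> p \<noteq> 0} \<inter> {p. s \<le> u p}"
  have K: "compact K" unfolding K_def
    using \<phi>(1) closed_Collect_le[OF continuous_on_const u, of s] unfolding test_function_def
    by (intro compact_Int_closed) auto
  \<comment> \<open>Chart, cutoff and neighbourhood are bundled into one triple, so that a single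
    application of choice selects them together.\<close>
  define good where "good = (\<lambda>p t. fst t \<in> A \<and> test_function A (int_mfd A) (fst (snd t)) \<and>
    (\<forall>q. 0 \<le> fst (snd t) q) \<and> (\<forall>q. fst (snd t) q \<le> 1) \<and>
    closure {q. fst (snd t) q \<noteq> 0} \<subseteq> fst (fst t) \<inter> int_mfd A \<and>
    open (snd (snd t)) \<and> p \<in> snd (snd t) \<and> (\<forall>q\<in>snd (snd t). fst (snd t) q = 1))"
  have "\<forall>p\<in>K. \<exists>t. good p t"
  proof
    fix p assume "p \<in> K"
    then have "p \<in> int_mfd A" using s unfolding K_def by blast
    then obtain c \<zeta> W where "c \<in> A" "test_function A (int_mfd A) \<zeta>" "\<And>q. 0 \<le> \<zeta> q" "\<And>q. \<zeta> q \<le> 1"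
      "closure {q. \<zeta> q \<noteq> 0} \<subseteq> fst c \<inter> int_mfd A" "open W" "p \<in> W" "\<And>q. q \<in> W \<Longrightarrow> \<zeta> q = 1"
      by (rule cutoff_exists) blast
    then have "good p (c, \<zeta>, W)" unfolding good_def fst_conv snd_conv by (intro conjI allI ballI)
    then show "\<exists>t. good p t" ..
  qed
  from bchoice[OF this] obtain t where t: "\<forall>p\<in>K. good p (t p)" ..
  let ?c = "\<lambda>p. fst (t p)" and ?\<zeta> = "\<lambda>p. fst (snd (t p))" and ?W = "\<lambda>p. snd (snd (t p))"
  have cw: "?c p \<in> A" "test_function A (int_mfd A) (?\<zeta> p)" "0 \<le> ?\<zeta> p q" "?\<zeta> p q \<le> 1"
    "closure {q. ?\<zeta> p q \<noteq> 0} \<subseteq> fst (?c p) \<inter> int_mfd A" "open (?W p)" "p \<in> ?W p"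
    "q \<in> ?W p \<Longrightarrow> ?\<zeta> p q = 1" if "p \<in> K" for p q
    using bspec[OF t that] unfolding good_def by simp_all
  have kc: "K \<subseteq> (\<Union>p\<in>K. ?W p)" using cw(7) by (auto simp del: split_paired_Ex)
  obtain J where J: "J \<subseteq> K" "finite J" "K \<subseteq> (\<Union>p\<in>J. ?W p)"
    by (rule compactE_image[OF K _ kc]) (erule cw(6), blast)
  have int: "p \<in> int_mfd A" if "s < u p" for p
    using subsetD[OF s, of p] that by simp
  have "closure {p. \<phi> p \<noteq> 0} \<inter> {p. s < u p} \<subseteq> K" unfolding K_def by auto
  with J(3) have "closure {p. \<phi> p \<noteq> 0} \<inter> {p. s < u p} \<subseteq> (\<Union>p\<in>J. ?W p)" by (rule order_trans[rotated])
  note cov = this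
  show ?thesis
  proof (rule conjunct2[OF max_subsolution_induct[where J=J and c="?c" and \<zeta>="?\<zeta>" and W="?W", OF wd u]])
    fix p q assume "p \<in> J"
    then have p: "p \<in> K" using J(1) by blast
    show "?c p \<in> A" "test_function A (int_mfd A) (?\<zeta> p)" "0 \<le> ?\<zeta> p q" "?\<zeta> p q \<le> 1"
      "closure {q. ?\<zeta> p q \<noteq> 0} \<subseteq> fst (?c p) \<inter> int_mfd A" "open (?W p)"
      using cw[OF p] by auto
    show "?\<zeta> p q = 1" if "q \<in> ?W p" by (rule cw(8)[OF p that])
  next
    show "(\<integral>p. grad_inner A G \<omega> (differential \<phi>) p \<partial>riemannian_volume A G) \<le> 0"
      if "test_function A (int_mfd A) \<phi>" "\<And>p. 0 \<le> \<phi> p" for \<phi> by (rule sub[OF that])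
    show "p \<in> int_mfd A" if "s < u p" for p by (rule int[OF that])
  qed (rule J(2) \<phi> cov)+
qed

text \<open>Near the boundary the truncated differential is 0, so integrability of \<omega> on
  compact subsets of the interior suffices for integrability up to the boundary. The weak gradient
  identity is tested only in the interior of the chart image and comes from
  \<open>max_weak_gradient\<close>.\<close>

lemma weak_differential_max:
  assumes wd: "weak_differential A (int_mfd A) u \<omega>" and u: "continuous_on UNIV u"
    and s: "{p. s \<le> u p} \<subseteq> int_mfd A"
  shows "weak_differential A UNIV (\<lambda>p. max (u p) s) (\<lambda>c p. if s < u p then \<omega> c p else 0)"
  unfolding weak_differential_def
proof (intro conjI ballI)
  show "covector_field A (\<lambda>c p. if s < u p then \<omega> c p else 0)"
    unfolding covector_field_def
  proof (intro ballI)
    fix c c' p assume c: "c \<in> A" "c' \<in> A" "p \<in> fst c \<inter> fst c'"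
    have "\<omega> c p = transpose (Defs.jacobian c c' p) *v \<omega> c' p"
      using wd c unfolding weak_differential_def covector_field_def by blast
    then show "(if s < u p then \<omega> c p else 0) = transpose (Defs.jacobian c c' p) *v (if s < u p then \<omega> c' p else 0)"
      by (cases "s < u p") simp_all
  qed
next
  fix c assume c: "c \<in> A"
  let ?v = "(\<lambda>p. max (u p) s) \<circ> chart_inv c" and ?w = "(\<lambda>p. if s < u p then \<omega> c p else 0) \<circ> chart_inv c"
  have uc: "continuous_on (img c) (u \<circ> chart_inv c)"
    unfolding comp_def by (rule continuous_on_compose2[OF u continuous_chart_inv[OF c]]) simp
  have vc: "continuous_on (img c) ?v"
    using uc unfolding comp_def by (intro continuous_intros)
  have imgU: "snd c ` (fst c \<inter> UNIV) = img c" by simp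
  note wc = weak_differential_chart[OF c wd]
  have inV: "x \<in> interior (img c)" if "x \<in> img c" "s \<le> u (chart_inv c x)" for x
  proof -
    have "chart_inv c x \<in> int_mfd A" using s that(2) by blast
    then show ?thesis using int_iff[OF c chart_inv_in[OF c that(1)]] chart_chart_inv[OF c that(1)] by simp
  qed
  show "L2_loc (snd c ` (fst c \<inter> UNIV)) ?v"
    unfolding imgU L2_loc_def set_borel_measurable_def
  proof (intro conjI allI impI)
    show "(\<lambda>x. indicat_real (img c) x *\<^sub>R ?v x) \<in> borel_measurable lborel"
      using borel_measurable_continuous_on_indicator[OF img_borel[OF c] vc] by simp
    fix K assume K: "compact K \<and> K \<subseteq> img c"
    have "continuous_on K (\<lambda>x. (norm (?v x))\<^sup>2)"
      by (intro continuous_on_power continuous_on_norm continuous_on_subset[OF vc]) (use K in blast)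
    then show "set_integrable lborel K (\<lambda>x. (norm (?v x))\<^sup>2)"
      unfolding set_integrable_def using K by (intro borel_integrable_compact) auto
  qed
  show "L2_loc (snd c ` (fst c \<inter> UNIV)) ?w"
    unfolding imgU L2_loc_def set_borel_measurable_def
  proof (intro conjI allI impI)
    obtain T where T: "open T" "img c \<inter> (u \<circ> chart_inv c) -` {s<..} = img c \<inter> T"
      using continuous_openin_preimage_gen[OF uc open_greaterThan] unfolding openin_open by blast
    have P: "img c \<inter> (u \<circ> chart_inv c) -` {s<..} \<in> sets borel" unfolding T(2) using T(1) img_borel[OF c] by simp
    have m: "(\<lambda>x. indicat_real (interior (img c)) x *\<^sub>R (\<omega> c \<circ> chart_inv c) x) \<in> borel_measurable borel"
      using wc(1) by (simp add: L2_loc_def set_borel_measurable_def)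
    \<comment> \<open>\<omega> is known to be measurable on the interior of the image only; the set
      s < u is contained in it, so the extra indicator changes nothing.\<close>
    have eq: "indicat_real (img c) x *\<^sub>R ?w x = indicat_real (img c \<inter> (u \<circ> chart_inv c) -` {s<..}) x *\<^sub>R
        (indicat_real (interior (img c)) x *\<^sub>R (\<omega> c \<circ> chart_inv c) x)" for x
      using inV[of x] by (cases "x \<in> img c") (auto simp: indicator_def)
    show "(\<lambda>x. indicat_real (img c) x *\<^sub>R ?w x) \<in> borel_measurable lborel"
      unfolding eq using P m by measurable
    fix K assume K: "compact K \<and> K \<subseteq> img c"
    \<comment> \<open>K may touch the hyperplane, but its part where s \<le> u is closed in K and
      avoids the boundary, so it is compact in the interior.\<close>
    define K' where "K' = K \<inter> (u \<circ> chart_inv c) -` {s..}"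
    have "closed K'" unfolding K'_def
      by (rule continuous_closed_preimage[OF continuous_on_subset[OF uc]]) (use K compact_imp_closed in auto)
    then have K': "compact K'" "K' \<subseteq> interior (img c)"
    proof -
      assume "closed K'"
      then have "compact (K \<inter> K')" using K by (intro compact_Int_closed) auto
      moreover have "K \<inter> K' = K'" unfolding K'_def by blast
      ultimately show "compact K'" by simp
      show "K' \<subseteq> interior (img c)" unfolding K'_def using inV K by (auto simp: comp_def)
    qed
    have i: "set_integrable lborel K' (\<lambda>x. (norm ((\<omega> c \<circ> chart_inv c) x))\<^sup>2)"
      using wc(1) K' unfolding L2_loc_def by blast
    have "set_integrable lborel (K' \<inter> (img c \<inter> (u \<circ> chart_inv c) -` {s<..})) (\<lambda>x. (norm ((\<omega> c \<circ> chart_inv c) x))\<^sup>2)"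
      by (rule set_integrable_subset[OF i]) (use P K'(1) in \<open>auto simp: borel_compact\<close>)
    moreover have "indicat_real (K' \<inter> (img c \<inter> (u \<circ> chart_inv c) -` {s<..})) x *\<^sub>R (norm ((\<omega> c \<circ> chart_inv c) x))\<^sup>2
        = indicat_real K x *\<^sub>R (norm (?w x))\<^sup>2" for x
      using K by (auto simp: indicator_def K'_def)
    ultimately show "set_integrable lborel K (\<lambda>x. (norm (?w x))\<^sup>2)"
      unfolding set_integrable_def by simp
  qed
  have uV: "continuous_on (interior (img c)) (u \<circ> chart_inv c)"
    by (rule continuous_on_subset[OF uc interior_subset])
  show "weak_gradient_on (interior (snd c ` (fst c \<inter> UNIV))) ?v ?w"
    using max_weak_gradient[OF open_interior uV wc, of s] unfolding imgU comp_def .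
qed

lemma max_weak_neumann_subsolution:
  assumes ws: "weakly_subharmonic A G (int_mfd A) u" and u: "continuous_on UNIV u"
    and s: "{p. s \<le> u p} \<subseteq> int_mfd A"
  shows "W12_loc A UNIV (\<lambda>p. max (u p) s)" "weak_neumann_subsolution A G (\<lambda>p. max (u p) s)"
proof -
  obtain \<omega> where wd: "weak_differential A (int_mfd A) u \<omega>"
    and sub0: "\<forall>\<phi>. test_function A (int_mfd A) \<phi> \<and> (\<forall>p. 0 \<le> \<phi> p) \<longrightarrow>
      - (\<integral>p. grad_inner A G \<omega> (differential \<phi>) p \<partial>riemannian_volume A G) \<ge> 0"
    using ws unfolding weakly_subharmonic_def by blast
  have sub: "(\<integral>p. grad_inner A G \<omega> (differential \<phi>) p \<partial>riemannian_volume A G) \<le> 0"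
    if "test_function A (int_mfd A) \<phi>" "\<And>p. 0 \<le> \<phi> p" for \<phi>
    using sub0[rule_format, of \<phi>] that by simp
  let ?\<omega> = "\<lambda>c p. if s < u p then \<omega> c p else 0"
  note wm = weak_differential_max[OF wd u s]
  show "W12_loc A UNIV (\<lambda>p. max (u p) s)" unfolding W12_loc_def using wm by blast
  \<comment> \<open>The truncation depends on the point and not on the chart, so it passes through
    the chart choice hidden in \<open>grad_inner\<close>.\<close>
  have gi: "grad_inner A G ?\<omega> \<eta> p = (if s < u p then grad_inner A G \<omega> \<eta> p else 0)" for \<eta> p
    by (simp add: grad_inner_def Let_def)
  have "- (\<integral>p. grad_inner A G ?\<omega> (differential \<phi>) p \<partial>riemannian_volume A G) \<ge> 0"
    if "test_function A UNIV \<phi> \<and> (\<forall>p. 0 \<le> \<phi> p)" for \<phi>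
    unfolding gi using max_subsolution_manifold[OF wd u sub s, of \<phi>] that by simp
  then show "weak_neumann_subsolution A G (\<lambda>p. max (u p) s)"
    unfolding weak_neumann_subsolution_def weakly_subharmonic_def using wm by blast
qed

end

theorem theorem0p8:
  fixes A :: "('m::{t2_space,second_countable_topology}, 'n::finite) chart set"
    and \<theta> :: "('m, 'n) chart \<Rightarrow> 'm \<Rightarrow> real"
    and G :: "('m, 'n) chart \<Rightarrow> 'm \<Rightarrow> real^'n^'n"
    and u :: "'m \<Rightarrow> real"
  assumes "oriented_riemannian_manifold A \<theta> G"
    and "bdry A \<noteq> {}"
    and "parabolic A G"
    and "continuous_on UNIV u"
    and "W12_loc A (int_mfd A) u"
    and "weakly_subharmonic A G (int_mfd A) u"
    and "bdd_above (range u)"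
  shows "(SUP p. u p) = (SUP p\<in>bdry A. u p)"
proof (rule antisym)
  \<comment> \<open>In the conditionally complete order of the reals this monotonicity rests on the
    boundary being nonempty and u being bounded above.\<close>
  show "(SUP p\<in>bdry A. u p) \<le> (SUP p. u p)"
    by (rule cSUP_subset_mono[OF assms(2,7)]) auto
  show "(SUP p. u p) \<le> (SUP p\<in>bdry A. u p)"
  proof (rule ccontr)
    assume "\<not> (SUP p. u p) \<le> (SUP p\<in>bdry A. u p)"
    then obtain s where s: "(SUP p\<in>bdry A. u p) < s" "s < (SUP p. u p)" using dense not_le by blast
    interpret riemannian_atlas A G
      using assms(1) by unfold_locales (simp_all add: oriented_riemannian_manifold_def)
    have bd: "bdd_above (u ` bdry A)" using assms(7) by (rule bdd_above_mono) auto
    have bs: "u p < s" if "p \<in> bdry A" for p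
      using cSUP_upper[OF that bd] s(1) by linarith
    then have sub: "{p. s \<le> u p} \<subseteq> int_mfd A" unfolding int_mfd_def by force
    obtain B where B: "\<And>p. u p \<le> B" using assms(7) by (auto simp: bdd_above_def)
    have "continuous_on UNIV (\<lambda>p. max (u p) s)" using assms(4) by (intro continuous_intros)
    moreover have "bdd_above (range (\<lambda>p. max (u p) s))"
      by (rule bdd_aboveI[of _ "max B s"]) (use B in \<open>auto intro: max.coboundedI1 simp: le_max_iff_disj\<close>)
    ultimately obtain k where k: "\<And>p. max (u p) s = k"
      using assms(3) max_weak_neumann_subsolution[OF assms(6,4) sub] unfolding parabolic_def by blast
    \<comment> \<open>The common value k is read off at a boundary point, where u is known to lie
      below s.\<close>
    obtain b where "b \<in> bdry A" using assms(2) by blast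
    then have "k = s" using bs k[of b] by (metis max.absorb2 less_imp_le)
    then have "u p \<le> s" for p using k[of p] by (metis max.cobounded1)
    then have "(SUP p. u p) \<le> s" by (intro cSUP_least) auto
    then show False using s(2) by linarith
  qed
qed

end
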